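(* Let $G=\mathrm{SL}(2,\mathbb H)$, let $A,B\in G$ be regular loxodromic, set $C=(AB)^{-1}$, and assume that $C$ is also regular loxodromic. Let $\mathfrak g=\mathfrak{sl}(2,\mathbb H)$ and $\mathfrak z(g)=\ker(1-\mathrm{Ad}_g)\subset\mathfrak g$ for $g\in G$. Suppose $$\mathfrak z(A)\cap\mathfrak z(B)=0.$$ Then the multiplication map $$F:[A]\times[B]\longrightarrow G,\qquad F(A',B')=A'B',$$ is transverse to the conjugacy class $[C^{-1}]$ at $(A,B)$. Consequently, $$R=\{(A',B')\in[A]\times[B]:(A'B')^{-1}\in[C]\}$$ is, near $(A,B)$, a real-analytic submanifold of dimension $21$. If, in addition, $A$ and $B$ have disjoint fixed point sets, then a neighbourhood of $[(A,B)]$ in the quotient $R/G$ (by simultaneous conjugation) is a real-analytic orbifold of dimension $6$.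
   Context: $\mathbb H$ denotes the quaternions with norm $|\cdot|$; $\mathbb S^2=\{I\in\mathbb H: I^2=-1\}$; $e^{I\theta}=\cos\theta+I\sin\theta$. The Dieudonné determinant of $\left(\begin{smallmatrix}a&b\\c&d\end{smallmatrix}\right)\in\mathrm{GL}(2,\mathbb H)$ is $|ad-aca^{-1}b|$ if $a\neq0$ and $|cb|$ if $a=0$; $\mathrm{SL}(2,\mathbb H)$ is the 15-dimensional Lie group of matrices of Dieudonné determinant $1$, with Lie algebra $\mathfrak{sl}(2,\mathbb H)$, acting on $\widehat{\mathbb H}=\mathbb H\cup\{\infty\}$ by $z\mapsto(az+b)(cz+d)^{-1}$; fixed points are taken in $\widehat{\mathbb H}$. $A\in\mathrm{SL}(2,\mathbb H)$ is regular loxodromic if it is conjugate in $\mathrm{SL}(2,\mathbb H)$ to $\mathrm{diag}(re^{I\theta},r^{-1}e^{J\varphi})$ with $r>1$, $\theta,\varphi\in(0,\pi)$, $I,J\in\mathbb S^2$. $[A]$ denotes the conjugacy class of $A$ in $G$; conjugacy classes of regular loxodromic elements are embedded real-analytic submanifolds of $G$ of codimension $3$. Transversality at $(A,B)$ means $\mathrm{Im}\,dF_{(A,B)}+T_{AB}[AB]=T_{AB}G$. *)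

theory Defs
  imports "HOL-Analysis.Analysis" "HOL-Algebra.Bij"
begin

section \<open>Quaternions\<close>

datatype quat = Quat (qRe: real) (qI: real) (qJ: real) (qK: real)

lemma quat_eq_iff:
  "x = y \<longleftrightarrow> qRe x = qRe y \<and> qI x = qI y \<and> qJ x = qJ y \<and> qK x = qK y"
  by (cases x; cases y) simp

instantiation quat :: real_algebra_1
begin

definition "0 = Quat 0 0 0 0"
definition "1 = Quat 1 0 0 0"
definition "x + y = Quat (qRe x + qRe y) (qI x + qI y) (qJ x + qJ y) (qK x + qK y)"
definition "- x = Quat (- qRe x) (- qI x) (- qJ x) (- qK x)"
definition "x - y = Quat (qRe x - qRe y) (qI x - qI y) (qJ x - qJ y) (qK x - qK y)"
definition "scaleR r x = Quat (r * qRe x) (r * qI x) (r * qJ x) (r * qK x)"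
definition "x * y = Quat
  (qRe x * qRe y - qI x * qI y - qJ x * qJ y - qK x * qK y)
  (qRe x * qI y + qI x * qRe y + qJ x * qK y - qK x * qJ y)
  (qRe x * qJ y - qI x * qK y + qJ x * qRe y + qK x * qI y)
  (qRe x * qK y + qI x * qJ y - qJ x * qI y + qK x * qRe y)"

lemmas quat_ring_defs =
  zero_quat_def one_quat_def plus_quat_def uminus_quat_def minus_quat_def
  scaleR_quat_def times_quat_def

instance
  by standard (simp_all add: quat_ring_defs quat_eq_iff algebra_simps)

end

instantiation quat :: real_inner
begin

definition inner_quat_def:
  "inner x y = qRe x * qRe y + qI x * qI y + qJ x * qJ y + qK x * qK y"
definition norm_quat_def:
  "norm x = sqrt ((qRe x)\<^sup>2 + (qI x)\<^sup>2 + (qJ x)\<^sup>2 + (qK x)\<^sup>2)"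
definition sgn_quat_def: "sgn (x::quat) = x /\<^sub>R norm x"
definition dist_quat_def: "dist (x::quat) y = norm (x - y)"
definition uniformity_quat_def [code del]:
  "(uniformity :: (quat \<times> quat) filter) = (INF e\<in>{0 <..}. principal {(x, y). dist x y < e})"
definition open_quat_def [code del]:
  "open (U :: quat set) \<longleftrightarrow> (\<forall>x\<in>U. eventually (\<lambda>(x', y). x' = x \<longrightarrow> y \<in> U) uniformity)"

instance
proof
  fix x y z :: quat and r :: real
  show "inner x y = inner y x"
    by (simp add: inner_quat_def mult.commute)
  show "inner (x + y) z = inner x z + inner y z"
    by (simp add: inner_quat_def plus_quat_def algebra_simps)
  show "inner (scaleR r x) y = r * inner x y"
    by (simp add: inner_quat_def scaleR_quat_def algebra_simps)
  show "0 \<le> inner x x"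
    by (simp add: inner_quat_def)
  show "inner x x = 0 \<longleftrightarrow> x = 0"
    by (simp add: inner_quat_def zero_quat_def quat_eq_iff add_nonneg_eq_0_iff)
  show "norm x = sqrt (inner x x)"
    by (simp add: inner_quat_def norm_quat_def power2_eq_square)
qed (rule sgn_quat_def dist_quat_def uniformity_quat_def open_quat_def)+

end

instantiation quat :: real_normed_div_algebra
begin

definition inverse_quat_def:
  "inverse x = Quat (qRe x) (- qI x) (- qJ x) (- qK x) /\<^sub>R (norm x)\<^sup>2"
definition divide_quat_def: "x div (y::quat) = x * inverse y"

instance
proof
  fix x y :: quat
  have n2: "(norm z)\<^sup>2 = (qRe z)\<^sup>2 + (qI z)\<^sup>2 + (qJ z)\<^sup>2 + (qK z)\<^sup>2" for z :: quat
    by (simp add: norm_quat_def)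
  show "inverse x * x = 1" "x * inverse x = 1" if "x \<noteq> 0"
  proof -
    define d where "d = inverse ((norm x)\<^sup>2)"
    have "(norm x)\<^sup>2 * d = 1"
      using that by (simp add: d_def)
    then have d: "(qRe x * qRe x + qI x * qI x + qJ x * qJ x + qK x * qK x) * d = 1"
      unfolding n2 by (simp only: power2_eq_square)
    show "inverse x * x = 1"
      unfolding inverse_quat_def d_def[symmetric] quat_ring_defs quat_eq_iff quat.sel
      using d by (simp add: algebra_simps)
    show "x * inverse x = 1"
      unfolding inverse_quat_def d_def[symmetric] quat_ring_defs quat_eq_iff quat.sel
      using d by (simp add: algebra_simps)
  qed
  show "x div y = x * inverse y" by (rule divide_quat_def)
  show "inverse (0::quat) = 0"
    by (simp add: inverse_quat_def quat_ring_defs)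
  have "(norm (x * y))\<^sup>2 = (norm x * norm y)\<^sup>2"
    unfolding power_mult_distrib n2 times_quat_def quat.sel
    by algebra
  then show "norm (x * y) = norm x * norm y"
    by simp
qed

end

instantiation quat :: euclidean_space
begin

definition Basis_quat_def:
  "Basis = {Quat 1 0 0 0, Quat 0 1 0 0, Quat 0 0 1 0, Quat 0 0 0 1}"

instance
proof
  show "(Basis :: quat set) \<noteq> {}" "finite (Basis :: quat set)"
    by (simp_all add: Basis_quat_def)
  show "inner u v = (if u = v then 1 else 0)" if "u \<in> Basis" "v \<in> Basis" for u v :: quat
    using that unfolding Basis_quat_def inner_quat_def
    by (elim insertE emptyE; simp)
  show "(\<forall>u\<in>Basis. inner x u = 0) \<longleftrightarrow> x = 0" for x :: quat
    unfolding Basis_quat_def inner_quat_def zero_quat_def quat_eq_iff by simp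
qed

end

definition imag_units :: "quat set"
  where "imag_units = {I. I * I = - 1}"

definition qcis :: "quat \<Rightarrow> real \<Rightarrow> quat"
  where "qcis I \<theta> = of_real (cos \<theta>) + I * of_real (sin \<theta>)"


section \<open>The group \<open>SL(2, H)\<close>\<close>

type_synonym qmat = "quat^2^2"

definition mat22 :: "quat \<Rightarrow> quat \<Rightarrow> quat \<Rightarrow> quat \<Rightarrow> qmat"
  where "mat22 a b c d = vector [vector [a, b], vector [c, d]]"

definition dieudonne_det :: "qmat \<Rightarrow> real"
  where "dieudonne_det M =
    (let a = M$1$1; b = M$1$2; c = M$2$1; d = M$2$2 in
      if a \<noteq> 0 then norm (a * d - a * c * inverse a * b) else norm (c * b))"

definition SL2H :: "qmat set"
  where "SL2H = {M. invertible M \<and> dieudonne_det M = 1}"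

definition conj_mat :: "qmat \<Rightarrow> qmat \<Rightarrow> qmat"
  where "conj_mat P X = P ** X ** matrix_inv P"

definition conj_class :: "qmat \<Rightarrow> qmat set"
  where "conj_class A = {conj_mat P A |P. P \<in> SL2H}"

definition regular_loxodromic :: "qmat \<Rightarrow> bool"
  where "regular_loxodromic A \<longleftrightarrow> A \<in> SL2H \<and>
    (\<exists>r \<theta> \<phi> I J. r > 1 \<and> \<theta> \<in> {0<..<pi} \<and> \<phi> \<in> {0<..<pi} \<and> I \<in> imag_units \<and> J \<in> imag_units \<and>
      A \<in> conj_class (mat22 (r *\<^sub>R qcis I \<theta>) 0 0 (inverse r *\<^sub>R qcis J \<phi>)))"

text \<open>The point at infinity of \<open>H \<union> {\<infinity>}\<close> is \<^term>\<open>None\<close>.\<close>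

fun moebius :: "qmat \<Rightarrow> quat option \<Rightarrow> quat option"
  where
    "moebius M (Some z) =
      (if M$2$1 * z + M$2$2 = 0 then None
       else Some ((M$1$1 * z + M$1$2) * inverse (M$2$1 * z + M$2$2)))"
  | "moebius M None = (if M$2$1 = 0 then None else Some (M$1$1 * inverse (M$2$1)))"

definition fixed_points :: "qmat \<Rightarrow> quat option set"
  where "fixed_points M = {z. moebius M z = z}"


section \<open>Real-analytic maps and embedded submanifolds of Euclidean spaces\<close>

text \<open>
  \<open>f\<close> is real-analytic at \<open>p\<close> if it is the sum of a power series
  \<open>\<Sum>\<^sub>\<alpha> (x - p)\<^sup>\<alpha> c\<^sub>\<alpha>\<close> near \<open>p\<close>. The multi-indices \<open>\<alpha>\<close> are the functions from the
  standard basis to the naturals; since they are only relevant on the basis, they are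
  taken to be extensional there.
\<close>

definition real_analytic_at :: "('a::euclidean_space \<Rightarrow> 'b::euclidean_space) \<Rightarrow> 'a \<Rightarrow> bool"
  where "real_analytic_at f p \<longleftrightarrow>
    (\<exists>r>0. \<exists>c :: ('a \<Rightarrow> nat) \<Rightarrow> 'b. \<forall>x\<in>ball p r.
      ((\<lambda>\<alpha>. (\<Prod>b\<in>Basis. ((x - p) \<bullet> b) ^ \<alpha> b) *\<^sub>R c \<alpha>) has_sum f x) (Basis \<rightarrow>\<^sub>E UNIV))"

definition real_analytic_on :: "('a::euclidean_space \<Rightarrow> 'b::euclidean_space) \<Rightarrow> 'a set \<Rightarrow> bool"
  where "real_analytic_on f S \<longleftrightarrow> (\<forall>p\<in>S. real_analytic_at f p)"

definition analytic_diffeo ::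
    "('a::euclidean_space \<Rightarrow> 'b::euclidean_space) \<Rightarrow> 'a set \<Rightarrow> 'b set \<Rightarrow> bool"
  where "analytic_diffeo f U V \<longleftrightarrow> open U \<and> open V \<and> bij_betw f U V \<and>
    real_analytic_on f U \<and> real_analytic_on (inv_into U f) V"

definition analytic_submanifold :: "nat \<Rightarrow> 'a::euclidean_space set \<Rightarrow> bool"
  where "analytic_submanifold d S \<longleftrightarrow>
    (\<forall>p\<in>S. \<exists>U V (f :: 'a \<Rightarrow> 'a) L. p \<in> U \<and> analytic_diffeo f U V \<and>
      subspace L \<and> dim L = d \<and> f ` (S \<inter> U) = L \<inter> V)"

text \<open>
  Velocities of \<open>C\<^sup>1\<close> curves in \<open>S\<close> through \<open>p\<close>; for an embedded submanifold \<open>S\<close> this is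
  its tangent space at \<open>p\<close>, as a subspace of the ambient space.
\<close>

definition tangent_space :: "'a::euclidean_space set \<Rightarrow> 'a \<Rightarrow> 'a set"
  where "tangent_space S p = {v. \<exists>e>0. \<exists>\<gamma>. \<gamma> C1_differentiable_on {-e<..<e} \<and>
    \<gamma> ` {-e<..<e} \<subseteq> S \<and> \<gamma> 0 = p \<and> (\<gamma> has_vector_derivative v) (at 0)}"

text \<open>
  The restriction of \<open>f\<close> to a map from \<open>M\<close> to \<open>N\<close> is transverse at \<open>p\<close> to the submanifold
  \<open>Z\<close> of \<open>N\<close>; here \<open>f\<close> is differentiable in the ambient space of \<open>M\<close>, so the differential of
  the restriction is the restriction of the differential to the tangent space of \<open>M\<close>.
\<close>

definition transverse_at ::
    "('a::euclidean_space \<Rightarrow> 'b::euclidean_space) \<Rightarrow> 'a set \<Rightarrow> 'b set \<Rightarrow> 'b set \<Rightarrow> 'a \<Rightarrow> bool"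
  where "transverse_at f M Z N p \<longleftrightarrow>
    {u + v |u v. u \<in> frechet_derivative f (at p) ` tangent_space M p \<and>
                 v \<in> tangent_space Z (f p)} = tangent_space N (f p)"

definition sl2H :: "qmat set"
  where "sl2H = tangent_space SL2H (mat 1)"

text \<open>\<open>\<zz>(g) = ker (1 - Ad\<^sub>g)\<close>; for matrix groups \<open>Ad\<^sub>g\<close> is conjugation by \<open>g\<close>.\<close>

definition lie_centralizer :: "qmat \<Rightarrow> qmat set"
  where "lie_centralizer g = {X \<in> sl2H. X - conj_mat g X = 0}"


section \<open>Real-analytic orbifolds\<close>

text \<open>
  A chart \<open>(U, \<Gamma>, \<phi>)\<close> consists of a connected open set \<open>U\<close> in a Euclidean space, a finite
  group \<open>\<Gamma>\<close> of real-analytic automorphisms of \<open>U\<close>, and a map \<open>\<phi>\<close> inducing a homeomorphism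
  from \<open>U/\<Gamma>\<close> onto an open subset of the space \<open>X\<close>.
\<close>

type_synonym ('v, 'x) orb_chart = "'v set \<times> ('v \<Rightarrow> 'v) set \<times> ('v \<Rightarrow> 'x)"

definition orbifold_chart :: "'x topology \<Rightarrow> ('v::euclidean_space, 'x) orb_chart \<Rightarrow> bool"
  where "orbifold_chart X = (\<lambda>(U, \<Gamma>, \<phi>).
    open U \<and> connected U \<and> U \<noteq> {} \<and>
    finite \<Gamma> \<and> subgroup \<Gamma> (BijGroup U) \<and> (\<forall>g\<in>\<Gamma>. real_analytic_on g U) \<and>
    openin X (\<phi> ` U) \<and> quotient_map (top_of_set U) (subtopology X (\<phi> ` U)) \<phi> \<and>
    (\<forall>x\<in>U. \<forall>y\<in>U. \<phi> x = \<phi> y \<longleftrightarrow> (\<exists>g\<in>\<Gamma>. y = g x)))"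

definition chart_embedding ::
    "('v \<Rightarrow> 'v) \<Rightarrow> ('v::euclidean_space, 'x) orb_chart \<Rightarrow> ('v, 'x) orb_chart \<Rightarrow> bool"
  where "chart_embedding f = (\<lambda>(W, \<Delta>, \<psi>) (U, \<Gamma>, \<phi>).
    (\<exists>V\<subseteq>U. analytic_diffeo f W V) \<and> (\<forall>w\<in>W. \<phi> (f w) = \<psi> w))"

definition chart_image :: "('v, 'x) orb_chart \<Rightarrow> 'x set"
  where "chart_image = (\<lambda>(U, \<Gamma>, \<phi>). \<phi> ` U)"

text \<open>
  \<open>\<A>\<close> makes \<open>X\<close> a real-analytic orbifold, of dimension the dimension of the model space
  \<open>'v\<close>: the charts cover \<open>X\<close>, and around each common point of two of them there is a chart
  that embeds into both.
\<close>

definition analytic_orbifold ::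
    "'x topology \<Rightarrow> ('v::euclidean_space, 'x) orb_chart set \<Rightarrow> bool"
  where "analytic_orbifold X \<A> \<longleftrightarrow>
    Hausdorff_space X \<and> second_countable X \<and>
    (\<forall>c\<in>\<A>. orbifold_chart X c) \<and>
    (\<Union>c\<in>\<A>. chart_image c) = topspace X \<and>
    (\<forall>c\<in>\<A>. \<forall>d\<in>\<A>. \<forall>x \<in> chart_image c \<inter> chart_image d.
      \<exists>b f g. orbifold_chart X b \<and> x \<in> chart_image b \<and>
        chart_embedding f b c \<and> chart_embedding g b d)"

text \<open>
  \<open>q\<close> is a real-analytic submersion from the submanifold \<open>M\<close> to the orbifold with atlas \<open>\<A>\<close>:
  locally it lifts through charts to real-analytic maps with surjective differential.
  When \<open>q\<close> is the projection to an orbit space, this is what ties the orbifold structure to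
  the analytic structure of \<open>M\<close>; the topology of the orbit space alone does not determine it.
\<close>

definition orbifold_submersion ::
    "'a::euclidean_space set \<Rightarrow> ('a \<Rightarrow> 'x) \<Rightarrow> ('v::euclidean_space, 'x) orb_chart set \<Rightarrow> bool"
  where "orbifold_submersion M q \<A> \<longleftrightarrow>
    (\<forall>x\<in>M. \<exists>(U, \<Gamma>, \<phi>)\<in>\<A>. \<exists>W h. open W \<and> x \<in> W \<and> real_analytic_on h W \<and>
      h ` (M \<inter> W) \<subseteq> U \<and> (\<forall>y \<in> M \<inter> W. \<phi> (h y) = q y) \<and>
      frechet_derivative h (at x) ` tangent_space M x = UNIV)"

definition quotient_topology :: "'a topology \<Rightarrow> ('a \<Rightarrow> 'b) \<Rightarrow> 'b topology"
  where "quotient_topology X q =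
    topology (\<lambda>U. U \<subseteq> q ` topspace X \<and> openin X {x \<in> topspace X. q x \<in> U})"

lemma openin_quotient_topology:
  "openin (quotient_topology X q) U \<longleftrightarrow>
    U \<subseteq> q ` topspace X \<and> openin X {x \<in> topspace X. q x \<in> U}"
proof -
  have "istopology (\<lambda>U. U \<subseteq> q ` topspace X \<and> openin X {x \<in> topspace X. q x \<in> U})"
    unfolding istopology_def
  proof (intro conjI allI impI)
    fix S T
    assume "S \<subseteq> q ` topspace X \<and> openin X {x \<in> topspace X. q x \<in> S}"
      and "T \<subseteq> q ` topspace X \<and> openin X {x \<in> topspace X. q x \<in> T}"
    moreover have "{x \<in> topspace X. q x \<in> S \<inter> T} =
        {x \<in> topspace X. q x \<in> S} \<inter> {x \<in> topspace X. q x \<in> T}"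
      by blast
    ultimately show "S \<inter> T \<subseteq> q ` topspace X" "openin X {x \<in> topspace X. q x \<in> S \<inter> T}"
      by (auto simp del: Int_iff)
  next
    fix \<K>
    assume *: "\<forall>K\<in>\<K>. K \<subseteq> q ` topspace X \<and> openin X {x \<in> topspace X. q x \<in> K}"
    then show "\<Union>\<K> \<subseteq> q ` topspace X"
      by blast
    have "{x \<in> topspace X. q x \<in> \<Union>\<K>} = (\<Union>K\<in>\<K>. {x \<in> topspace X. q x \<in> K})"
      by blast
    with * show "openin X {x \<in> topspace X. q x \<in> \<Union>\<K>}"
      by (auto intro!: openin_Union)
  qed
  then show ?thesis
    unfolding quotient_topology_def by (simp add: topology_inverse')
qed


section \<open>The relative representation set and its quotient\<close>

definition rep_set :: "qmat \<Rightarrow> qmat \<Rightarrow> qmat \<Rightarrow> (qmat \<times> qmat) set"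
  where "rep_set A B C =
    {(A', B') \<in> conj_class A \<times> conj_class B. matrix_inv (A' ** B') \<in> conj_class C}"

definition conj_orbit :: "qmat \<times> qmat \<Rightarrow> (qmat \<times> qmat) set"
  where "conj_orbit = (\<lambda>(A, B). {(conj_mat P A, conj_mat P B) |P. P \<in> SL2H})"

definition rep_quotient :: "qmat \<Rightarrow> qmat \<Rightarrow> qmat \<Rightarrow> (qmat \<times> qmat) set topology"
  where "rep_quotient A B C = quotient_topology (top_of_set (rep_set A B C)) conj_orbit"

end

theory Submission
  imports Defs "HOL-Complex_Analysis.Cauchy_Integral_Formula"
begin

text \<open>
  Everything rests on the trace form \<open>tau (X ** Y)\<close>, where \<open>tau\<close> is the real part of the trace. It is
  invariant under conjugation and nondegenerate, and the tangent space of \<^const>\<open>SL2H\<close> at \<open>D\<close> is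
  \<open>{v. tau (D\<inverse> ** v) = 0}\<close>.

  \<^emph>\<open>Transversality.\<close> Commutators \<open>X A - A X\<close> are tangent to the class of \<open>A\<close>, so the image of the
  differential of the multiplication map contains all \<open>(X A - A X) B + A (Y B - B Y)\<close>. If \<open>Z\<close>
  annihilates these, then \<open>A B Z = B Z A = Z A B\<close>; hence \<open>A B Z\<close> commutes with \<open>A\<close> and \<open>B\<close>. The
  trace-free part of such a matrix lies in both centralizers, which meet in zero, so \<open>Z\<close> is a real
  multiple of \<open>(A B)\<inverse>\<close>. Therefore the image is the whole tangent space of \<^const>\<open>SL2H\<close> at \<open>A B\<close>.

  \<^emph>\<open>The representation set.\<close> A regular loxodromic element is similar to \<open>diag(u, v)\<close> with nonreal \<open>u\<close>, \<open>v\<close> of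
  different norms. The commutant of such an element \<open>A\<close> has the basis 1, \<open>A\<close>, \<open>A\<^sup>2\<close>, \<open>A\<^sup>3\<close>
  (\<open>cyclic_diag\<close>). Under the trace form the commutators with \<open>A\<close> annihilate exactly the
  commutant; so they form the common kernel of the differentials of \<open>tau (A\<^sup>k)\<close> for \<open>k = 1, ..., 4\<close>, and a
  slice argument shows that these four numbers cut out the class of \<open>A\<close> locally
  (\<open>conjugate_if_invariants_agree\<close>). For the product, which lies in \<^const>\<open>SL2H\<close>, three of them
  suffice. Hence the representation set is locally a level set of 4 + 4 + 3 functions on a space of
  dimension 32. Their differentials are independent by the annihilator computation for
  transversality (\<open>invariants'_surjective\<close>), so the dimension is 32 - 11 = 21.

  \<^emph>\<open>The orbit space.\<close> The matrices commuting with \<open>A\<close> and \<open>B\<close> are the real scalars. They act trivially,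
  and the orbit of \<open>(A, B)\<close> has dimension 15. Pairs of the representation set that lie near \<open>(A, B)\<close> in
  directions orthogonal to the orbit form a slice of dimension 6, to which all nearby pairs can be
  conjugated analytically. Two points of the slice in the same orbit are equal: a
  conjugating matrix nearly commutes with \<open>A\<close> and \<open>B\<close>, so up to a scalar factor it is close to the identity
  (\<open>approximate_schur\<close>), where the slice decomposition is unique. So the slice is a chart
  with trivial group for a neighbourhood of the orbit.

  \<^emph>\<open>Analyticity.\<close> Maps are called analytic here when they extend holomorphically to the complexification.
  This property is inherited by compositions and by local inverses of polynomial maps, and
  Osgood's lemma turns it into the existence of convergent power series. All charts
  arise from polynomial maps through the inverse function theorem.
\<close>

section \<open>Power series of holomorphic functions of several variables\<close>

text \<open>Cauchy's inequality applies on the circles of radius \<open>r < R\<close>; letting \<open>r\<close> tend to \<open>R\<close> gives the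
  bound with \<open>R\<close> itself, so that the radius does not shrink when the bound is used once for each
  coordinate below.\<close>

lemma taylor_coefficient_bound:
  fixes g :: "complex \<Rightarrow> complex"
  assumes "g holomorphic_on ball 0 R" and "0 < R"
    and "\<And>z. cmod z < R \<Longrightarrow> cmod (g z) \<le> M"
  shows "cmod ((deriv ^^ n) g 0 / fact n) \<le> M / R ^ n"
proof -
  have r: "cmod ((deriv ^^ n) g 0 / fact n) * r ^ n \<le> M" if r: "0 < r" "r < R" for r
  proof -
    have sub: "cball 0 r \<subseteq> ball (0::complex) R"
      using r by auto
    have "cmod ((deriv ^^ n) g 0) \<le> fact n * M / r ^ n"
    proof (rule Cauchy_inequality)
      show "g holomorphic_on ball 0 r"
        by (rule holomorphic_on_subset[OF assms(1)]) (use r in auto)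
      show "continuous_on (cball 0 r) g"
        by (rule holomorphic_on_imp_continuous_on[OF holomorphic_on_subset[OF assms(1) sub]])
      show "cmod (g x) \<le> M" if "cmod (0 - x) = r" for x
        using that r assms(3) by simp
    qed (use r in simp)
    then show ?thesis
      using r by (simp add: norm_divide field_simps)
  qed
  have "((\<lambda>r. cmod ((deriv ^^ n) g 0 / fact n) * r ^ n) \<longlongrightarrow>
      cmod ((deriv ^^ n) g 0 / fact n) * R ^ n) (at_left R)"
    by (intro tendsto_intros)
  moreover have "eventually (\<lambda>r. cmod ((deriv ^^ n) g 0 / fact n) * r ^ n \<le> M) (at_left R)"
    using eventually_at_left_real[OF \<open>0 < R\<close>] by eventually_elim (use r in auto)
  ultimately have "cmod ((deriv ^^ n) g 0 / fact n) * R ^ n \<le> M"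
    by (rule tendsto_upperbound) simp
  then show ?thesis
    using \<open>0 < R\<close> by (simp add: pos_le_divide_eq)
qed

lemma has_sum_geometric_real:
  fixes x :: real
  assumes "0 \<le> x" "x < 1"
  shows "((\<lambda>n. x ^ n) has_sum (1 / (1 - x))) (UNIV :: nat set)"
  using norm_summable_imp_has_sum[of "\<lambda>n. x ^ n" "1 / (1 - x)"] geometric_sums[of x] assms
  by (simp add: norm_power summable_geometric)

text \<open>The majorant of a power series in the variables \<open>S\<close>. One variable is split off along the bijection
  \<open>(n, \<beta>) \<mapsto> \<beta>(i := n)\<close>.\<close>

lemma multi_geometric_summable:
  fixes x :: "'i \<Rightarrow> real"
  assumes "finite S" "\<And>i. i \<in> S \<Longrightarrow> 0 \<le> x i \<and> x i < 1"
  shows "(\<lambda>\<alpha>. \<Prod>i\<in>S. x i ^ \<alpha> i) summable_on (PiE S (\<lambda>_. UNIV :: nat set))"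
  using assms
proof (induction S)
  case empty
  then show ?case by (simp add: PiE_empty_domain)
next
  case (insert i S)
  have inj: "inj_on (\<lambda>(n, \<beta>). \<beta>(i := n)) (UNIV \<times> PiE S (\<lambda>_. UNIV :: nat set))"
    by (rule inj_combinator[OF insert.hyps(2)])
  have IH: "(\<lambda>\<alpha>. \<Prod>i\<in>S. x i ^ \<alpha> i) summable_on (PiE S (\<lambda>_. UNIV :: nat set))"
    using insert by blast
  have g: "(\<lambda>n. x i ^ n) summable_on (UNIV :: nat set)"
    using has_sum_geometric_real[of "x i"] insert.prems[of i] by (auto simp: summable_on_def)
  have "(\<lambda>(n, \<beta>). x i ^ n * (\<Prod>j\<in>S. x j ^ \<beta> j)) summable_on (UNIV \<times> PiE S (\<lambda>_. UNIV :: nat set))"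
  proof (rule summable_on_SigmaI)
    show "((\<lambda>\<beta>. case (n, \<beta>) of (n, \<beta>) \<Rightarrow> x i ^ n * (\<Prod>j\<in>S. x j ^ \<beta> j)) has_sum
        x i ^ n * infsum (\<lambda>\<beta>. \<Prod>j\<in>S. x j ^ \<beta> j) (PiE S (\<lambda>_. UNIV))) (PiE S (\<lambda>_. UNIV))" for n
      using has_sum_cmult_right[OF has_sum_infsum[OF IH]] by simp
    show "(\<lambda>n. x i ^ n * infsum (\<lambda>\<beta>. \<Prod>j\<in>S. x j ^ \<beta> j) (PiE S (\<lambda>_. UNIV))) summable_on UNIV"
      by (rule summable_on_cmult_left[OF g])
    show "0 \<le> (case (n, \<beta>) of (n, \<beta>) \<Rightarrow> x i ^ n * (\<Prod>j\<in>S. x j ^ \<beta> j))" for n \<beta>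
      using insert.prems by (auto intro!: mult_nonneg_nonneg prod_nonneg)
  qed
  also have "(\<lambda>(n, \<beta>). x i ^ n * (\<Prod>j\<in>S. x j ^ \<beta> j)) = (\<lambda>\<alpha>. \<Prod>j\<in>insert i S. x j ^ \<alpha> j) \<circ> (\<lambda>(n, \<beta>). \<beta>(i := n))"
  proof -
    have "(\<Prod>j\<in>S. x j ^ (if j = i then n else \<beta> j)) = (\<Prod>j\<in>S. x j ^ \<beta> j)" for n and \<beta> :: "'i \<Rightarrow> nat"
      by (rule prod.cong) (use insert.hyps in auto)
    then show ?thesis
      using insert.hyps by (simp add: fun_eq_iff)
  qed
  finally show ?case
    unfolding PiE_insert_eq by (subst summable_on_reindex[OF inj]) 
qed

text \<open>The \<open>n\<close>-th coefficient arises from \<open>g\<close> and the earlier coefficients by a limit that is locally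
  uniform in the parameter \<open>\<xi>\<close>, so it is holomorphic when these are.\<close>

lemma taylor_coefficient_holomorphic_in_parameter:
  fixes g :: "complex \<Rightarrow> complex \<Rightarrow> complex"
  assumes "0 < R"
    and bd: "\<And>\<zeta> \<xi>. cmod \<zeta> < R \<Longrightarrow> cmod \<xi> < R \<Longrightarrow> cmod (g \<xi> \<zeta>) \<le> M"
    and hol1: "\<And>\<xi>. cmod \<xi> < R \<Longrightarrow> g \<xi> holomorphic_on ball 0 R"
    and hol2: "\<And>\<zeta>. cmod \<zeta> < R \<Longrightarrow> (\<lambda>\<xi>. g \<xi> \<zeta>) holomorphic_on ball 0 R"
  shows "(\<lambda>\<xi>. (deriv ^^ n) (g \<xi>) 0 / fact n) holomorphic_on ball 0 R"
proof (induction n rule: less_induct)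
  case (less n)
  define a where "a \<xi> k = (deriv ^^ k) (g \<xi>) 0 / fact k" for \<xi> k
  have sums: "(\<lambda>k. a \<xi> k * \<zeta> ^ k) sums g \<xi> \<zeta>" if "cmod \<xi> < R" "cmod \<zeta> < R" for \<xi> \<zeta>
    using holomorphic_power_series[OF hol1[OF that(1)], of \<zeta>] that by (simp add: a_def)
  have abd: "cmod (a \<xi> k) \<le> M / R ^ k" if "cmod \<xi> < R" for \<xi> k
    unfolding a_def using taylor_coefficient_bound[OF hol1[OF that] \<open>0 < R\<close>] bd that by blast
  have M: "0 \<le> M"
    using order.trans[OF norm_ge_zero bd[of 0 0]] \<open>0 < R\<close> by simp
  define q where "q \<zeta> \<xi> = (g \<xi> \<zeta> - (\<Sum>k<n. a \<xi> k * \<zeta> ^ k)) / \<zeta> ^ n" for \<zeta> \<xi>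
  \<comment> \<open>Dividing the tail of the Taylor series by \<open>\<zeta> ^ n\<close> recovers the \<open>n\<close>-th coefficient as
      \<open>\<zeta> \<rightarrow> 0\<close>, with an error that the Cauchy bounds make uniform in \<open>\<xi>\<close>.\<close>
  have est: "cmod (q \<zeta> \<xi> - a \<xi> n) \<le> M / R ^ n * (cmod \<zeta> / R) / (1 - cmod \<zeta> / R)"
    if "cmod \<xi> < R" "cmod \<zeta> < R" "\<zeta> \<noteq> 0" for \<xi> \<zeta>
  proof -
    have "(\<lambda>k. a \<xi> (k + n) * \<zeta> ^ (k + n)) sums (g \<xi> \<zeta> - (\<Sum>k<n. a \<xi> k * \<zeta> ^ k))"
      by (rule sums_split_initial_segment[OF sums[OF that(1,2)]])
    from sums_divide[OF this, of "\<zeta> ^ n"]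
    have "(\<lambda>k. a \<xi> (k + n) * \<zeta> ^ k) sums q \<zeta> \<xi>"
      using that(3) by (simp add: q_def power_add)
    from sums_split_initial_segment[OF this, of 1]
    have s: "(\<lambda>k. a \<xi> (Suc k + n) * \<zeta> ^ Suc k) sums (q \<zeta> \<xi> - a \<xi> n)"
      by simp
    define t where "t = cmod \<zeta> / R"
    have t: "0 \<le> t" "t < 1" using that \<open>0 < R\<close> by (auto simp: t_def)
    have le: "cmod (a \<xi> (Suc k + n) * \<zeta> ^ Suc k) \<le> M / R ^ n * t * t ^ k" for k
    proof -
      have "cmod (a \<xi> (Suc k + n) * \<zeta> ^ Suc k) \<le> M / R ^ (Suc k + n) * cmod \<zeta> ^ Suc k"
        unfolding norm_mult norm_power by (intro mult_right_mono abd that) simp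
      also have "\<dots> = M / R ^ n * t * t ^ k"
        using \<open>0 < R\<close> by (simp add: t_def power_add power_divide field_simps)
      finally show ?thesis .
    qed
    have gs: "(\<lambda>k. M / R ^ n * t * t ^ k) sums (M / R ^ n * t * (1 / (1 - t)))"
      using t by (intro sums_mult geometric_sums) simp
    have "cmod (\<Sum>k. a \<xi> (Suc k + n) * \<zeta> ^ Suc k) \<le> (\<Sum>k. M / R ^ n * t * t ^ k)"
      by (rule norm_suminf_le[OF le sums_summable[OF gs]])
    then show ?thesis
      using sums_unique[OF s] sums_unique[OF gs] by (simp add: t_def)
  qed
  define z where "z m = complex_of_real (R / (real m + 2))" for m :: nat
  have z: "cmod (z m) < R" "z m \<noteq> 0" for m
    using \<open>0 < R\<close> by (auto simp: z_def norm_divide divide_simps simp del: of_real_divide)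
  have z0: "(\<lambda>m. cmod (z m)) \<longlonglongrightarrow> 0"
  proof -
    have "(\<lambda>m. R / (real m + 2)) \<longlonglongrightarrow> 0"
      using LIMSEQ_ignore_initial_segment[OF lim_const_over_n[of R], of 2] by (simp add: add.commute)
    then show ?thesis
      unfolding z_def norm_of_real by (rule tendsto_rabs_zero)
  qed
  have zlim: "(\<lambda>m. M / R ^ n * (cmod (z m) / R) / (1 - cmod (z m) / R)) \<longlonglongrightarrow> M / R ^ n * (0 / R) / (1 - 0 / R)"
    by (intro tendsto_divide tendsto_mult tendsto_diff tendsto_const z0) (use \<open>0 < R\<close> in auto)
  have "(\<lambda>\<xi>. a \<xi> n) holomorphic_on ball 0 R"
  proof (rule holomorphic_uniform_sequence)
    show "q (z m) holomorphic_on ball 0 R" for m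
    proof -
      have "(\<lambda>\<xi>. a \<xi> k) holomorphic_on ball 0 R" if "k < n" for k
        using less.IH[OF that] by (simp add: a_def)
      then show ?thesis
        unfolding q_def[abs_def] using z[of m]
        by (intro holomorphic_on_divide holomorphic_on_diff holomorphic_on_sum holomorphic_on_mult
            holomorphic_on_const hol2) auto
    qed
    fix \<xi> :: complex assume \<xi>: "\<xi> \<in> ball 0 R"
    then obtain d where d: "0 < d" "cball \<xi> d \<subseteq> ball 0 R"
      by (metis open_ball open_contains_cball)
    have "uniform_limit (cball \<xi> d) (\<lambda>m. q (z m)) (\<lambda>\<xi>. a \<xi> n) sequentially"
      unfolding uniform_limit_iff
    proof (intro allI impI)
      fix e :: real assume "0 < e"
      then have "\<forall>\<^sub>F m in sequentially. M / R ^ n * (cmod (z m) / R) / (1 - cmod (z m) / R) < e"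
        using order_tendstoD(2)[OF zlim, of e] by simp
      then show "\<forall>\<^sub>F m in sequentially. \<forall>x\<in>cball \<xi> d. dist (q (z m) x) (a x n) < e"
      proof eventually_elim
        case (elim m)
        show ?case
        proof
          fix x assume "x \<in> cball \<xi> d"
          then have "cmod x < R" using d by auto
          from est[OF this z, of m] elim show "dist (q (z m) x) (a x n) < e"
            by (simp add: dist_norm)
        qed
      qed
    qed
    then show "\<exists>d>0. cball \<xi> d \<subseteq> ball 0 R \<and> uniform_limit (cball \<xi> d) (\<lambda>m. q (z m)) (\<lambda>\<xi>. a \<xi> n) sequentially"
      using d by blast
  qed simp
  then show ?case by (simp add: a_def)
qed

text \<open>A quantitative form of Osgood's lemma. The Taylor coefficients in one variable are again separately
  holomorphic in the others and satisfy the same kind of bound with \<open>M / R ^ n\<close> for \<open>M\<close>, so the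
  induction hypothesis applies to each of them. The bounds on the coefficients make the iterated
  series absolutely summable, and it can be rearranged into a sum over multi-indices. The
  expansion is asserted at points whose coordinates outside \<open>S\<close> vanish, so that for empty \<open>S\<close> it
  is the evaluation at one point.\<close>

lemma separately_holomorphic_power_series:
  fixes g :: "('i \<Rightarrow> complex) \<Rightarrow> complex"
  assumes "finite S" and "0 < R"
    and "\<And>w. (\<And>j. cmod (w j) < R) \<Longrightarrow> cmod (g w) \<le> M"
    and "\<And>i w. i \<in> S \<Longrightarrow> (\<And>j. cmod (w j) < R) \<Longrightarrow> (\<lambda>\<zeta>. g (w(i := \<zeta>))) holomorphic_on ball 0 R"
  shows "\<exists>c. (\<forall>\<alpha>. cmod (c \<alpha>) \<le> M / R ^ (\<Sum>i\<in>S. \<alpha> i)) \<and>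
    (\<forall>w. (\<forall>j. cmod (w j) < R) \<longrightarrow> (\<forall>j. j \<notin> S \<longrightarrow> w j = 0) \<longrightarrow>
       ((\<lambda>\<alpha>. (\<Prod>i\<in>S. w i ^ \<alpha> i) * c \<alpha>) has_sum g w) (PiE S (\<lambda>_. UNIV)))"
  using assms(1,3,4)
proof (induction S arbitrary: g M)
  case empty
  show ?case
  proof (intro exI conjI allI impI)
    show "cmod (g (\<lambda>_. 0)) \<le> M / R ^ (\<Sum>i\<in>{}. \<alpha> i)" for \<alpha> :: "'i \<Rightarrow> nat"
      using empty.prems(1)[of "\<lambda>_. 0"] \<open>0 < R\<close> by simp
    fix w :: "'i \<Rightarrow> complex"
    assume "\<forall>j. j \<notin> {} \<longrightarrow> w j = 0"
    then have "w = (\<lambda>_. 0)" by auto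
    then show "((\<lambda>\<alpha>. (\<Prod>i\<in>{}. w i ^ \<alpha> i) * g (\<lambda>_. 0)) has_sum g w) (PiE {} (\<lambda>_. UNIV))"
      by (intro has_sum_finiteI) (simp_all add: PiE_empty_domain)
  qed
next
  case (insert i S)
  define a where "a n w = (deriv ^^ n) (\<lambda>\<zeta>. g (w(i := \<zeta>))) 0 / fact n" for n w
  have hol: "(\<lambda>\<zeta>. g (w(j := \<zeta>))) holomorphic_on ball 0 R" if "j \<in> insert i S" "\<And>j. cmod (w j) < R" for j w
    by (rule insert.prems(2)[OF that])
  have bd: "cmod (g (w(i := \<zeta>))) \<le> M" if "\<And>j. cmod (w j) < R" "cmod \<zeta> < R" for w \<zeta>
    by (rule insert.prems(1)) (use that in auto)
  have abd: "cmod (a n w) \<le> M / R ^ n" if "\<And>j. cmod (w j) < R" for n w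
    unfolding a_def by (rule taylor_coefficient_bound) (use hol bd that \<open>0 < R\<close> in auto)
  have ahol: "(\<lambda>\<zeta>. a n (w(j := \<zeta>))) holomorphic_on ball 0 R"
    if j: "j \<in> S" and w: "\<And>j. cmod (w j) < R" for n j w
    unfolding a_def
  proof (rule taylor_coefficient_holomorphic_in_parameter)
    have ji: "j \<noteq> i" using insert.hyps j by auto
    show "(\<lambda>\<zeta>. g (w(j := \<xi>, i := \<zeta>))) holomorphic_on ball 0 R" if "cmod \<xi> < R" for \<xi>
      by (rule hol) (use that w in auto)
    show "(\<lambda>\<xi>. g (w(j := \<xi>, i := \<zeta>))) holomorphic_on ball 0 R" if "cmod \<zeta> < R" for \<zeta>
      unfolding fun_upd_twist[OF ji] by (rule hol) (use that w j in auto)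
    show "cmod (g (w(j := \<xi>, i := \<zeta>))) \<le> M" if "cmod \<zeta> < R" "cmod \<xi> < R" for \<zeta> \<xi>
      by (rule bd) (use that w in auto)
  qed (rule \<open>0 < R\<close>)
  have "\<forall>n. \<exists>c. (\<forall>\<alpha>. cmod (c \<alpha>) \<le> (M / R ^ n) / R ^ (\<Sum>i\<in>S. \<alpha> i)) \<and>
    (\<forall>w. (\<forall>j. cmod (w j) < R) \<longrightarrow> (\<forall>j. j \<notin> S \<longrightarrow> w j = 0) \<longrightarrow>
       ((\<lambda>\<alpha>. (\<Prod>i\<in>S. w i ^ \<alpha> i) * c \<alpha>) has_sum a n w) (PiE S (\<lambda>_. UNIV)))"
    using insert.IH[OF abd ahol] by blast
  then obtain c where c: "\<forall>n. (\<forall>\<alpha>. cmod (c n \<alpha>) \<le> (M / R ^ n) / R ^ (\<Sum>i\<in>S. \<alpha> i)) \<and>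
    (\<forall>w. (\<forall>j. cmod (w j) < R) \<longrightarrow> (\<forall>j. j \<notin> S \<longrightarrow> w j = 0) \<longrightarrow>
       ((\<lambda>\<alpha>. (\<Prod>i\<in>S. w i ^ \<alpha> i) * c n \<alpha>) has_sum a n w) (PiE S (\<lambda>_. UNIV)))"
    by (rule choice[THEN exE])
  have cbd: "cmod (c n \<alpha>) \<le> (M / R ^ n) / R ^ (\<Sum>i\<in>S. \<alpha> i)" for n \<alpha>
    by (rule spec[OF conjunct1[OF spec[OF c]]])
  have csum: "((\<lambda>\<alpha>. (\<Prod>i\<in>S. w i ^ \<alpha> i) * c n \<alpha>) has_sum a n w) (PiE S (\<lambda>_. UNIV))"
    if "\<forall>j. cmod (w j) < R" "\<forall>j. j \<notin> S \<longrightarrow> w j = 0" for n w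
    by (rule mp[OF mp[OF spec[OF conjunct2[OF spec[OF c]]]]]) (fact that)+
  have inj: "inj_on (\<lambda>(n, \<beta>). \<beta>(i := n)) (UNIV \<times> PiE S (\<lambda>_. UNIV :: nat set))"
    by (rule inj_combinator[OF insert.hyps(2)])
  show ?case
  proof (intro exI conjI allI impI)
    fix \<alpha> :: "'i \<Rightarrow> nat"
    have "(\<Sum>j\<in>S. restrict \<alpha> S j) = (\<Sum>j\<in>S. \<alpha> j)" by simp
    then show "cmod (c (\<alpha> i) (restrict \<alpha> S)) \<le> M / R ^ (\<Sum>i\<in>insert i S. \<alpha> i)"
      using cbd[of "\<alpha> i" "restrict \<alpha> S"] insert.hyps by (simp add: power_add)
  next
    fix w :: "'i \<Rightarrow> complex"
    assume w: "\<forall>j. cmod (w j) < R" and w0: "\<forall>j. j \<notin> insert i S \<longrightarrow> w j = 0"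
    define v where "v = w(i := 0)"
    have v: "\<forall>j. cmod (v j) < R" "\<forall>j. j \<notin> S \<longrightarrow> v j = 0"
      using w w0 \<open>0 < R\<close> by (auto simp: v_def)
    have pv: "(\<Prod>j\<in>S. v j ^ \<beta> j) = (\<Prod>j\<in>S. w j ^ \<beta> j)" for \<beta> :: "'i \<Rightarrow> nat"
      by (rule prod.cong) (use insert.hyps in \<open>auto simp: v_def\<close>)
    define F where "F = (\<lambda>(n, \<beta>). w i ^ n * ((\<Prod>j\<in>S. w j ^ \<beta> j) * c n \<beta>))"
    have inner: "((\<lambda>\<beta>. F (n, \<beta>)) has_sum (w i ^ n * a n v)) (PiE S (\<lambda>_. UNIV))" for n
      unfolding F_def using has_sum_cmult_right[OF csum[OF v, of n], of "w i ^ n"] by (simp add: pv)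
    have outer_sums: "(\<lambda>n. a n v * w i ^ n) sums g w"
      using holomorphic_power_series[of "\<lambda>\<zeta>. g (v(i := \<zeta>))" 0 R "w i"] hol[of i v] v w
      by (simp add: a_def v_def)
    have wi: "cmod (w i) / R < 1" "0 \<le> cmod (w i) / R" using w \<open>0 < R\<close> by auto
    have "summable (\<lambda>n. norm (a n v * w i ^ n))"
    proof (rule summable_comparison_test)
      show "summable (\<lambda>n. M * (cmod (w i) / R) ^ n)"
        using wi by (intro summable_mult summable_geometric) simp
      show "\<exists>N. \<forall>n\<ge>N. norm (norm (a n v * w i ^ n)) \<le> M * (cmod (w i) / R) ^ n"
      proof (intro exI allI impI)
        fix n :: nat
        have "cmod (a n v) * cmod (w i) ^ n \<le> M / R ^ n * cmod (w i) ^ n"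
          by (intro mult_right_mono abd) (use v in auto)
        then show "norm (norm (a n v * w i ^ n)) \<le> M * (cmod (w i) / R) ^ n"
          by (simp add: norm_mult norm_power power_divide)
      qed
    qed
    from norm_summable_imp_has_sum[OF this outer_sums]
    have outer: "((\<lambda>n. w i ^ n * a n v) has_sum g w) UNIV"
      by (simp add: mult.commute)
    have summ: "F summable_on (UNIV \<times> PiE S (\<lambda>_. UNIV))"
    proof -
      have G: "(\<lambda>\<alpha>. \<Prod>j\<in>insert i S. (cmod (w j) / R) ^ \<alpha> j) summable_on (PiE (insert i S) (\<lambda>_. UNIV))"
        by (rule multi_geometric_summable) (use insert.hyps w \<open>0 < R\<close> in auto)
      then have "((\<lambda>\<alpha>. \<Prod>j\<in>insert i S. (cmod (w j) / R) ^ \<alpha> j) \<circ> (\<lambda>(n, \<beta>). \<beta>(i := n)))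
          summable_on (UNIV \<times> PiE S (\<lambda>_. UNIV))"
        unfolding PiE_insert_eq by (subst (asm) summable_on_reindex[OF inj])
      from summable_on_cmult_right[OF this, of M]
      have "(\<lambda>x. norm (F x)) summable_on (UNIV \<times> PiE S (\<lambda>_. UNIV))"
      proof (rule Infinite_Sum.abs_summable_on_comparison_test')
        fix x :: "nat \<times> ('i \<Rightarrow> nat)"
        obtain n \<beta> where x: "x = (n, \<beta>)" by (cases x)
        have pr: "(\<Prod>j\<in>S. (cmod (w j) / R) ^ (if j = i then n else \<beta> j)) = (\<Prod>j\<in>S. (cmod (w j) / R) ^ \<beta> j)"
          by (rule prod.cong) (use insert.hyps in auto)
        have "norm (F x) = cmod (w i) ^ n * ((\<Prod>j\<in>S. cmod (w j) ^ \<beta> j) * cmod (c n \<beta>))"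
          by (simp add: F_def x norm_mult norm_power prod_norm[symmetric])
        also have "\<dots> \<le> cmod (w i) ^ n * ((\<Prod>j\<in>S. cmod (w j) ^ \<beta> j) * (M / R ^ n / R ^ (\<Sum>i\<in>S. \<beta> i)))"
          by (intro mult_left_mono cbd prod_nonneg) (auto intro: prod_nonneg)
        also have "\<dots> = M * ((cmod (w i) / R) ^ n * (\<Prod>j\<in>S. (cmod (w j) / R) ^ \<beta> j))"
          by (simp add: power_divide prod_dividef power_sum)
        also have "\<dots> = M * ((\<lambda>\<alpha>. \<Prod>j\<in>insert i S. (cmod (w j) / R) ^ \<alpha> j) \<circ> (\<lambda>(n, \<beta>). \<beta>(i := n))) x"
          using insert.hyps by (simp add: x pr)
        finally show "norm (F x) \<le> M * ((\<lambda>\<alpha>. \<Prod>j\<in>insert i S. (cmod (w j) / R) ^ \<alpha> j) \<circ> (\<lambda>(n, \<beta>). \<beta>(i := n))) x" .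
      qed
      then show ?thesis by (rule Infinite_Sum.abs_summable_summable)
    qed
    have "(F has_sum g w) (UNIV \<times> PiE S (\<lambda>_. UNIV))"
      by (rule has_sum_SigmaI[OF inner outer summ])
    also have "?this \<longleftrightarrow> (((\<lambda>\<alpha>. (\<Prod>j\<in>insert i S. w j ^ \<alpha> j) * c (\<alpha> i) (restrict \<alpha> S)) \<circ> (\<lambda>(n, \<beta>). \<beta>(i := n)))
        has_sum g w) (UNIV \<times> PiE S (\<lambda>_. UNIV))"
    proof (rule has_sum_cong)
      fix x :: "nat \<times> ('i \<Rightarrow> nat)"
      assume "x \<in> UNIV \<times> PiE S (\<lambda>_. UNIV)"
      then obtain n \<beta> where x: "x = (n, \<beta>)" and \<beta>: "\<beta> \<in> PiE S (\<lambda>_. UNIV)" by (cases x) auto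
      have pr: "(\<Prod>j\<in>S. w j ^ (if j = i then n else \<beta> j)) = (\<Prod>j\<in>S. w j ^ \<beta> j)"
        by (rule prod.cong) (use insert.hyps in auto)
      have re: "restrict (\<beta>(i := n)) S = \<beta>"
        using \<beta> insert.hyps by (auto simp: fun_eq_iff restrict_def PiE_def extensional_def)
      show "F x = ((\<lambda>\<alpha>. (\<Prod>j\<in>insert i S. w j ^ \<alpha> j) * c (\<alpha> i) (restrict \<alpha> S)) \<circ> (\<lambda>(n, \<beta>). \<beta>(i := n))) x"
        using insert.hyps re by (simp add: x F_def pr)
    qed
    finally show "((\<lambda>\<alpha>. (\<Prod>j\<in>insert i S. w j ^ \<alpha> j) * c (\<alpha> i) (restrict \<alpha> S)) has_sum g w)
        (PiE (insert i S) (\<lambda>_. UNIV))"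
      unfolding PiE_insert_eq by (subst has_sum_reindex[OF inj])
  qed
qed

section \<open>Maps with a holomorphic extension\<close>

text \<open>The complexification of \<open>'a\<close> is \<open>'a \<times> 'a\<close>, where \<open>(x, y)\<close> stands for \<open>x + \<i> y\<close>; this is
  multiplication by \<open>\<i>\<close>.\<close>

definition imul :: "'a::euclidean_space \<times> 'a \<Rightarrow> 'a \<times> 'a"
  where "imul z = (- snd z, fst z)"

definition cscale :: "complex \<Rightarrow> 'a::euclidean_space \<Rightarrow> 'a \<times> 'a"
  where "cscale \<zeta> v = (Re \<zeta> *\<^sub>R v, Im \<zeta> *\<^sub>R v)"

text \<open>Holomorphy on an open set: the real derivatives commute with multiplication by \<open>\<i>\<close>, that is, they
  are complex-linear.\<close>

definition chol :: "('a::euclidean_space \<times> 'a \<Rightarrow> 'b::euclidean_space \<times> 'b) \<Rightarrow> ('a \<times> 'a) set \<Rightarrow> bool"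
  where "chol F \<Omega> \<longleftrightarrow> open \<Omega> \<and>
    (\<forall>z\<in>\<Omega>. \<exists>D. (F has_derivative D) (at z) \<and> (\<forall>v. D (imul v) = imul (D v)))"

text \<open>The working form of real-analyticity at \<open>p\<close>: a holomorphic extension to a neighbourhood in the
  complexification. Its stability under composition and inversion follows from the chain rule and
  the inverse function theorem, whereas for power series it would need estimates.\<close>

definition hol_ext :: "('a::euclidean_space \<Rightarrow> 'b::euclidean_space) \<Rightarrow> 'a \<Rightarrow> bool"
  where "hol_ext f p \<longleftrightarrow>
    (\<exists>\<Omega> F. (p, 0) \<in> \<Omega> \<and> chol F \<Omega> \<and> (\<forall>x. (x, 0) \<in> \<Omega> \<longrightarrow> F (x, 0) = (f x, 0)))"

lemma open_slice: "open V \<Longrightarrow> open {x. (x, c) \<in> V}"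
  using open_vimage[of V "\<lambda>x. (x, c)"] by (simp add: vimage_def continuous_on_Pair)

lemma chol_subset: "chol F \<Omega> \<Longrightarrow> open \<Omega>' \<Longrightarrow> \<Omega>' \<subseteq> \<Omega> \<Longrightarrow> chol F \<Omega>'"
  unfolding chol_def by blast

lemma hol_ext_cong:
  assumes "hol_ext f p" "open U" "p \<in> U" "\<And>x. x \<in> U \<Longrightarrow> f x = g x"
  shows "hol_ext g p"
proof -
  obtain \<Omega> F where h: "(p, 0) \<in> \<Omega>" "chol F \<Omega>" "\<forall>x. (x, 0) \<in> \<Omega> \<longrightarrow> F (x, 0) = (f x, 0)"
    using assms unfolding hol_ext_def by blast
  have "chol F (\<Omega> \<inter> (U \<times> UNIV))"
    by (rule chol_subset[OF h(2)]) (use h(2) assms in \<open>auto simp: chol_def open_Times\<close>)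
  then show ?thesis
    unfolding hol_ext_def using h assms by (intro exI[of _ "\<Omega> \<inter> (U \<times> UNIV)"] exI[of _ F]) auto
qed

lemma hol_ext_compose:
  assumes "hol_ext f p" "hol_ext g (f p)"
  shows "hol_ext (\<lambda>x. g (f x)) p"
proof -
  obtain \<Omega> F where f: "(p, 0) \<in> \<Omega>" "chol F \<Omega>" "\<forall>x. (x, 0) \<in> \<Omega> \<longrightarrow> F (x, 0) = (f x, 0)"
    using assms unfolding hol_ext_def by blast
  obtain \<Omega>' G where g: "(f p, 0) \<in> \<Omega>'" "chol G \<Omega>'" "\<forall>x. (x, 0) \<in> \<Omega>' \<longrightarrow> G (x, 0) = (g x, 0)"
    using assms unfolding hol_ext_def by blast
  have cont: "continuous_on \<Omega> F"
    using f(2) unfolding chol_def by (metis continuous_at_imp_continuous_on has_derivative_continuous)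
  have op: "open (\<Omega> \<inter> F -` \<Omega>')"
    using continuous_open_preimage[OF cont] f(2) g(2) by (simp add: chol_def)
  have "chol (G \<circ> F) (\<Omega> \<inter> F -` \<Omega>')"
    unfolding chol_def
  proof (intro conjI ballI op)
    fix z assume z: "z \<in> \<Omega> \<inter> F -` \<Omega>'"
    obtain D where D: "(F has_derivative D) (at z)" "\<And>v. D (imul v) = imul (D v)"
      using f(2) z unfolding chol_def by blast
    obtain E where E: "(G has_derivative E) (at (F z))" "\<And>v. E (imul v) = imul (E v)"
      using g(2) z unfolding chol_def by blast
    show "\<exists>D. (G \<circ> F has_derivative D) (at z) \<and> (\<forall>v. D (imul v) = imul (D v))"
      using diff_chain_at[OF D(1) E(1)] D(2) E(2) by (intro exI[of _ "E \<circ> D"]) simp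
  qed
  then show ?thesis
    unfolding hol_ext_def using f g
    by (intro exI[of _ "\<Omega> \<inter> F -` \<Omega>'"] exI[of _ "G \<circ> F"]) auto
qed

lemma hol_ext_differentiable:
  assumes "hol_ext f p"
  shows "f differentiable (at p)"
proof -
  obtain \<Omega> F where f: "(p, 0) \<in> \<Omega>" "chol F \<Omega>" "\<forall>x. (x, 0) \<in> \<Omega> \<longrightarrow> F (x, 0) = (f x, 0)"
    using assms unfolding hol_ext_def by blast
  obtain D where D: "(F has_derivative D) (at (p, 0))"
    using f unfolding chol_def by blast
  have "((\<lambda>x. (x, 0)) has_derivative (\<lambda>h. (h, 0))) (at p)"
    by (intro derivative_intros)
  from has_derivative_fst[OF has_derivative_compose[OF this D]]
  have d: "((\<lambda>x. fst (F (x, 0))) has_derivative (\<lambda>h. fst (D (h, 0)))) (at p)" .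
  have "(f has_derivative (\<lambda>h. fst (D (h, 0)))) (at p)"
    by (rule has_derivative_transform_within_open[OF d, of "{x. (x, 0) \<in> \<Omega>}"])
       (use f in \<open>auto simp: chol_def open_slice\<close>)
  then show ?thesis
    by (auto simp: differentiable_def)
qed

text \<open>The link to functions of one complex variable: on a complex line, a coordinate of a holomorphic map
  has a derivative that is complex-linear, hence multiplication by its value at 1.\<close>

lemma chol_line_holomorphic:
  assumes "chol F \<Omega>" and "open S" and "\<And>\<zeta>. \<zeta> \<in> S \<Longrightarrow> z0 + cscale \<zeta> v \<in> \<Omega>"
  shows "(\<lambda>\<zeta>. Complex (fst (F (z0 + cscale \<zeta> v)) \<bullet> b) (snd (F (z0 + cscale \<zeta> v)) \<bullet> b)) holomorphic_on S"
  unfolding holomorphic_on_open[OF \<open>open S\<close>]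
proof
  fix \<zeta> assume "\<zeta> \<in> S"
  then have "z0 + cscale \<zeta> v \<in> \<Omega>" using assms by blast
  then obtain D where D: "(F has_derivative D) (at (z0 + cscale \<zeta> v))" "\<And>v. D (imul v) = imul (D v)"
    using assms(1) unfolding chol_def by blast
  interpret D: bounded_linear D by (rule has_derivative_bounded_linear[OF D(1)])
  have "((\<lambda>\<zeta>. z0 + cscale \<zeta> v) has_derivative (\<lambda>h. cscale h v)) (at \<zeta>)"
    unfolding cscale_def by (auto intro!: derivative_eq_intros)
  note d = has_derivative_compose[OF this D(1)]
  define L where "L h = complex_of_real (fst (D (cscale h v)) \<bullet> b) + \<i> * complex_of_real (snd (D (cscale h v)) \<bullet> b)" for h
  have "((\<lambda>\<zeta>. complex_of_real (fst (F (z0 + cscale \<zeta> v)) \<bullet> b) + \<i> * complex_of_real (snd (F (z0 + cscale \<zeta> v)) \<bullet> b)) has_derivative L) (at \<zeta>)"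
    unfolding L_def using d by (auto intro!: derivative_eq_intros)
  moreover have "L = (*) (L 1)"
  proof
    fix h
    have "cscale h v = Re h *\<^sub>R (v, 0) + Im h *\<^sub>R imul (v, 0)"
      by (simp add: cscale_def imul_def)
    then have "D (cscale h v) = Re h *\<^sub>R D (v, 0) + Im h *\<^sub>R imul (D (v, 0))"
      by (simp only: D.add D.scaleR D(2))
    moreover have "D (cscale 1 v) = D (v, 0)"
      by (simp add: cscale_def zero_prod_def)
    ultimately show "L h = L 1 * h"
      by (simp add: L_def complex_eq_iff imul_def inner_diff_left inner_add_left algebra_simps)
  qed
  ultimately have "((\<lambda>\<zeta>. complex_of_real (fst (F (z0 + cscale \<zeta> v)) \<bullet> b) + \<i> * complex_of_real (snd (F (z0 + cscale \<zeta> v)) \<bullet> b)) has_field_derivative L 1) (at \<zeta>)"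
    unfolding has_field_derivative_def by metis
  then show "\<exists>f'. ((\<lambda>\<zeta>. Complex (fst (F (z0 + cscale \<zeta> v)) \<bullet> b) (snd (F (z0 + cscale \<zeta> v)) \<bullet> b)) has_field_derivative f') (at \<zeta>)"
    unfolding Complex_eq by blast
qed

lemma has_sum_sum_of_family:
  fixes f :: "'i \<Rightarrow> 'x \<Rightarrow> 'b::{topological_comm_monoid_add}"
  assumes "finite I" "\<And>i. i \<in> I \<Longrightarrow> (f i has_sum s i) A"
  shows "((\<lambda>x. \<Sum>i\<in>I. f i x) has_sum (\<Sum>i\<in>I. s i)) A"
  using assms by (induction I rule: finite_induct) (auto intro: has_sum_add)

text \<open>In coordinates with respect to the basis, the extension is bounded near \<open>p\<close> and holomorphic in each
  coordinate, so it has a power series there. At real points the series represents \<open>f\<close>, and taking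
  the real parts of the coefficients makes it a real series.\<close>

theorem hol_ext_imp_real_analytic:
  fixes f :: "'a::euclidean_space \<Rightarrow> 'b::euclidean_space"
  assumes "hol_ext f p"
  shows "real_analytic_at f p"
proof -
  obtain \<Omega> F where f: "(p, 0) \<in> \<Omega>" "chol F \<Omega>" "\<forall>x. (x, 0) \<in> \<Omega> \<longrightarrow> F (x, 0) = (f x, 0)"
    using assms unfolding hol_ext_def by blast
  have op: "open \<Omega>" using f(2) by (simp add: chol_def)
  have "isCont F (p, 0)"
    using f unfolding chol_def by (metis has_derivative_continuous)
  then obtain d1 where d1: "0 < d1" "\<And>z. dist z (p, 0) < d1 \<Longrightarrow> dist (F z) (F (p, 0)) < 1"
    unfolding continuous_at_eps_delta by (metis zero_less_one)
  obtain d2 where d2: "0 < d2" "\<And>z. dist z (p, 0) < d2 \<Longrightarrow> z \<in> \<Omega>"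
    using op f(1) unfolding open_dist by metis
  define \<delta> where "\<delta> = min d1 d2"
  \<comment> \<open>The real and imaginary parts of a point of the polydisc of radius \<open>R\<close> have norm at most \<open>DIM('a) * R\<close>.\<close>
  define R where "R = \<delta> / (4 * DIM('a))"
  have \<delta>: "0 < \<delta>" using d1 d2 by (simp add: \<delta>_def)
  have R: "0 < R" using \<delta> by (simp add: R_def)
  define Z where "Z w = (p + (\<Sum>b\<in>Basis. Re (w b) *\<^sub>R b), (\<Sum>b\<in>Basis. Im (w b) *\<^sub>R b))" for w :: "'a \<Rightarrow> complex"
  have near: "dist (Z w) (p, 0) < \<delta>" if w: "\<And>j. cmod (w j) < R" for w
  proof -
    have re: "norm (\<Sum>b\<in>Basis. Re (w b) *\<^sub>R b) \<le> DIM('a) * R"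
      by (rule sum_norm_bound) (use w in \<open>auto intro: order_trans[OF abs_Re_le_cmod less_imp_le]\<close>)
    have im: "norm (\<Sum>b\<in>Basis. Im (w b) *\<^sub>R b) \<le> DIM('a) * R"
      by (rule sum_norm_bound) (use w in \<open>auto intro: order_trans[OF abs_Im_le_cmod less_imp_le]\<close>)
    have "dist (Z w) (p, 0) = norm (\<Sum>b\<in>Basis. Re (w b) *\<^sub>R b, \<Sum>b\<in>Basis. Im (w b) *\<^sub>R b)"
      by (simp add: dist_norm Z_def)
    also have "\<dots> \<le> norm (\<Sum>b\<in>Basis. Re (w b) *\<^sub>R b) + norm (\<Sum>b\<in>Basis. Im (w b) *\<^sub>R b)"
      by (rule norm_Pair_le)
    also have "\<dots> \<le> DIM('a) * R + DIM('a) * R"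
      by (intro add_mono re im)
    also have "\<dots> < \<delta>" using \<delta> by (simp add: R_def field_simps)
    finally show ?thesis .
  qed
  define g where "g b w = Complex (fst (F (Z w)) \<bullet> b) (snd (F (Z w)) \<bullet> b)" for b w
  have series: "\<exists>c. (\<forall>\<alpha>. cmod (c \<alpha>) \<le> (2 * (norm (F (p, 0)) + 1)) / R ^ (\<Sum>i\<in>Basis. \<alpha> i)) \<and>
    (\<forall>w. (\<forall>j. cmod (w j) < R) \<longrightarrow> (\<forall>j. j \<notin> Basis \<longrightarrow> w j = 0) \<longrightarrow>
       ((\<lambda>\<alpha>. (\<Prod>i\<in>Basis. w i ^ \<alpha> i) * c \<alpha>) has_sum g b w) (PiE Basis (\<lambda>_. UNIV)))"
    if b: "b \<in> Basis" for b
  proof (rule separately_holomorphic_power_series)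
    fix w :: "'a \<Rightarrow> complex" assume w: "\<And>j. cmod (w j) < R"
    have "dist (F (Z w)) (F (p, 0)) < 1" using d1 near[OF w] by (simp add: \<delta>_def)
    then have FZ: "norm (F (Z w)) \<le> norm (F (p, 0)) + 1"
      by (smt (verit) dist_norm norm_triangle_sub)
    have "cmod (g b w) \<le> \<bar>fst (F (Z w)) \<bullet> b\<bar> + \<bar>snd (F (Z w)) \<bullet> b\<bar>"
      using cmod_le[of "g b w"] by (simp add: g_def)
    also have "\<dots> \<le> norm (fst (F (Z w))) + norm (snd (F (Z w)))"
      by (intro add_mono Basis_le_norm b)
    also have "\<dots> \<le> norm (F (Z w)) + norm (F (Z w))"
      using norm_fst_le[of "fst (F (Z w))" "snd (F (Z w))"] norm_snd_le[of "snd (F (Z w))" "fst (F (Z w))"]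
      by simp
    finally show "cmod (g b w) \<le> 2 * (norm (F (p, 0)) + 1)"
      using FZ by simp
  next
    fix i :: 'a and w :: "'a \<Rightarrow> complex"
    assume i: "i \<in> Basis" and w: "\<And>j. cmod (w j) < R"
    have Z: "Z (w(i := \<zeta>)) = Z (w(i := 0)) + cscale \<zeta> i" for \<zeta>
    proof -
      have "(\<Sum>b\<in>Basis. h ((w(i := \<zeta>)) b) *\<^sub>R b) = (\<Sum>b\<in>Basis. h ((w(i := 0)) b) *\<^sub>R b) + h \<zeta> *\<^sub>R i"
        if "h 0 = 0" for h :: "complex \<Rightarrow> real"
      proof -
        have "(\<Sum>b\<in>Basis - {i}. h ((w(i := \<zeta>)) b) *\<^sub>R b) = (\<Sum>b\<in>Basis - {i}. h ((w(i := 0)) b) *\<^sub>R b)"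
          by (rule sum.cong) auto
        then show ?thesis
          using that by (simp add: sum.remove[OF finite_Basis i])
      qed
      from this[of Re] this[of Im] show ?thesis
        by (simp add: Z_def cscale_def)
    qed
    have "(\<lambda>\<zeta>. Complex (fst (F (Z (w(i := 0)) + cscale \<zeta> i)) \<bullet> b) (snd (F (Z (w(i := 0)) + cscale \<zeta> i)) \<bullet> b))
        holomorphic_on ball 0 R"
    proof (rule chol_line_holomorphic[OF f(2) open_ball])
      fix \<zeta> assume "\<zeta> \<in> ball (0::complex) R"
      then have "dist (Z (w(i := \<zeta>))) (p, 0) < \<delta>"
        by (intro near) (use w in auto)
      then have "Z (w(i := \<zeta>)) \<in> \<Omega>"
        by (intro d2(2)) (simp add: \<delta>_def)
      then show "Z (w(i := 0)) + cscale \<zeta> i \<in> \<Omega>"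
        by (simp only: Z[symmetric])
    qed
    then show "(\<lambda>\<zeta>. g b (w(i := \<zeta>))) holomorphic_on ball 0 R"
      by (simp only: g_def Z[symmetric])
  qed (use R in auto)
  have "\<exists>c. \<forall>w. (\<forall>j. cmod (w j) < R) \<longrightarrow> (\<forall>j. j \<notin> Basis \<longrightarrow> w j = 0) \<longrightarrow>
       ((\<lambda>\<alpha>. (\<Prod>i\<in>Basis. w i ^ \<alpha> i) * c \<alpha>) has_sum g b w) (PiE Basis (\<lambda>_. UNIV))"
    if "b \<in> Basis" for b
  proof -
    from series[OF that] obtain c where "\<forall>w. (\<forall>j. cmod (w j) < R) \<longrightarrow> (\<forall>j. j \<notin> Basis \<longrightarrow> w j = 0) \<longrightarrow>
       ((\<lambda>\<alpha>. (\<Prod>i\<in>Basis. w i ^ \<alpha> i) * c \<alpha>) has_sum g b w) (PiE Basis (\<lambda>_. UNIV))"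
      by (elim exE conjE)
    then show ?thesis by (rule exI[of _ c])
  qed
  then have "\<forall>b\<in>Basis. \<exists>c. \<forall>w. (\<forall>j. cmod (w j) < R) \<longrightarrow> (\<forall>j. j \<notin> Basis \<longrightarrow> w j = 0) \<longrightarrow>
       ((\<lambda>\<alpha>. (\<Prod>i\<in>Basis. w i ^ \<alpha> i) * c \<alpha>) has_sum g b w) (PiE Basis (\<lambda>_. UNIV))" ..
  then obtain c where c0: "\<forall>b\<in>Basis. \<forall>w. (\<forall>j. cmod (w j) < R) \<longrightarrow> (\<forall>j. j \<notin> Basis \<longrightarrow> w j = 0) \<longrightarrow>
       ((\<lambda>\<alpha>. (\<Prod>i\<in>Basis. w i ^ \<alpha> i) * c b \<alpha>) has_sum g b w) (PiE Basis (\<lambda>_. UNIV))"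
    by (rule bchoice[THEN exE])
  have c: "((\<lambda>\<alpha>. (\<Prod>i\<in>Basis. w i ^ \<alpha> i) * c b \<alpha>) has_sum g b w) (PiE Basis (\<lambda>_. UNIV))"
    if "b \<in> Basis" "\<forall>j. cmod (w j) < R" "\<forall>j. j \<notin> Basis \<longrightarrow> w j = 0" for b w
    by (rule mp[OF mp[OF spec[OF bspec[OF c0]]]]) (fact that)+
  show ?thesis
    unfolding real_analytic_at_def
  proof (intro exI conjI ballI)
    fix x assume x: "x \<in> ball p R"
    define w where "w j = (if j \<in> Basis then complex_of_real ((x - p) \<bullet> j) else 0)" for j
    have "cmod (w j) \<le> norm (x - p)" for j
      by (simp add: w_def Basis_le_norm)
    moreover have "norm (x - p) < R"
      using x by (simp add: dist_norm norm_minus_commute)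
    ultimately have w: "\<forall>j. cmod (w j) < R"
      by (blast intro: le_less_trans)
    have w0: "\<forall>j. j \<notin> Basis \<longrightarrow> w j = 0"
      by (simp add: w_def)
    have "(\<Sum>b\<in>Basis. Re (w b) *\<^sub>R b) = (\<Sum>b\<in>Basis. ((x - p) \<bullet> b) *\<^sub>R b)"
      by (rule sum.cong) (auto simp: w_def)
    then have re: "(\<Sum>b\<in>Basis. Re (w b) *\<^sub>R b) = x - p"
      by (simp only: euclidean_representation)
    have im: "(\<Sum>b\<in>Basis. Im (w b) *\<^sub>R b) = 0"
      by (rule sum.neutral) (auto simp: w_def)
    have Zw: "Z w = (x, 0)"
      by (simp add: Z_def re im)
    have "(x, 0) \<in> \<Omega>"
      using near[of w] w d2 Zw by (simp add: \<delta>_def)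
    then have gw: "Re (g b w) = f x \<bullet> b" for b
      using f(3) by (simp add: g_def Zw)
    have "((\<lambda>\<alpha>. (\<Prod>i\<in>Basis. ((x - p) \<bullet> i) ^ \<alpha> i) * Re (c b \<alpha>)) has_sum (f x \<bullet> b)) (PiE Basis (\<lambda>_. UNIV))"
      if b: "b \<in> Basis" for b
    proof -
      have "(\<Prod>i\<in>Basis. w i ^ \<alpha> i) = complex_of_real (\<Prod>i\<in>Basis. ((x - p) \<bullet> i) ^ \<alpha> i)" for \<alpha>
        unfolding of_real_prod by (rule prod.cong) (auto simp: w_def)
      moreover have "Re (complex_of_real r * z) = r * Re z" for r z
        by simp
      ultimately show ?thesis
        using has_sum_Re[OF c[OF b w w0]] by (simp only: gw)
    qed
    then have "((\<lambda>\<alpha>. \<Sum>b\<in>Basis. ((\<Prod>i\<in>Basis. ((x - p) \<bullet> i) ^ \<alpha> i) * Re (c b \<alpha>)) *\<^sub>R b) has_sum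
        (\<Sum>b\<in>Basis. (f x \<bullet> b) *\<^sub>R b)) (PiE Basis (\<lambda>_. UNIV))"
      by (intro has_sum_sum_of_family finite_Basis has_sum_bounded_linear[OF bounded_linear_scaleR_left])
    moreover have "(\<Sum>b\<in>Basis. (P * Re (c b \<alpha>)) *\<^sub>R b) = P *\<^sub>R (\<Sum>b\<in>Basis. Re (c b \<alpha>) *\<^sub>R b)" for P \<alpha>
      by (simp add: scaleR_sum_right)
    ultimately show "((\<lambda>\<alpha>. (\<Prod>b\<in>Basis. ((x - p) \<bullet> b) ^ \<alpha> b) *\<^sub>R (\<Sum>b\<in>Basis. Re (c b \<alpha>) *\<^sub>R b)) has_sum f x)
        (Basis \<rightarrow>\<^sub>E UNIV)"
      by (simp only: euclidean_representation)
  qed (use R in simp)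
qed

text \<open>Tangent vectors are velocities of \<open>C\<^sup>1\<close> curves, which are obtained as images of lines. Along a line
  the map is the restriction of a holomorphic function of one variable, whose derivative is
  automatically continuous.\<close>

lemma hol_ext_curve:
  fixes f :: "'a::euclidean_space \<Rightarrow> 'b::euclidean_space"
  assumes "hol_ext f p"
  obtains d where "0 < d" "(\<lambda>t. f (p + t *\<^sub>R v)) C1_differentiable_on {-d<..<d}"
proof -
  obtain \<Omega> F where f: "(p, 0) \<in> \<Omega>" "chol F \<Omega>" "\<forall>x. (x, 0) \<in> \<Omega> \<longrightarrow> F (x, 0) = (f x, 0)"
    using assms unfolding hol_ext_def by blast
  have op: "open \<Omega>" using f(2) by (simp add: chol_def)
  have cont: "continuous_on UNIV (\<lambda>\<zeta>. (p, 0) + cscale \<zeta> v)"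
    unfolding cscale_def by (intro continuous_intros)
  have "open ((\<lambda>\<zeta>. (p, 0) + cscale \<zeta> v) -` \<Omega>)"
    by (rule open_vimage[OF op cont])
  moreover have "0 \<in> (\<lambda>\<zeta>. (p, 0) + cscale \<zeta> v) -` \<Omega>"
    using f(1) by (simp add: cscale_def)
  ultimately obtain d where d: "0 < d" "ball 0 d \<subseteq> (\<lambda>\<zeta>. (p, 0) + cscale \<zeta> v) -` \<Omega>"
    using open_contains_ball by blast
  define g where "g b \<zeta> = Complex (fst (F ((p, 0) + cscale \<zeta> v)) \<bullet> b) (snd (F ((p, 0) + cscale \<zeta> v)) \<bullet> b)" for b \<zeta>
  have hol: "g b holomorphic_on ball 0 d" for b
    unfolding g_def[abs_def] by (rule chol_line_holomorphic[OF f(2) open_ball]) (use d in auto)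
  have in_ball: "complex_of_real t \<in> ball 0 d" if "t \<in> {-d<..<d}" for t
    using that by auto
  have fg: "f (p + t *\<^sub>R v) = (\<Sum>b\<in>Basis. Re (g b (of_real t)) *\<^sub>R b)" if "t \<in> {-d<..<d}" for t
  proof -
    have "(p + t *\<^sub>R v, 0) \<in> \<Omega>"
      using subsetD[OF d(2) in_ball[OF that]] by (simp add: cscale_def)
    then have "F (p + t *\<^sub>R v, 0) = (f (p + t *\<^sub>R v), 0)" using f(3) by blast
    then have "Re (g b (of_real t)) = f (p + t *\<^sub>R v) \<bullet> b" for b
      by (simp add: g_def cscale_def)
    then show ?thesis by (simp add: euclidean_representation)
  qed
  have "(\<lambda>t. f (p + t *\<^sub>R v)) C1_differentiable_on {-d<..<d}"
    unfolding C1_differentiable_on_def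
  proof (intro exI conjI ballI)
    fix t assume t: "t \<in> {-d<..<d}"
    have "((\<lambda>t. Re (g b (of_real t))) has_vector_derivative Re (deriv (g b) (of_real t))) (at t)" for b
    proof -
      have "(g b has_field_derivative deriv (g b) (of_real t)) (at (of_real t))"
        using holomorphic_derivI[OF hol open_ball in_ball[OF t]] .
      from has_vector_derivative_real_field[OF this]
      show ?thesis
        using bounded_linear.has_vector_derivative[OF bounded_linear_Re] by blast
    qed
    then have "((\<lambda>t. \<Sum>b\<in>Basis. Re (g b (of_real t)) *\<^sub>R b) has_vector_derivative
        (\<Sum>b\<in>Basis. Re (deriv (g b) (of_real t)) *\<^sub>R b)) (at t)"
      by (intro has_vector_derivative_sum bounded_linear.has_vector_derivative[OF bounded_linear_scaleR_left])
    then show "((\<lambda>t. f (p + t *\<^sub>R v)) has_vector_derivative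
        (\<Sum>b\<in>Basis. Re (deriv (g b) (of_real t)) *\<^sub>R b)) (at t)"
      by (rule has_vector_derivative_transform_within_open[of _ _ _ "{-d<..<d}"]) (use t fg in auto)
  next
    have "continuous_on {-d<..<d} (\<lambda>t. deriv (g b) (complex_of_real t))" for b
      by (rule continuous_on_compose2[OF holomorphic_on_imp_continuous_on[OF holomorphic_deriv[OF hol open_ball]]])
         (use in_ball in \<open>auto intro!: continuous_intros\<close>)
    then show "continuous_on {-d<..<d} (\<lambda>t. \<Sum>b\<in>Basis. Re (deriv (g b) (of_real t)) *\<^sub>R b)"
      by (intro continuous_intros)
  qed
  then show thesis using that d by blast
qed

section \<open>Entire maps and the inverse function theorem\<close>

text \<open>The inverse function theorem needs an extension that is continuously differentiable. The maps that
  are inverted below are polynomial, and for polynomials the extension is global.\<close>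

definition entire_ext :: "('a::euclidean_space \<Rightarrow> 'b::euclidean_space) \<Rightarrow> bool"
  where "entire_ext f \<longleftrightarrow> (\<exists>F F'.
    (\<forall>z. (F has_derivative F' z) (at z)) \<and> (\<forall>v. continuous_on UNIV (\<lambda>z. F' z v)) \<and>
    (\<forall>z v. F' z (imul v) = imul (F' z v)) \<and> (\<forall>x. F (x, 0) = (f x, 0)))"

lemma entire_extI:
  assumes "\<And>z. (F has_derivative F' z) (at z)" "\<And>v. continuous_on UNIV (\<lambda>z. F' z v)"
    and "\<And>z v. F' z (imul v) = imul (F' z v)" "\<And>x. F (x, 0) = (f x, 0)"
  shows "entire_ext f"
  unfolding entire_ext_def using assms by blast

lemma entire_ext_imp_hol_ext: "entire_ext f \<Longrightarrow> hol_ext f p"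
  unfolding entire_ext_def hol_ext_def chol_def by (metis UNIV_I open_UNIV)

lemma entire_ext_const: "entire_ext (\<lambda>x. c)"
  unfolding entire_ext_def
  by (rule exI[of _ "\<lambda>z. (c, 0)"], rule exI[of _ "\<lambda>z v. 0"]) (auto simp: imul_def prod_eq_iff)

lemma entire_ext_linear:
  assumes "linear f" shows "entire_ext f"
proof -
  interpret bounded_linear f using assms by (simp add: linear_conv_bounded_linear)
  have "((\<lambda>z. (f (fst z), f (snd z))) has_derivative (\<lambda>z. (f (fst z), f (snd z)))) (at z)" for z :: "'a \<times> 'a"
    by (intro has_derivative_Pair has_derivative has_derivative_fst has_derivative_snd has_derivative_ident)
  then show ?thesis
    unfolding entire_ext_def
    by (intro exI[of _ "\<lambda>z. (f (fst z), f (snd z))"] exI[of _ "\<lambda>_ z. (f (fst z), f (snd z))"])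
       (auto simp: imul_def zero neg)
qed

text \<open>The complexification of a bilinear map is given by the rule for the product of complex numbers.\<close>

lemma entire_ext_bilinear:
  fixes b :: "'b::euclidean_space \<Rightarrow> 'c::euclidean_space \<Rightarrow> 'd::euclidean_space"
  assumes "bounded_bilinear b" "entire_ext f" "entire_ext g"
  shows "entire_ext (\<lambda>x::'a::euclidean_space. b (f x) (g x))"
proof -
  interpret b: bounded_bilinear b by fact
  obtain F F' where F: "\<And>z. (F has_derivative F' z) (at z)" "\<And>v. continuous_on UNIV (\<lambda>z. F' z v)"
      "\<And>z v. F' z (imul v) = imul (F' z v)" "\<And>x. F (x, 0) = (f x, 0)"
    using assms(2) unfolding entire_ext_def by blast
  obtain G G' where G: "\<And>z. (G has_derivative G' z) (at z)" "\<And>v. continuous_on UNIV (\<lambda>z. G' z v)"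
      "\<And>z v. G' z (imul v) = imul (G' z v)" "\<And>x. G (x, 0) = (g x, 0)"
    using assms(3) unfolding entire_ext_def by blast
  have c: "continuous_on UNIV F" "continuous_on UNIV G"
    using F(1) G(1) by (auto intro!: continuous_at_imp_continuous_on has_derivative_continuous)
  have FG: "((\<lambda>z. b (p (F z)) (q (G z))) has_derivative
      (\<lambda>v. b (p (F z)) (q (G' z v)) + b (p (F' z v)) (q (G z)))) (at z)"
    if "bounded_linear p" "bounded_linear q" for p q z
    by (rule b.FDERIV[OF bounded_linear.has_derivative[OF that(1) F(1)] bounded_linear.has_derivative[OF that(2) G(1)]])
  note bl = bounded_linear_fst bounded_linear_snd
  have deriv: "((\<lambda>z. (b (fst (F z)) (fst (G z)) - b (snd (F z)) (snd (G z)),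
                 b (fst (F z)) (snd (G z)) + b (snd (F z)) (fst (G z)))) has_derivative
       (\<lambda>v. ((b (fst (F z)) (fst (G' z v)) + b (fst (F' z v)) (fst (G z)))
            - (b (snd (F z)) (snd (G' z v)) + b (snd (F' z v)) (snd (G z))),
             (b (fst (F z)) (snd (G' z v)) + b (fst (F' z v)) (snd (G z)))
            + (b (snd (F z)) (fst (G' z v)) + b (snd (F' z v)) (fst (G z)))))) (at z)" for z
    by (intro has_derivative_Pair has_derivative_add has_derivative_diff FG bl)
  show ?thesis
    apply (rule entire_extI[OF deriv])
    subgoal by (intro continuous_intros b.continuous_on F(2) G(2) c)
    subgoal by (simp only: F(3) G(3)) (simp add: imul_def b.minus_left b.minus_right)
    subgoal by (simp add: F(4) G(4) b.zero_left b.zero_right)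
    done
qed

lemma entire_ext_add:
  assumes "entire_ext f" "entire_ext g"
  shows "entire_ext (\<lambda>x. f x + g x)"
proof -
  obtain F F' where F: "\<And>z. (F has_derivative F' z) (at z)" "\<And>v. continuous_on UNIV (\<lambda>z. F' z v)"
      "\<And>z v. F' z (imul v) = imul (F' z v)" "\<And>x. F (x, 0) = (f x, 0)"
    using assms(1) unfolding entire_ext_def by blast
  obtain G G' where G: "\<And>z. (G has_derivative G' z) (at z)" "\<And>v. continuous_on UNIV (\<lambda>z. G' z v)"
      "\<And>z v. G' z (imul v) = imul (G' z v)" "\<And>x. G (x, 0) = (g x, 0)"
    using assms(2) unfolding entire_ext_def by blast
  have deriv: "((\<lambda>z. F z + G z) has_derivative (\<lambda>v. F' z v + G' z v)) (at z)" for z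
    by (intro has_derivative_add F G)
  show ?thesis
    apply (rule entire_extI[OF deriv])
    subgoal by (intro continuous_intros F(2) G(2))
    subgoal by (simp only: F(3) G(3)) (simp add: imul_def)
    subgoal by (simp add: F(4) G(4))
    done
qed

lemma entire_ext_linear_compose:
  assumes "linear l" "entire_ext f"
  shows "entire_ext (\<lambda>x. l (f x))"
proof -
  have "bounded_linear l" using assms by (simp add: linear_conv_bounded_linear)
  then have "bounded_bilinear (\<lambda>r x. r *\<^sub>R l x)"
    by (rule bounded_bilinear.comp[OF bounded_bilinear_scaleR bounded_linear_ident])
  from entire_ext_bilinear[OF this entire_ext_const[of "1::real"] assms(2)]
  show ?thesis by simp
qed

text \<open>At a real point the derivative of the extension is \<open>f' \<times> f'\<close>, so the extension has a local inverse.
  The inverse of a complex-linear map is complex-linear, hence this local inverse is holomorphic. By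
  invariance of domain the image under \<open>f\<close> of a real neighbourhood is open, and over it the local
  inverse of the extension takes real points to real points.\<close>

theorem entire_ext_inverse_function:
  fixes f :: "'a::euclidean_space \<Rightarrow> 'a"
  assumes "entire_ext f" and f': "(f has_derivative f') (at x0)" and "inj f'"
  obtains U V g where "open U" "open V" "x0 \<in> U" "homeomorphism U V f g" "\<forall>y\<in>V. hol_ext g y"
proof -
  obtain F F' where F: "\<And>z. (F has_derivative F' z) (at z)" "\<And>v. continuous_on UNIV (\<lambda>z. F' z v)"
      "\<And>z v. F' z (imul v) = imul (F' z v)" "\<And>x. F (x, 0) = (f x, 0)"
    using assms(1) unfolding entire_ext_def by blast
  have blF: "bounded_linear (F' z)" for z
    by (rule has_derivative_bounded_linear[OF F(1)])
  define FB where "FB z = Blinfun (F' z)" for z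
  have FB: "blinfun_apply (FB z) = F' z" for z
    unfolding FB_def by (rule bounded_linear_Blinfun_apply[OF blF])
  have contFB: "continuous_on UNIV FB"
    by (rule continuous_on_blinfun_componentwise) (simp add: FB F(2))
  have lf': "linear f'"
    using has_derivative_bounded_linear[OF f'] by (simp add: linear_conv_bounded_linear)
  have "((\<lambda>x. (x, 0)) has_derivative (\<lambda>h. (h, 0))) (at x0)"
    by (intro derivative_intros)
  from has_derivative_compose[OF this F(1)]
  have "((\<lambda>x. (f x, 0)) has_derivative (\<lambda>h. F' (x0, 0) (h, 0))) (at x0)"
    by (simp add: F(4))
  moreover have "((\<lambda>x. (f x, 0::'a)) has_derivative (\<lambda>h. (f' h, 0))) (at x0)"
    by (intro has_derivative_Pair f' has_derivative_const)
  ultimately have "(\<lambda>h. F' (x0, 0) (h, 0)) = (\<lambda>h. (f' h, 0))"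
    by (rule has_derivative_unique)
  then have F0: "F' (x0, 0) (h, 0) = (f' h, 0)" for h
    by (rule fun_cong)
  \<comment> \<open>Complex linearity determines the derivative from its values in the real directions.\<close>
  have F'0: "F' (x0, 0) (v, w) = (f' v, f' w)" for v w
  proof -
    have "(v, w) = (v, 0) + imul (w, 0)" by (simp add: imul_def)
    then show ?thesis
      by (simp only: bounded_linear.linear[OF blF, THEN linear_add] F(3) F0) (simp add: imul_def)
  qed
  obtain k where k: "linear k" "k \<circ> f' = id"
    using linear_injective_left_inverse[OF lf' \<open>inj f'\<close>] by blast
  have k': "bounded_linear k" using k by (simp add: linear_conv_bounded_linear)
  define K where "K z = (k (fst z), k (snd z))" for z :: "'a \<times> 'a"
  have blK: "bounded_linear K"
    unfolding K_def by (intro bounded_linear_Pair bounded_linear_compose[OF k'] bounded_linear_fst bounded_linear_snd)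
  have inv: "Blinfun K o\<^sub>L FB (x0, 0) = id_blinfun"
  proof (rule blinfun_eqI)
    fix z :: "'a \<times> 'a"
    show "blinfun_apply (Blinfun K o\<^sub>L FB (x0, 0)) z = blinfun_apply id_blinfun z"
      using fun_cong[OF k(2)] by (cases z) (simp add: bounded_linear_Blinfun_apply[OF blK] FB F'0 K_def)
  qed
  obtain U V G G' where G: "open U" "(x0, 0) \<in> U" "open V" "homeomorphism U V F G"
      "\<And>y. y \<in> V \<Longrightarrow> (G has_derivative G' y) (at y)"
      "\<And>y. y \<in> V \<Longrightarrow> G' y = inv_into UNIV (F' (G y))" "\<And>y. y \<in> V \<Longrightarrow> bij (F' (G y))"
    by (rule inverse_function_theorem[OF open_UNIV _ contFB UNIV_I inv, of F]) (auto simp: FB F)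
  have cholG: "chol G V"
    unfolding chol_def
  proof (intro conjI ballI G(3))
    fix y assume y: "y \<in> V"
    have "G' y (imul v) = imul (G' y v)" for v
    proof -
      have "F' (G y) (imul (G' y v)) = imul v"
        using G(6,7)[OF y] by (simp add: F(3) bij_is_surj surj_f_inv_f)
      then show ?thesis
        using G(6,7)[OF y] by (metis bij_inv_eq_iff)
    qed
    then show "\<exists>D. (G has_derivative D) (at y) \<and> (\<forall>v. D (imul v) = imul (D v))"
      using G(5)[OF y] by blast
  qed
  define U1 where "U1 = {x. (x, 0) \<in> U}"
  define g where "g y = fst (G (y, 0))" for y
  have oU1: "open U1" unfolding U1_def by (rule open_slice[OF G(1)])
  have GF: "G (f x, 0) = (x, 0)" "(f x, 0) \<in> V" if "x \<in> U1" for x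
  proof -
    have "G (F (x, 0)) = (x, 0)" "F (x, 0) \<in> V"
      using that G(4) unfolding U1_def homeomorphism_def by blast+
    then show "G (f x, 0) = (x, 0)" "(f x, 0) \<in> V" by (simp_all only: F(4))
  qed
  have contf: "continuous_on U1 f"
  proof -
    have "continuous_on UNIV F"
      using F(1) by (auto intro!: continuous_at_imp_continuous_on has_derivative_continuous)
    then have "continuous_on U1 (\<lambda>x. F (x, 0))"
      by (rule continuous_on_compose2) (auto intro: continuous_on_Pair continuous_on_id continuous_on_const)
    then have "continuous_on U1 (\<lambda>x. fst (F (x, 0)))"
      by (rule continuous_on_fst)
    then show ?thesis by (simp add: F(4))
  qed
  have inj: "inj_on f U1"
    by (rule inj_onI) (metis GF(1) prod.inject)
  have oV1: "open (f ` U1)"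
    by (rule invariance_of_domain[OF contf oU1 inj])
  have gf: "g (f x) = x" if "x \<in> U1" for x
    using GF[OF that] by (simp add: g_def)
  have hol: "hol_ext g y" if "y \<in> f ` U1" for y
    unfolding hol_ext_def
  proof (intro exI conjI allI impI)
    show "chol G (V \<inter> (f ` U1 \<times> UNIV))"
      by (rule chol_subset[OF cholG]) (use G(3) oV1 in \<open>auto intro!: open_Int open_Times\<close>)
    show "(y, 0) \<in> V \<inter> (f ` U1 \<times> UNIV)"
      using that GF(2) by auto
    fix x assume "(x, 0) \<in> V \<inter> (f ` U1 \<times> UNIV)"
    then show "G (x, 0) = (g x, 0)"
      using GF(1) by (auto simp: g_def)
  qed
  have "continuous_on (f ` U1) g"
    using hol by (auto intro!: continuous_at_imp_continuous_on differentiable_imp_continuous_within hol_ext_differentiable)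
  then have "homeomorphism U1 (f ` U1) f g"
    using contf gf by (auto simp: homeomorphism_def image_image)
  then show thesis
    using that[OF oU1 oV1] hol G(2) by (simp add: U1_def)
qed

lemma analytic_diffeoI:
  assumes "open U" "open V" "homeomorphism U V f g"
    and "\<And>x. x \<in> U \<Longrightarrow> hol_ext f x" and "\<And>y. y \<in> V \<Longrightarrow> hol_ext g y"
  shows "analytic_diffeo f U V"
proof -
  have bij: "bij_betw f U V"
    using assms(3) unfolding homeomorphism_def bij_betw_def by (metis inj_onI)
  have "hol_ext (inv_into U f) y" if "y \<in> V" for y
  proof (rule hol_ext_cong[OF assms(5)[OF that] \<open>open V\<close> that])
    fix x assume "x \<in> V"
    then show "g x = inv_into U f x"
      using assms(3) bij unfolding homeomorphism_def
      by (metis bij_betw_def imageI inv_into_f_f)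
  qed
  then show ?thesis
    using assms bij by (auto simp: analytic_diffeo_def real_analytic_on_def hol_ext_imp_real_analytic)
qed

section \<open>Quaternionic matrices, their trace form and their determinant\<close>

definition qcnj :: "quat \<Rightarrow> quat"
  where "qcnj x = Quat (qRe x) (- qI x) (- qJ x) (- qK x)"

lemma of_real_quat: "of_real r = Quat r 0 0 0"
  by (simp add: of_real_def quat_ring_defs)

lemmas quat_defs = quat_ring_defs quat_eq_iff qcnj_def of_real_quat inner_quat_def

lemma norm_quat_sq: "(norm (x::quat))\<^sup>2 = (qRe x)\<^sup>2 + (qI x)\<^sup>2 + (qJ x)\<^sup>2 + (qK x)\<^sup>2"
  by (simp add: norm_quat_def)

lemma qRe_simps [simp]:
  "qRe (x + y) = qRe x + qRe y" "qRe (x - y) = qRe x - qRe y" "qRe (- x) = - qRe x"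
  "qRe (r *\<^sub>R x) = r * qRe x" "qRe 0 = 0" "qRe 1 = 1" "qRe (of_real r) = r" "qRe (qcnj x) = qRe x"
  by (simp_all add: quat_defs)

lemma qRe_commute: "qRe (x * y) = qRe (y * x)"
  by (simp add: quat_defs)

lemma qcnj_mult: "qcnj (x * y) = qcnj y * qcnj x"
  by (simp add: quat_defs)

lemma qcnj_simps [simp]: "qcnj (x + y) = qcnj x + qcnj y" "qcnj (qcnj x) = x" "qcnj 0 = 0" "qcnj 1 = 1"
    "norm (qcnj x) = norm x"
  by (simp_all add: quat_defs norm_quat_def)

lemma qcnj_mult_self: "qcnj x * x = (norm x)\<^sup>2 *\<^sub>R 1" "x * qcnj x = (norm x)\<^sup>2 *\<^sub>R 1"
  unfolding norm_quat_sq by (simp_all add: quat_defs power2_eq_square)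

lemma inner_eq_qRe: "inner x y = qRe (qcnj x * y)"
  by (simp add: quat_defs)

lemma quat_quadratic: "u * u = (2 * qRe u) *\<^sub>R u - ((norm u)\<^sup>2) *\<^sub>R (1::quat)"
  unfolding norm_quat_sq by (simp add: quat_defs power2_eq_square)

lemma inverse_eq_qcnj: "inverse x = qcnj x /\<^sub>R (norm x)\<^sup>2"
  by (simp add: inverse_quat_def qcnj_def)

definition nonreal :: "quat \<Rightarrow> bool"
  where "nonreal u \<longleftrightarrow> u \<notin> range of_real"

lemma nonreal_iff: "nonreal u \<longleftrightarrow> qI u \<noteq> 0 \<or> qJ u \<noteq> 0 \<or> qK u \<noteq> 0"
proof -
  have "(\<exists>r. u = of_real r) \<longleftrightarrow> qI u = 0 \<and> qJ u = 0 \<and> qK u = 0"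
    by (auto simp: of_real_quat quat_eq_iff)
  then show ?thesis unfolding nonreal_def by blast
qed

lemma nonreal_independent:
  assumes "nonreal u" "x *\<^sub>R 1 + y *\<^sub>R u = 0"
  shows "x = 0 \<and> y = 0"
  using assms by (auto simp: nonreal_iff quat_defs)

text \<open>Commuting with \<open>u\<close> means having an imaginary part parallel to that of \<open>u\<close>.\<close>

lemma nonreal_commutant:
  assumes "nonreal u" "a * u = u * a"
  shows "\<exists>x y. a = x *\<^sub>R 1 + y *\<^sub>R u"
proof -
  have e: "qJ a * qK u = qK a * qJ u" "qI a * qK u = qK a * qI u" "qI a * qJ u = qJ a * qI u"
    using assms(2) by (auto simp: quat_defs algebra_simps)
  consider "qI u \<noteq> 0" | "qJ u \<noteq> 0" | "qK u \<noteq> 0"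
    using assms(1) nonreal_iff by blast
  then obtain y where y: "qI a = y * qI u" "qJ a = y * qJ u" "qK a = y * qK u"
  proof cases
    case 1 then show ?thesis using e that[of "qI a / qI u"] by (simp add: field_simps)
  next
    case 2 then show ?thesis using e that[of "qJ a / qJ u"] by (simp add: field_simps)
  next
    case 3 then show ?thesis using e that[of "qK a / qK u"] by (simp add: field_simps)
  qed
  then have "a = (qRe a - y * qRe u) *\<^sub>R 1 + y *\<^sub>R u"
    by (simp add: quat_defs)
  then show ?thesis by blast
qed

lemma imag_units_components:
  assumes "I \<in> imag_units"
  shows "qRe I = 0" "(qI I)\<^sup>2 + (qJ I)\<^sup>2 + (qK I)\<^sup>2 = 1" "nonreal I"
proof -
  have e: "qRe I * qRe I - qI I * qI I - qJ I * qJ I - qK I * qK I = -1"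
    "qRe I * qI I = 0" "qRe I * qJ I = 0" "qRe I * qK I = 0"
    using assms by (auto simp: imag_units_def quat_defs)
  show 1: "qRe I = 0"
  proof (rule ccontr)
    assume "qRe I \<noteq> 0"
    then have "qI I = 0" "qJ I = 0" "qK I = 0" using e(2-4) by simp_all
    then have "qRe I * qRe I = -1" using e(1) by simp
    then show False using zero_le_square[of "qRe I"] by simp
  qed
  then show 2: "(qI I)\<^sup>2 + (qJ I)\<^sup>2 + (qK I)\<^sup>2 = 1"
    using e(1) by (simp add: power2_eq_square)
  then show "nonreal I" by (auto simp: nonreal_iff)
qed

lemma norm_qcis:
  assumes "I \<in> imag_units" shows "norm (qcis I \<theta>) = 1"
proof -
  have "(norm (qcis I \<theta>))\<^sup>2 = (cos \<theta>)\<^sup>2 + (sin \<theta>)\<^sup>2 * ((qI I)\<^sup>2 + (qJ I)\<^sup>2 + (qK I)\<^sup>2)"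
    unfolding norm_quat_sq qcis_def
    using imag_units_components(1)[OF assms] by (simp add: quat_defs power_mult_distrib algebra_simps)
  then show ?thesis
    using imag_units_components(2)[OF assms] by (simp add: power2_eq_1_iff) (smt (verit) norm_ge_zero)
qed

lemma nonreal_qcis:
  assumes "I \<in> imag_units" "sin \<theta> \<noteq> 0" "r \<noteq> 0"
  shows "nonreal (r *\<^sub>R qcis I \<theta>)"
  using imag_units_components(3)[OF assms(1)] assms(2,3)
  by (auto simp: nonreal_iff qcis_def quat_defs)

subsection \<open>Two by two matrices\<close>

lemma mmult_nth: "((X::qmat) ** Y) $ i $ j = X $ i $ 1 * Y $ 1 $ j + X $ i $ 2 * Y $ 2 $ j"
  by (simp add: matrix_matrix_mult_def sum_2)

lemma qmat_eq_iff: "(X::qmat) = Y \<longleftrightarrow> X $ 1 $ 1 = Y $ 1 $ 1 \<and> X $ 1 $ 2 = Y $ 1 $ 2 \<and> X $ 2 $ 1 = Y $ 2 $ 1 \<and> X $ 2 $ 2 = Y $ 2 $ 2"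
  by (simp add: vec_eq_iff forall_2)

lemma mat22_nth [simp]:
  "mat22 a b c d $ 1 $ 1 = a" "mat22 a b c d $ 1 $ 2 = b" "mat22 a b c d $ 2 $ 1 = c" "mat22 a b c d $ 2 $ 2 = d"
  by (simp_all add: mat22_def)

lemma mat_one_nth [simp]:
  "(mat 1 :: qmat) $ 1 $ 1 = 1" "(mat 1 :: qmat) $ 1 $ 2 = 0" "(mat 1 :: qmat) $ 2 $ 1 = 0" "(mat 1 :: qmat) $ 2 $ 2 = 1"
  by (simp_all add: mat_def)

lemma bounded_bilinear_mmult: "bounded_bilinear ((**) :: qmat \<Rightarrow> qmat \<Rightarrow> qmat)"
proof -
  have "bilinear ((**) :: qmat \<Rightarrow> qmat \<Rightarrow> qmat)"
    by (auto simp: bilinear_def qmat_eq_iff mmult_nth algebra_simps intro!: linearI)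
  then show ?thesis by (simp add: bilinear_conv_bounded_bilinear)
qed

interpretation mm: bounded_bilinear "(**) :: qmat \<Rightarrow> qmat \<Rightarrow> qmat"
  by (rule bounded_bilinear_mmult)

lemmas mm_simps = mm.add_left mm.add_right mm.diff_left mm.diff_right mm.scaleR_left mm.scaleR_right
  mm.minus_left mm.minus_right

lemma DIM_quat: "DIM(quat) = 4"
  by (simp add: Basis_quat_def)

text \<open>Half the reduced trace. The symmetric bilinear form \<open>tau (X ** Y)\<close>, invariant under conjugation,
  is the form with respect to which annihilators are computed throughout.\<close>

definition tau :: "qmat \<Rightarrow> real"
  where "tau X = qRe (X $ 1 $ 1) + qRe (X $ 2 $ 2)"

lemma tau_simps [simp]:
  "tau (X + Y) = tau X + tau Y" "tau (X - Y) = tau X - tau Y" "tau (r *\<^sub>R X) = r * tau X" "tau 0 = 0"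
  "tau (- X) = - tau X" "tau (mat 1) = 2"
  by (simp_all add: tau_def algebra_simps)

lemma linear_tau: "linear tau"
  by (rule linearI) simp_all

lemma tau_commute: "tau (X ** Y) = tau (Y ** X)"
  by (simp add: tau_def mmult_nth qRe_commute)

definition mstar :: "qmat \<Rightarrow> qmat"
  where "mstar X = mat22 (qcnj (X $ 1 $ 1)) (qcnj (X $ 2 $ 1)) (qcnj (X $ 1 $ 2)) (qcnj (X $ 2 $ 2))"

lemma inner_eq_tau: "inner w x = tau (mstar w ** x)"
  by (simp add: inner_vec_def sum_2 tau_def mstar_def mmult_nth inner_eq_qRe)

lemma mstar_mstar [simp]: "mstar (mstar w) = w"
  by (simp add: mstar_def qmat_eq_iff)

text \<open>The trace form differs from the inner product by the conjugate transpose in one argument.\<close>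

lemma tau_nondegenerate:
  fixes Y :: qmat
  assumes "\<And>v. tau (Y ** v) = 0" shows "Y = 0"
proof -
  have "inner (mstar Y) (mstar Y) = 0"
    using assms by (simp add: inner_eq_tau)
  then have "mstar Y = mat22 0 0 0 0"
    by (simp add: qmat_eq_iff)
  then show ?thesis
    using mstar_mstar[of Y] by (simp add: mstar_def qmat_eq_iff)
qed

text \<open>Subspaces are their own double annihilators under the trace form. This is how surjectivity of
  linear maps built from commutators is proved: their annihilators are commutants.\<close>

lemma tau_orthogonal_membership:
  fixes S :: "qmat set"
  assumes "subspace S" and "\<And>Y. (\<And>s. s \<in> S \<Longrightarrow> tau (Y ** s) = 0) \<Longrightarrow> tau (Y ** v) = 0"
  shows "v \<in> S"
proof -
  have "v \<in> orthogonal_comp (orthogonal_comp S)"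
    unfolding orthogonal_comp_def orthogonal_def inner_eq_tau[of _ v]
    by (auto simp: inner_eq_tau intro!: assms(2)) (metis inner_commute inner_eq_tau)
  then show ?thesis
    using orthogonal_comp_self[OF assms(1)] by simp
qed

subsection \<open>The determinant\<close>

text \<open>The square of the Dieudonne determinant. In contrast to the determinant it is a polynomial in the
  components, so that it can be differentiated and extended to the complexification.\<close>

definition qdet :: "qmat \<Rightarrow> real"
  where "qdet M = (norm (M$1$1))\<^sup>2 * (norm (M$2$2))\<^sup>2 + (norm (M$1$2))\<^sup>2 * (norm (M$2$1))\<^sup>2
     - 2 * qRe (qcnj (M$2$2) * M$2$1 * qcnj (M$1$1) * M$1$2)"

lemma norm_diff_sq: "(norm (x - y))\<^sup>2 = (norm x)\<^sup>2 + (norm y)\<^sup>2 - 2 * inner x (y::quat)"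
  by (simp add: power2_norm_eq_inner inner_diff_left inner_diff_right inner_commute)

lemma norm_add_sq: "(norm (x + y))\<^sup>2 = (norm x)\<^sup>2 + (norm y)\<^sup>2 + 2 * inner x (y::quat)"
  by (simp add: power2_norm_eq_inner inner_add_left inner_add_right inner_commute)

lemma dieudonne_det_sq: "(dieudonne_det M)\<^sup>2 = qdet M"
proof -
  define a b c d where "a = M$1$1" and "b = M$1$2" and "c = M$2$1" and "d = M$2$2"
  show ?thesis
  proof (cases "a = 0")
    case True
    then show ?thesis
      by (simp add: dieudonne_det_def qdet_def a_def b_def c_def d_def norm_mult power_mult_distrib)
  next
    case False
    define e where "e = c * inverse a * b"
    have "a * d - a * c * inverse a * b = a * (d - e)"
      by (simp add: e_def algebra_simps)
    then have "(dieudonne_det M)\<^sup>2 = (norm a)\<^sup>2 * (norm (d - e))\<^sup>2"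
      using False by (simp add: dieudonne_det_def Let_def norm_mult power_mult_distrib flip: a_def b_def c_def d_def)
    also have "\<dots> = (norm a)\<^sup>2 * (norm d)\<^sup>2 + (norm a)\<^sup>2 * (norm e)\<^sup>2 - 2 * ((norm a)\<^sup>2 * inner d e)"
      by (simp add: norm_diff_sq algebra_simps)
    also have "norm e = norm b * norm c / norm a"
      by (simp only: e_def norm_mult norm_inverse divide_inverse mult_ac)
    also have "(norm a)\<^sup>2 * (norm b * norm c / norm a)\<^sup>2 = (norm b)\<^sup>2 * (norm c)\<^sup>2"
      using False by (simp add: power_mult_distrib power_divide)
    also have "(norm a)\<^sup>2 * inner d e = qRe (qcnj d * c * qcnj a * b)"
      using False by (simp add: inner_eq_qRe e_def inverse_eq_qcnj mult.assoc)
    finally show ?thesis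
      by (simp add: qdet_def a_def b_def c_def d_def)
  qed
qed

lemma dieudonne_det_nonneg: "0 \<le> dieudonne_det M"
  by (simp add: dieudonne_det_def Let_def)

lemma dieudonne_det_eq_1_iff: "dieudonne_det M = 1 \<longleftrightarrow> qdet M = 1"
  using dieudonne_det_sq[of M] dieudonne_det_nonneg[of M] by (auto simp: power2_eq_1_iff)

lemma qdet_nonneg: "0 \<le> qdet M"
  using dieudonne_det_sq[of M] by (metis zero_le_power2)

lemma SL2H_iff: "M \<in> SL2H \<longleftrightarrow> invertible M \<and> qdet M = 1"
  by (simp add: SL2H_def dieudonne_det_eq_1_iff)

lemma qRe_sandwich: "qRe (qcnj d * y * d) = (norm d)\<^sup>2 * qRe y"
proof -
  have "qRe (qcnj d * y * d) = qRe (d * (qcnj d * y))"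
    by (rule qRe_commute)
  also have "\<dots> = qRe ((norm d)\<^sup>2 *\<^sub>R 1 * y)"
    by (simp only: mult.assoc[symmetric] qcnj_mult_self)
  finally show ?thesis
    by simp
qed

lemma qdet_shear_mult: "qdet (mat22 1 x 0 1 ** M) = qdet M"
proof -
  define a b c d where "a = M$1$1" and "b = M$1$2" and "c = M$2$1" and "d = M$2$2"
  have 1: "qRe (qcnj d * c * qcnj a * (x * d)) = (norm d)\<^sup>2 * inner a (x * c)"
  proof -
    have "qRe (qcnj d * c * qcnj a * (x * d)) = qRe (qcnj d * (c * (qcnj a * x)) * d)"
      by (simp add: mult.assoc)
    also have "\<dots> = (norm d)\<^sup>2 * qRe (qcnj a * x * c)"
      unfolding qRe_sandwich by (simp add: qRe_commute[of c])
    finally show ?thesis by (simp add: inner_eq_qRe mult.assoc)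
  qed
  have cc: "y * c * (qcnj c * z) = (norm c)\<^sup>2 *\<^sub>R (y * z)" for y z
  proof -
    have "y * c * (qcnj c * z) = y * (c * qcnj c) * z" by (simp add: mult.assoc)
    then show ?thesis by (simp add: qcnj_mult_self)
  qed
  have 2: "qRe (qcnj d * c * qcnj (x * c) * b) = (norm c)\<^sup>2 * inner (x * d) b"
    using cc[of "qcnj d" "qcnj x * b"] by (simp add: inner_eq_qRe qcnj_mult mult.assoc)
  have 3: "qRe (qcnj d * c * qcnj (x * c) * (x * d)) = (norm c)\<^sup>2 * (norm (x * d))\<^sup>2"
    using cc[of "qcnj d" "qcnj x * (x * d)"] inner_eq_qRe[of "x * d" "x * d"]
    by (simp add: qcnj_mult mult.assoc power2_norm_eq_inner)
  have "qdet (mat22 1 x 0 1 ** M) = (norm (a + x * c))\<^sup>2 * (norm d)\<^sup>2 + (norm (b + x * d))\<^sup>2 * (norm c)\<^sup>2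
     - 2 * qRe (qcnj d * c * qcnj (a + x * c) * (b + x * d))"
    by (simp add: qdet_def mmult_nth a_def b_def c_def d_def)
  also have "qRe (qcnj d * c * qcnj (a + x * c) * (b + x * d)) =
     qRe (qcnj d * c * qcnj a * b) + qRe (qcnj d * c * qcnj a * (x * d))
     + qRe (qcnj d * c * qcnj (x * c) * b) + qRe (qcnj d * c * qcnj (x * c) * (x * d))"
    by (simp add: distrib_left distrib_right)
  finally have "qdet (mat22 1 x 0 1 ** M) = (norm (a + x * c))\<^sup>2 * (norm d)\<^sup>2 + (norm (b + x * d))\<^sup>2 * (norm c)\<^sup>2
     - 2 * (qRe (qcnj d * c * qcnj a * b) + (norm d)\<^sup>2 * inner a (x * c) + (norm c)\<^sup>2 * inner (x * d) b + (norm c)\<^sup>2 * (norm (x * d))\<^sup>2)"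
    by (simp only: 1 2 3)
  also have "\<dots> = (norm a)\<^sup>2 * (norm d)\<^sup>2 + (norm b)\<^sup>2 * (norm c)\<^sup>2 - 2 * qRe (qcnj d * c * qcnj a * b)"
    by (simp add: norm_add_sq norm_mult power_mult_distrib inner_commute[of b] algebra_simps)
  finally show ?thesis
    by (simp add: qdet_def a_def b_def c_def d_def)
qed

lemma qdet_swap_mult: "qdet (mat22 0 1 1 0 ** M) = qdet M"
proof -
  have "qRe (qcnj y * x * qcnj z * w) = qRe (qcnj w * z * qcnj x * y)" for x y z w
  proof -
    have "qRe (qcnj y * x * qcnj z * w) = qRe (qcnj (qcnj y * x * qcnj z * w))" by simp
    then show ?thesis by (simp only: qcnj_mult qcnj_simps mult.assoc)
  qed
  then show ?thesis
    by (simp add: qdet_def mmult_nth)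
qed

lemma qdet_diag_mult: "qdet (mat22 p 0 0 q ** M) = (norm p)\<^sup>2 * (norm q)\<^sup>2 * qdet M"
proof -
  have "qRe (qcnj (q * d) * (q * c) * qcnj (p * a) * (p * b)) = (norm p)\<^sup>2 * (norm q)\<^sup>2 * qRe (qcnj d * c * qcnj a * b)" for a b c d
  proof -
    have "qcnj (q * d) * (q * c) * qcnj (p * a) * (p * b) = qcnj d * (qcnj q * q) * c * qcnj a * (qcnj p * p) * b"
      by (simp add: qcnj_mult mult.assoc)
    also have "\<dots> = ((norm p)\<^sup>2 * (norm q)\<^sup>2) *\<^sub>R (qcnj d * c * qcnj a * b)"
      by (simp add: qcnj_mult_self mult.assoc)
    finally show ?thesis by simp
  qed
  then show ?thesis
    by (simp add: qdet_def mmult_nth norm_mult power_mult_distrib algebra_simps)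
qed

text \<open>Every matrix is a product of shears, row swaps and diagonal matrices, so that multiplicativity
  only needs to be checked for these.\<close>

theorem qdet_mult: "qdet (X ** Y) = qdet X * qdet Y"
proof -
  define G where "G = {X. \<forall>Y. qdet (X ** Y) = qdet X * qdet Y}"
  have GI: "X \<in> G" if "\<And>Y. qdet (X ** Y) = k * qdet Y" for X k
  proof -
    have "qdet X = k * qdet (mat 1)"
      using that[of "mat 1"] by simp
    then have "qdet X = k" by (simp add: qdet_def)
    then show ?thesis using that by (simp add: G_def)
  qed
  have G_mult: "X ** Z \<in> G" if "X \<in> G" "Z \<in> G" for X Z
    using that by (simp add: G_def flip: matrix_mul_assoc)
  have G_shear: "mat22 1 x 0 1 \<in> G" for x
    by (rule GI[of _ 1]) (simp add: qdet_shear_mult)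
  have G_swap: "mat22 0 1 1 0 \<in> G"
    by (rule GI[of _ 1]) (simp add: qdet_swap_mult)
  have G_diag: "mat22 p 0 0 q \<in> G" for p q
    by (rule GI) (rule qdet_diag_mult)
  have G_pivot: "X \<in> G" if a: "X$1$1 \<noteq> 0" for X
  proof -
    define a b c d where "a = X$1$1" and "b = X$1$2" and "c = X$2$1" and "d = X$2$2"
    have "X = (mat22 0 1 1 0 ** (mat22 1 (c * inverse a) 0 1 ** mat22 0 1 1 0)) **
        (mat22 a 0 0 (d - c * inverse a * b) ** mat22 1 (inverse a * b) 0 1)"
      using a by (simp add: qmat_eq_iff mmult_nth a_def b_def c_def d_def algebra_simps)
        (simp add: mult.assoc[symmetric])
    then show ?thesis
      by (metis G_mult G_shear G_swap G_diag)
  qed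
  have swap2: "mat22 0 1 1 0 ** (mat22 0 1 1 0 ** X) = X" "(X ** mat22 0 1 1 0) ** mat22 0 1 1 0 = X" for X
    by (simp_all add: qmat_eq_iff mmult_nth)
  have G_column: "X \<in> G" if "X$1$1 \<noteq> 0 \<or> X$2$1 \<noteq> 0" for X
  proof (cases "X$1$1 = 0")
    case True
    then have "mat22 0 1 1 0 ** X \<in> G"
      using that by (intro G_pivot) (simp add: mmult_nth)
    then show ?thesis
      using G_mult[OF G_swap] swap2(1) by metis
  qed (rule G_pivot)
  have "X \<in> G"
  proof (cases "X = 0")
    case True
    then show ?thesis by (simp add: G_def qdet_def)
  next
    case False
    show ?thesis
    proof (cases "X$1$1 \<noteq> 0 \<or> X$2$1 \<noteq> 0")
      case True then show ?thesis by (rule G_column)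
    next
      case c: False
      have "X ** mat22 0 1 1 0 \<in> G"
        by (rule G_column) (use False c in \<open>auto simp: mmult_nth qmat_eq_iff\<close>)
      then show ?thesis
        using G_mult[OF _ G_swap] swap2(2) by metis
    qed
  qed
  then show ?thesis by (simp add: G_def)
qed

lemma qdet_one [simp]: "qdet (mat 1) = 1"
  by (simp add: qdet_def)

lemma qdet_scaleR: "qdet (r *\<^sub>R M) = r ^ 4 * qdet M"
proof -
  have "r *\<^sub>R M = mat22 (r *\<^sub>R 1) 0 0 (r *\<^sub>R 1) ** M"
    by (simp add: qmat_eq_iff mmult_nth)
  then show ?thesis
    by (simp add: qdet_diag_mult power_mult_distrib[symmetric]) (simp add: power4_eq_xxxx power2_eq_square)
qed

subsection \<open>Inverses and conjugacy\<close>

lemma matrix_inv_works: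
  fixes P :: qmat
  assumes "invertible P" shows "P ** matrix_inv P = mat 1" "matrix_inv P ** P = mat 1"
proof -
  have "\<exists>A'. P ** A' = mat 1 \<and> A' ** P = mat 1"
    using assms by (simp add: invertible_def)
  then have "P ** matrix_inv P = mat 1 \<and> matrix_inv P ** P = mat 1"
    unfolding matrix_inv_def by (rule someI_ex)
  then show "P ** matrix_inv P = mat 1" "matrix_inv P ** P = mat 1" by auto
qed

lemma matrix_inv_cancel [simp]:
  fixes P :: qmat
  assumes "invertible P"
  shows "P ** (matrix_inv P ** Z) = Z" "matrix_inv P ** (P ** Z) = Z"
    "Z ** P ** matrix_inv P = Z" "Z ** matrix_inv P ** P = Z"
  using matrix_inv_works[OF assms] by (simp_all add: matrix_mul_assoc) (simp_all flip: matrix_mul_assoc)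

lemma matrix_inv_eqI:
  fixes P :: qmat
  assumes "P ** Q = mat 1" "Q ** P = mat 1" shows "matrix_inv P = Q"
proof -
  have "invertible P" using assms by (auto simp: invertible_def)
  then show ?thesis
    using matrix_inv_works[of P] assms by (metis matrix_mul_assoc matrix_mul_lid matrix_mul_rid)
qed

lemma invertible_matrix_inv: "invertible (P::qmat) \<Longrightarrow> invertible (matrix_inv P)"
  using matrix_inv_works[of P] by (auto simp: invertible_def)

lemma qdet_pos: "invertible P \<Longrightarrow> 0 < qdet P"
  using matrix_inv_works(1)[of P] qdet_mult[of P "matrix_inv P"] qdet_nonneg[of P]
  by (auto simp: order_less_le)

lemma invertible_scaleR: "invertible (P::qmat) \<Longrightarrow> r \<noteq> 0 \<Longrightarrow> invertible (r *\<^sub>R P)"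
  using matrix_inv_works[of P] unfolding invertible_def[of "r *\<^sub>R P"]
  by (intro exI[of _ "inverse r *\<^sub>R matrix_inv P"]) (simp add: mm_simps)

lemma normalize_SL2H:
  assumes "invertible P" obtains r where "r \<noteq> 0" "r *\<^sub>R P \<in> SL2H"
proof
  define r where "r = 1 / sqrt (sqrt (qdet P))"
  have p: "0 < qdet P" by (rule qdet_pos[OF assms])
  show "r \<noteq> 0" using p by (simp add: r_def)
  have "r ^ 4 = (r\<^sup>2)\<^sup>2" by simp
  also have "\<dots> = 1 / qdet P" using p by (simp add: r_def power_divide)
  finally have "r ^ 4 = 1 / qdet P" .
  then show "r *\<^sub>R P \<in> SL2H"
    using p assms \<open>r \<noteq> 0\<close> by (simp add: SL2H_iff invertible_scaleR qdet_scaleR)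
qed

lemma SL2H_invertible: "P \<in> SL2H \<Longrightarrow> invertible P"
  by (simp add: SL2H_iff)

lemma SL2H_mult: "P \<in> SL2H \<Longrightarrow> Q \<in> SL2H \<Longrightarrow> P ** Q \<in> SL2H"
  by (simp add: SL2H_iff qdet_mult invertible_mult)

lemma SL2H_one: "mat 1 \<in> SL2H"
  by (auto simp: SL2H_iff invertible_def)

lemma SL2H_inv: "P \<in> SL2H \<Longrightarrow> matrix_inv P \<in> SL2H"
  using qdet_mult[of P "matrix_inv P"] matrix_inv_works(1)[of P]
  by (simp add: SL2H_iff invertible_matrix_inv)

lemma conj_mat_eq_iff:
  assumes "invertible P" shows "conj_mat P X = Y \<longleftrightarrow> P ** X = Y ** P"
  using matrix_inv_works[OF assms] unfolding conj_mat_def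
  by (metis matrix_mul_assoc matrix_mul_rid)

lemma conj_mat_scaleR: "invertible P \<Longrightarrow> r \<noteq> 0 \<Longrightarrow> conj_mat (r *\<^sub>R P) X = conj_mat P X"
  using conj_mat_eq_iff[of P X "conj_mat P X"]
  by (subst conj_mat_eq_iff) (auto simp: invertible_scaleR mm_simps)

text \<open>Conjugation is insensitive to real scaling, and every invertible matrix has a real multiple in
  \<^const>\<open>SL2H\<close>; so all invertible matrices may be used as conjugators. Writing the relation without an
  inverse makes it linear in \<open>P\<close>.\<close>

lemma conj_class_iff: "Y \<in> conj_class X \<longleftrightarrow> (\<exists>P. invertible P \<and> P ** X = Y ** P)"
proof
  assume "Y \<in> conj_class X"
  then show "\<exists>P. invertible P \<and> P ** X = Y ** P"
    unfolding conj_class_def using conj_mat_eq_iff SL2H_invertible by blast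
next
  assume "\<exists>P. invertible P \<and> P ** X = Y ** P"
  then obtain P where P: "invertible P" "P ** X = Y ** P" by blast
  obtain r where r: "r \<noteq> 0" "r *\<^sub>R P \<in> SL2H" by (rule normalize_SL2H[OF P(1)])
  have "conj_mat (r *\<^sub>R P) X = Y"
    using P r conj_mat_scaleR conj_mat_eq_iff by metis
  then show "Y \<in> conj_class X"
    unfolding conj_class_def using r by blast
qed

lemma conj_orbit_iff:
  "Y \<in> conj_orbit X \<longleftrightarrow> (\<exists>P. invertible P \<and> P ** fst X = fst Y ** P \<and> P ** snd X = snd Y ** P)"
proof
  assume "Y \<in> conj_orbit X"
  then obtain P where "P \<in> SL2H" "Y = (conj_mat P (fst X), conj_mat P (snd X))"
    unfolding conj_orbit_def by (auto split: prod.splits)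
  then show "\<exists>P. invertible P \<and> P ** fst X = fst Y ** P \<and> P ** snd X = snd Y ** P"
    using conj_mat_eq_iff[OF SL2H_invertible] by (metis fst_conv snd_conv SL2H_invertible)
next
  assume "\<exists>P. invertible P \<and> P ** fst X = fst Y ** P \<and> P ** snd X = snd Y ** P"
  then obtain P where P: "invertible P" "P ** fst X = fst Y ** P" "P ** snd X = snd Y ** P" by blast
  obtain r where r: "r \<noteq> 0" "r *\<^sub>R P \<in> SL2H" by (rule normalize_SL2H[OF P(1)])
  have "conj_mat (r *\<^sub>R P) (fst X) = fst Y" "conj_mat (r *\<^sub>R P) (snd X) = snd Y"
    using P r conj_mat_scaleR conj_mat_eq_iff by metis+
  then show "Y \<in> conj_orbit X"
    unfolding conj_orbit_def using r by (auto split: prod.splits intro!: exI[of _ "r *\<^sub>R P"])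
qed

lemma conj_class_SL2H: "A \<in> SL2H \<Longrightarrow> conj_class A \<subseteq> SL2H"
  unfolding conj_class_def conj_mat_def using SL2H_mult SL2H_inv by blast

lemma conj_class_refl: "A \<in> conj_class A"
  unfolding conj_class_iff by (rule exI[of _ "mat 1"]) (auto simp: invertible_def)

lemma similar_symmetric:
  assumes "invertible (P::qmat)" "P ** X = Y ** P"
  shows "matrix_inv P ** Y = X ** matrix_inv P"
  using matrix_inv_works[OF assms(1)] assms(2)
  by (metis matrix_mul_assoc matrix_mul_lid matrix_mul_rid)

lemma similar_transitive:
  assumes "P ** X = Y ** P" "Q ** Y = Z ** Q" shows "(Q ** P) ** X = Z ** (Q ** (P::qmat))"
  using assms by (metis matrix_mul_assoc)

lemma conj_orbit_eq_iff: "conj_orbit X = conj_orbit Y \<longleftrightarrow> Y \<in> conj_orbit X"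
proof -
  have refl: "X \<in> conj_orbit X" for X
    unfolding conj_orbit_iff by (rule exI[of _ "mat 1"]) (auto simp: invertible_def)
  have sym: "X \<in> conj_orbit Y" if YX: "Y \<in> conj_orbit X" for X Y
  proof -
    obtain P where P: "invertible P" "P ** fst X = fst Y ** P" "P ** snd X = snd Y ** P"
      using YX unfolding conj_orbit_iff by blast
    show ?thesis
      unfolding conj_orbit_iff
      using similar_symmetric[OF P(1,2)] similar_symmetric[OF P(1,3)] invertible_matrix_inv[OF P(1)]
      by blast
  qed
  have trans: "Z \<in> conj_orbit X" if YX: "Y \<in> conj_orbit X" and ZY: "Z \<in> conj_orbit Y" for X Y Z
  proof -
    obtain P where P: "invertible P" "P ** fst X = fst Y ** P" "P ** snd X = snd Y ** P"
      using YX unfolding conj_orbit_iff by blast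
    obtain Q where Q: "invertible Q" "Q ** fst Y = fst Z ** Q" "Q ** snd Y = snd Z ** Q"
      using ZY unfolding conj_orbit_iff by blast
    show ?thesis
      unfolding conj_orbit_iff
      using similar_transitive[OF P(2) Q(2)] similar_transitive[OF P(3) Q(3)] invertible_mult[OF Q(1) P(1)]
      by blast
  qed
  show ?thesis
    using refl sym trans by blast
qed

lemma similar_inverse:
  assumes "invertible (X::qmat)" "invertible (Y::qmat)" "P ** X = Y ** P"
  shows "P ** matrix_inv X = matrix_inv Y ** P"
proof -
  have "matrix_inv Y ** (P ** X ** matrix_inv X) = matrix_inv Y ** (Y ** P ** matrix_inv X)"
    using assms(3) by simp
  moreover have "matrix_inv Y ** (P ** X ** matrix_inv X) = matrix_inv Y ** P"
    using assms(1) by simp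
  moreover have "matrix_inv Y ** (Y ** P ** matrix_inv X) = P ** matrix_inv X"
    using assms(2) by (simp flip: matrix_mul_assoc)
  ultimately show ?thesis by simp
qed

lemma similar_product:
  assumes "P ** X = Y ** P" "P ** X' = Y' ** P" shows "P ** (X ** X') = Y ** Y' ** (P::qmat)"
proof -
  have "P ** (X ** X') = Y ** P ** X'" by (simp add: matrix_mul_assoc assms(1))
  also have "\<dots> = Y ** (Y' ** P)" by (simp add: assms(2) flip: matrix_mul_assoc)
  finally show ?thesis by (simp add: matrix_mul_assoc)
qed

lemma matrix_inv_in_conj_class:
  assumes "invertible X" "invertible Y"
  shows "matrix_inv Y \<in> conj_class (matrix_inv X) \<longleftrightarrow> Y \<in> conj_class X"
proof -
  have inv2: "matrix_inv (matrix_inv X) = X" "matrix_inv (matrix_inv Y) = Y"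
    by (intro matrix_inv_eqI matrix_inv_works assms)+
  have "P ** matrix_inv X = matrix_inv Y ** P \<longleftrightarrow> P ** X = Y ** P" for P
    using similar_inverse[OF assms, of P]
      similar_inverse[OF assms[THEN invertible_matrix_inv], of P] by (auto simp: inv2)
  then show ?thesis by (simp add: conj_class_iff)
qed

lemma rep_set_iff:
  assumes "A \<in> SL2H" "B \<in> SL2H" "C = matrix_inv (A ** B)"
  shows "Y \<in> rep_set A B C \<longleftrightarrow>
    fst Y \<in> conj_class A \<and> snd Y \<in> conj_class B \<and> fst Y ** snd Y \<in> conj_class (A ** B)"
proof -
  have "invertible (A' ** B')" if "A' \<in> conj_class A" "B' \<in> conj_class B" for A' B'
    using that assms conj_class_SL2H SL2H_mult SL2H_invertible by blast
  moreover have "invertible (A ** B)" using assms SL2H_mult SL2H_invertible by blast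
  ultimately show ?thesis
    using matrix_inv_in_conj_class unfolding rep_set_def assms(3) by (cases Y) auto
qed

subsection \<open>Matrices with small commutant\<close>

definition cubic :: "real \<Rightarrow> real \<Rightarrow> real \<Rightarrow> real \<Rightarrow> qmat \<Rightarrow> qmat"
  where "cubic p q r s A = p *\<^sub>R mat 1 + q *\<^sub>R A + r *\<^sub>R (A ** A) + s *\<^sub>R (A ** A ** A)"

text \<open>The commutant of \<open>A\<close> is spanned by the linearly independent powers 1, \<open>A\<close>, \<open>A\<^sup>2\<close>, \<open>A\<^sup>3\<close>. It
  follows that the traces of the first four powers of \<open>A\<close> have independent differentials at \<open>A\<close>, with
  common kernel the tangent space of the conjugacy class. Regular loxodromic elements enter the proof
  through this property.\<close>

definition cyclic :: "qmat \<Rightarrow> bool"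
  where "cyclic A \<longleftrightarrow> (\<forall>X. A ** X = X ** A \<longrightarrow> (\<exists>p q r s. X = cubic p q r s A)) \<and>
    (\<forall>p q r s. cubic p q r s A = 0 \<longrightarrow> p = 0 \<and> q = 0 \<and> r = 0 \<and> s = 0)"

lemma cubic_similar:
  assumes "P ** X = Y ** P" shows "P ** cubic p q r s X = cubic p q r s Y ** P"
proof -
  have "P ** (X ** X) = Y ** Y ** P" "P ** (X ** X ** X) = Y ** Y ** Y ** P"
    using similar_product[OF assms assms] similar_product[OF similar_product[OF assms assms] assms] by auto
  then show ?thesis
    using assms by (simp add: cubic_def mm_simps)
qed

lemma cyclic_similar:
  assumes "invertible P" "P ** X = Y ** P" "cyclic X" shows "cyclic Y"
  unfolding cyclic_def
proof (intro conjI allI impI)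
  note inv = matrix_inv_works[OF assms(1)]
  fix Z assume "Y ** Z = Z ** Y"
  then have "X ** (matrix_inv P ** Z ** P) = (matrix_inv P ** Z ** P) ** X"
  proof -
    assume Z: "Y ** Z = Z ** Y"
    have "X ** (matrix_inv P ** Z ** P) = (X ** matrix_inv P) ** Z ** P"
      by (simp add: matrix_mul_assoc)
    also have "\<dots> = matrix_inv P ** (Y ** Z) ** P"
      by (simp add: matrix_mul_assoc flip: similar_symmetric[OF assms(1,2)])
    also have "\<dots> = matrix_inv P ** Z ** (Y ** P)"
      by (simp add: matrix_mul_assoc Z)
    also have "\<dots> = (matrix_inv P ** Z ** P) ** X"
      by (simp add: matrix_mul_assoc flip: assms(2))
    finally show ?thesis .
  qed
  then obtain p q r s where "matrix_inv P ** Z ** P = cubic p q r s X"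
    using assms(3) unfolding cyclic_def by blast
  then have "P ** (matrix_inv P ** Z ** P) = cubic p q r s Y ** P"
    using cubic_similar[OF assms(2)] by simp
  then have "Z ** P ** matrix_inv P = cubic p q r s Y ** P ** matrix_inv P"
    using assms(1) by (simp flip: matrix_mul_assoc)
  then have "Z = cubic p q r s Y"
    using assms(1) by simp
  then show "\<exists>p q r s. Z = cubic p q r s Y" by blast
next
  fix p q r s assume "cubic p q r s Y = 0"
  then have "P ** cubic p q r s X = 0"
    using cubic_similar[OF assms(2), of p q r s] by simp
  then have "matrix_inv P ** (P ** cubic p q r s X) = 0" by simp
  then have "cubic p q r s X = 0"
    using matrix_inv_works[OF assms(1)] by (simp add: matrix_mul_assoc)
  then show "p = 0" "q = 0" "r = 0" "s = 0"
    using assms(3) unfolding cyclic_def by blast+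
qed

text \<open>The left-hand side is the minimal polynomial of \<open>u\<close> evaluated at \<open>v\<close>; the minimal polynomial of \<open>v\<close>
  is a different one, because its constant term is the squared norm of \<open>v\<close>.\<close>

lemma other_quadratic_nonzero:
  assumes "nonreal v" "norm u \<noteq> norm v"
  shows "v * v - (2 * qRe u) *\<^sub>R v + ((norm u)\<^sup>2) *\<^sub>R (1::quat) \<noteq> 0"
proof
  assume "v * v - (2 * qRe u) *\<^sub>R v + ((norm u)\<^sup>2) *\<^sub>R (1::quat) = 0"
  then have "((norm u)\<^sup>2 - (norm v)\<^sup>2) *\<^sub>R 1 + (2 * qRe v - 2 * qRe u) *\<^sub>R v = 0"
    by (simp add: quat_quadratic[of v] algebra_simps)
  from nonreal_independent[OF assms(1) this]
  have "(norm u)\<^sup>2 = (norm v)\<^sup>2" by simp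
  then show False using assms(2) by simp
qed

text \<open>Comparing norms shows that a matrix commuting with \<open>diag(u, v)\<close> is diagonal. Its entries commute with
  \<open>u\<close> and \<open>v\<close>, hence are real linear polynomials in \<open>u\<close> and \<open>v\<close> respectively. The quadratic minimal
  polynomials of \<open>u\<close> and \<open>v\<close> are coprime, so by the Chinese remainder theorem the two entries come from
  one cubic polynomial.\<close>

lemma cyclic_diag:
  assumes u: "nonreal u" and v: "nonreal v" and uv: "norm u \<noteq> norm v"
  shows "cyclic (mat22 u 0 0 v)"
  unfolding cyclic_def
proof (intro conjI allI impI)
  define D where "D = mat22 u 0 0 v"
  fix X assume c: "mat22 u 0 0 v ** X = X ** mat22 u 0 0 v"
  have e: "u * X$1$1 = X$1$1 * u" "u * X$1$2 = X$1$2 * v" "v * X$2$1 = X$2$1 * u" "v * X$2$2 = X$2$2 * v"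
    using c by (simp_all add: qmat_eq_iff mmult_nth)
  have "norm u * norm (X$1$2) = norm v * norm (X$1$2)"
    using arg_cong[OF e(2), of norm] by (simp add: norm_mult mult.commute)
  then have b0: "X$1$2 = 0" using uv by simp
  have "norm v * norm (X$2$1) = norm u * norm (X$2$1)"
    using arg_cong[OF e(3), of norm] by (simp add: norm_mult mult.commute)
  then have c0: "X$2$1 = 0" using uv by simp
  \<comment> \<open>The block supported at one eigenvalue is a multiple of the quadratic polynomial of the other one.\<close>
  have block: "\<exists>x y. d = (x *\<^sub>R 1 + y *\<^sub>R w) * (w * w - (2 * qRe u') *\<^sub>R w + ((norm u')\<^sup>2) *\<^sub>R 1)"
    if w: "nonreal w" "norm u' \<noteq> norm w" and d: "w * d = d * w" for d w u'
  proof -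
    define \<kappa> where "\<kappa> = w * w - (2 * qRe u') *\<^sub>R w + ((norm u')\<^sup>2) *\<^sub>R (1::quat)"
    have k0: "\<kappa> \<noteq> 0" unfolding \<kappa>_def by (rule other_quadratic_nonzero[OF w])
    have kw: "\<kappa> * w = w * \<kappa>"
      by (simp add: \<kappa>_def algebra_simps)
    have "inverse \<kappa> * w = w * inverse \<kappa>"
    proof -
      have "inverse \<kappa> * w = inverse \<kappa> * w * (\<kappa> * inverse \<kappa>)"
        using k0 by simp
      also have "\<dots> = inverse \<kappa> * (w * \<kappa>) * inverse \<kappa>"
        by (simp only: mult.assoc)
      also have "\<dots> = (inverse \<kappa> * \<kappa>) * w * inverse \<kappa>"
        by (simp only: kw[symmetric] mult.assoc)
      finally show ?thesis
        using k0 by simp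
    qed
    then have "(d * inverse \<kappa>) * w = w * (d * inverse \<kappa>)"
      using d by (metis mult.assoc)
    then obtain x y where "d * inverse \<kappa> = x *\<^sub>R 1 + y *\<^sub>R w"
      using nonreal_commutant[OF w(1)] by blast
    then have "d = (x *\<^sub>R 1 + y *\<^sub>R w) * \<kappa>"
      using k0 by (metis mult.assoc mult.right_neutral left_inverse)
    then show ?thesis unfolding \<kappa>_def by blast
  qed
  obtain x y where xy: "X$2$2 = (x *\<^sub>R 1 + y *\<^sub>R v) * (v * v - (2 * qRe u) *\<^sub>R v + ((norm u)\<^sup>2) *\<^sub>R 1)"
    using block[OF v uv e(4)] by blast
  obtain x' y' where xy': "X$1$1 = (x' *\<^sub>R 1 + y' *\<^sub>R u) * (u * u - (2 * qRe v) *\<^sub>R u + ((norm v)\<^sup>2) *\<^sub>R 1)"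
    using block[OF u uv[symmetric] e(1)] by blast
  \<comment> \<open>The coefficients of \<open>(x + y w) m\<^sub>u(w) + (x' + y' w) m\<^sub>v(w)\<close>, where \<open>m\<^sub>u\<close> and \<open>m\<^sub>v\<close> are the
      minimal polynomials.\<close>
  define p where "p = x * (norm u)\<^sup>2 + x' * (norm v)\<^sup>2"
  define q where "q = y * (norm u)\<^sup>2 - 2 * x * qRe u + y' * (norm v)\<^sup>2 - 2 * x' * qRe v"
  define r where "r = x - 2 * y * qRe u + x' - 2 * y' * qRe v"
  define s where "s = y + y'"
  have u0: "u * u - (2 * qRe u) *\<^sub>R u + ((norm u)\<^sup>2) *\<^sub>R 1 = 0" and v0: "v * v - (2 * qRe v) *\<^sub>R v + ((norm v)\<^sup>2) *\<^sub>R 1 = 0"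
    by (simp_all add: quat_quadratic)
  have general: "p *\<^sub>R 1 + q *\<^sub>R w + r *\<^sub>R (w * w) + s *\<^sub>R (w * w * w) =
     (x *\<^sub>R 1 + y *\<^sub>R w) * (w * w - (2 * qRe u) *\<^sub>R w + ((norm u)\<^sup>2) *\<^sub>R 1) +
     (x' *\<^sub>R 1 + y' *\<^sub>R w) * (w * w - (2 * qRe v) *\<^sub>R w + ((norm v)\<^sup>2) *\<^sub>R 1)" for w :: quat
    by (simp add: p_def q_def r_def s_def algebra_simps)
  have "X = cubic p q r s (mat22 u 0 0 v)"
    using b0 c0 general[of u] general[of v]
    by (simp add: cubic_def qmat_eq_iff mmult_nth u0 v0 flip: xy xy')
  then show "\<exists>p q r s. X = cubic p q r s (mat22 u 0 0 v)" by blast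
next
  fix p q r s assume "cubic p q r s (mat22 u 0 0 v) = 0"
  then have hu: "p *\<^sub>R 1 + q *\<^sub>R u + r *\<^sub>R (u * u) + s *\<^sub>R (u * u * u) = 0"
    and hv: "p *\<^sub>R 1 + q *\<^sub>R v + r *\<^sub>R (v * v) + s *\<^sub>R (v * v * v) = 0"
    by (simp_all add: cubic_def qmat_eq_iff mmult_nth)
  \<comment> \<open>Dividing the cubic polynomial by the minimal polynomial of \<open>u\<close> leaves the remainder zero, and the
      linear quotient then has the nonreal root \<open>v\<close>.\<close>
  define m n where "m = 2 * qRe u" and "n = (norm u)\<^sup>2"
  have uu: "u * u = m *\<^sub>R u - n *\<^sub>R 1"
    by (simp add: quat_quadratic m_def n_def)
  have uuu: "u * u * u = (m * m - n) *\<^sub>R u - (m * n) *\<^sub>R 1"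
    by (simp add: uu algebra_simps)
  have "(p - r * n - s * m * n) *\<^sub>R 1 + (q + r * m + s * (m * m - n)) *\<^sub>R u = 0"
    using hu[unfolded uuu] by (simp add: uu algebra_simps)
  then have c: "p - r * n - s * m * n = 0" "q + r * m + s * (m * m - n) = 0"
    using nonreal_independent[OF u] by blast+
  have p: "p = r * n + s * m * n" and q: "q = - r * m - s * (m * m - n)"
    using c by linarith+
  have "(s *\<^sub>R v + (r + s * m) *\<^sub>R 1) * (v * v - m *\<^sub>R v + n *\<^sub>R 1) = 0"
    using hv unfolding p q by (simp add: algebra_simps)
  then have "s *\<^sub>R v + (r + s * m) *\<^sub>R 1 = 0"
    using other_quadratic_nonzero[OF v uv] by (simp add: m_def n_def)
  then have "r + s * m = 0 \<and> s = 0"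
    by (intro nonreal_independent[OF v]) (simp add: add.commute)
  then show "p = 0" "q = 0" "r = 0" "s = 0"
    using p q by auto
qed

lemma regular_loxodromic_diagonalizable:
  assumes "regular_loxodromic A"
  obtains P u v where "invertible P" "P ** mat22 u 0 0 v = A ** P" "nonreal u" "nonreal v" "norm u \<noteq> norm v"
proof -
  obtain r \<theta> \<phi> I J where h: "r > 1" "\<theta> \<in> {0<..<pi}" "\<phi> \<in> {0<..<pi}" "I \<in> imag_units" "J \<in> imag_units"
    "A \<in> conj_class (mat22 (r *\<^sub>R qcis I \<theta>) 0 0 (inverse r *\<^sub>R qcis J \<phi>))"
    using assms unfolding regular_loxodromic_def by blast
  obtain P where P: "invertible P" "P ** mat22 (r *\<^sub>R qcis I \<theta>) 0 0 (inverse r *\<^sub>R qcis J \<phi>) = A ** P"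
    using h(6) unfolding conj_class_iff by blast
  have s: "sin \<theta> \<noteq> 0" "sin \<phi> \<noteq> 0"
    using h sin_gt_zero by fastforce+
  have "inverse r < r" using h(1) by (smt (verit) inverse_less_1_iff)
  then show thesis
    using that[OF P] h s by (simp add: nonreal_qcis norm_qcis)
qed

lemma regular_loxodromic_cyclic: "regular_loxodromic A \<Longrightarrow> cyclic A"
  by (metis regular_loxodromic_diagonalizable cyclic_similar cyclic_diag)

lemma regular_loxodromic_inv_cyclic:
  assumes "regular_loxodromic A" shows "cyclic (matrix_inv A)"
proof -
  obtain P u v where h: "invertible P" "P ** mat22 u 0 0 v = A ** P" "nonreal u" "nonreal v" "norm u \<noteq> norm v"
    by (rule regular_loxodromic_diagonalizable[OF assms])
  have uv0: "u \<noteq> 0" "v \<noteq> 0" using h(3,4) by (auto simp: nonreal_iff quat_defs)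
  have "invertible A" using assms by (simp add: regular_loxodromic_def SL2H_iff)
  have D: "mat22 u 0 0 v ** mat22 (inverse u) 0 0 (inverse v) = mat 1"
    using uv0 by (simp add: qmat_eq_iff mmult_nth)
  have D': "mat22 (inverse u) 0 0 (inverse v) ** mat22 u 0 0 v = mat 1"
    using uv0 by (simp add: qmat_eq_iff mmult_nth)
  have "invertible (mat22 u 0 0 v)" using D D' by (auto simp: invertible_def)
  from similar_inverse[OF this \<open>invertible A\<close> h(2)]
  have "P ** mat22 (inverse u) 0 0 (inverse v) = matrix_inv A ** P"
    by (simp add: matrix_inv_eqI[OF D D'])
  moreover have "cyclic (mat22 (inverse u) 0 0 (inverse v))"
  proof (rule cyclic_diag)
    show "nonreal (inverse u)" "nonreal (inverse v)"
      using h(3,4) uv0 by (auto simp: nonreal_iff inverse_quat_def quat_defs)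
    show "norm (inverse u) \<noteq> norm (inverse v)"
      using h(5) by (simp add: norm_inverse)
  qed
  ultimately show ?thesis
    using cyclic_similar[OF h(1)] by blast
qed

section \<open>Analytic families of conjugates and tangent spaces\<close>

lemma linear_components: "linear (\<lambda>M::qmat. M $ i $ j)" "linear qcnj"
  by (auto intro!: linearI simp: quat_defs)

lemma entire_ext_Pair:
  assumes "entire_ext f" "entire_ext g" shows "entire_ext (\<lambda>x. (f x, g x))"
proof -
  have "linear (\<lambda>u. (u, 0))" "linear (\<lambda>u. (0, u))"
    by (auto intro!: linearI)
  from entire_ext_add[OF entire_ext_linear_compose[OF this(1) assms(1)] entire_ext_linear_compose[OF this(2) assms(2)]]
  show ?thesis by simp
qed

lemma entire_ext_diff:
  assumes "entire_ext f" "entire_ext g" shows "entire_ext (\<lambda>x. f x - g x)"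
proof -
  have "linear (\<lambda>u::'b. - u)" by (auto intro!: linearI)
  from entire_ext_add[OF assms(1) entire_ext_linear_compose[OF this assms(2)]]
  show ?thesis by simp
qed

lemma entire_ext_ident: "entire_ext (\<lambda>x. x)"
  by (rule entire_ext_linear) (simp add: linear_ident)

lemma entire_ext_fst: "entire_ext f \<Longrightarrow> entire_ext (\<lambda>x. fst (f x))"
  by (rule entire_ext_linear_compose[OF linear_fst])

lemma entire_ext_snd: "entire_ext f \<Longrightarrow> entire_ext (\<lambda>x. snd (f x))"
  by (rule entire_ext_linear_compose[OF linear_snd])

lemma entire_ext_mmult: "entire_ext f \<Longrightarrow> entire_ext g \<Longrightarrow> entire_ext (\<lambda>x. (f x :: qmat) ** (g x :: qmat))"
  by (rule entire_ext_bilinear[OF bounded_bilinear_mmult])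

lemma entire_ext_times: "entire_ext f \<Longrightarrow> entire_ext g \<Longrightarrow> entire_ext (\<lambda>x. f x * g x :: real)"
  by (rule entire_ext_bilinear[OF bounded_bilinear_mult])

lemma entire_ext_qtimes: "entire_ext f \<Longrightarrow> entire_ext g \<Longrightarrow> entire_ext (\<lambda>x. f x * g x :: quat)"
  by (rule entire_ext_bilinear[OF bounded_bilinear_mult])

lemma entire_ext_inner: "entire_ext f \<Longrightarrow> entire_ext g \<Longrightarrow> entire_ext (\<lambda>x. inner (f x) (g x) :: real)"
  by (rule entire_ext_bilinear[OF bounded_bilinear_inner])

lemma entire_ext_scaleR: "entire_ext f \<Longrightarrow> entire_ext g \<Longrightarrow> entire_ext (\<lambda>x. f x *\<^sub>R g x)"
  by (rule entire_ext_bilinear[OF bounded_bilinear_scaleR])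

lemmas entire_ext_intros = entire_ext_Pair entire_ext_diff entire_ext_add entire_ext_ident entire_ext_const
  entire_ext_fst entire_ext_snd entire_ext_mmult entire_ext_times entire_ext_qtimes entire_ext_inner entire_ext_scaleR

lemma hol_ext_Pair:
  assumes "hol_ext f p" "hol_ext g p" shows "hol_ext (\<lambda>x. (f x, g x)) p"
proof -
  obtain \<Omega> F where f: "(p, 0) \<in> \<Omega>" "chol F \<Omega>" "\<forall>x. (x, 0) \<in> \<Omega> \<longrightarrow> F (x, 0) = (f x, 0)"
    using assms unfolding hol_ext_def by blast
  obtain \<Omega>' G where g: "(p, 0) \<in> \<Omega>'" "chol G \<Omega>'" "\<forall>x. (x, 0) \<in> \<Omega>' \<longrightarrow> G (x, 0) = (g x, 0)"
    using assms unfolding hol_ext_def by blast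
  define H where "H z = ((fst (F z), fst (G z)), (snd (F z), snd (G z)))" for z
  have "chol H (\<Omega> \<inter> \<Omega>')"
    unfolding chol_def
  proof (intro conjI ballI)
    show "open (\<Omega> \<inter> \<Omega>')" using f g by (auto simp: chol_def)
    fix z assume z: "z \<in> \<Omega> \<inter> \<Omega>'"
    obtain D where D: "(F has_derivative D) (at z)" "\<And>v. D (imul v) = imul (D v)"
      using f(2) z unfolding chol_def by blast
    obtain E where E: "(G has_derivative E) (at z)" "\<And>v. E (imul v) = imul (E v)"
      using g(2) z unfolding chol_def by blast
    have "(H has_derivative (\<lambda>v. ((fst (D v), fst (E v)), (snd (D v), snd (E v))))) (at z)"
      unfolding H_def by (intro has_derivative_Pair has_derivative_fst has_derivative_snd D E)
    moreover have "((fst (D (imul v)), fst (E (imul v))), (snd (D (imul v)), snd (E (imul v)))) =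
        imul ((fst (D v), fst (E v)), (snd (D v), snd (E v)))" for v
      by (simp only: D(2) E(2)) (simp add: imul_def)
    ultimately show "\<exists>D. (H has_derivative D) (at z) \<and> (\<forall>v. D (imul v) = imul (D v))"
      by blast
  qed
  then show ?thesis
    unfolding hol_ext_def using f g
    by (intro exI[of _ "\<Omega> \<inter> \<Omega>'"] exI[of _ H]) (auto simp: H_def zero_prod_def)
qed

lemma hol_ext_linear: "linear f \<Longrightarrow> hol_ext f p"
  by (rule entire_ext_imp_hol_ext[OF entire_ext_linear])

lemma hol_ext_entire_compose: "hol_ext f p \<Longrightarrow> entire_ext g \<Longrightarrow> hol_ext (\<lambda>x. g (f x)) p"
  by (rule hol_ext_compose[OF _ entire_ext_imp_hol_ext])

lemma hol_ext_continuous: "hol_ext f p \<Longrightarrow> isCont f p"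
  by (rule differentiable_imp_continuous_within[OF hol_ext_differentiable])

lemma entire_ext_inverse_function_within:
  fixes f :: "'a::euclidean_space \<Rightarrow> 'a"
  assumes "entire_ext f" "(f has_derivative f') (at x0)" "inj f'" "open N" "x0 \<in> N"
  obtains U V g where "open U" "open V" "x0 \<in> U" "U \<subseteq> N" "homeomorphism U V f g" "\<forall>y\<in>V. hol_ext g y"
proof -
  obtain U V g where h: "open U" "open V" "x0 \<in> U" "homeomorphism U V f g" "\<forall>y\<in>V. hol_ext g y"
    by (rule entire_ext_inverse_function[OF assms(1-3)])
  have V: "f ` (U \<inter> N) = V \<inter> g -` N"
    using h(4) unfolding homeomorphism_def by auto
  have "open (V \<inter> g -` N)"
    using h(2,4) assms(4) by (auto simp: homeomorphism_def intro!: continuous_open_preimage)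
  moreover have "homeomorphism (U \<inter> N) (V \<inter> g -` N) f g"
    by (rule homeomorphism_of_subsets[OF h(4) Int_lower1 Int_lower1 V])
  ultimately show thesis
    using that[of "U \<inter> N" "V \<inter> g -` N" g] h assms by blast
qed

lemma invertible_if_left_injective:
  fixes M :: qmat
  assumes "\<And>Y::qmat. M ** Y = 0 \<Longrightarrow> Y = 0"
  shows "invertible M"
proof -
  have lin: "linear (\<lambda>Y::qmat. M ** Y)"
    by (auto intro!: linearI simp: mm_simps)
  have "inj (\<lambda>Y::qmat. M ** Y)"
    using assms by (simp add: linear_injective_0[OF lin])
  then obtain R :: qmat where R: "M ** R = mat 1"
    using linear_injective_imp_surjective[OF lin] unfolding surj_def by metis
  have "M ** (R ** M - mat 1) = 0"
    using R by (simp add: mm_simps matrix_mul_assoc)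
  then have "R ** M = mat 1" using assms by fastforce
  then show ?thesis using R by (auto simp: invertible_def)
qed

text \<open>The Neumann series argument, reduced to injectivity of left multiplication.\<close>

lemma invertible_near_one:
  obtains \<delta> where "0 < \<delta>" "\<forall>X::qmat. norm X < \<delta> \<longrightarrow> invertible (mat 1 + X)"
proof -
  obtain K where K0: "0 < K \<and> (\<forall>(X::qmat) (Y::qmat). norm (X ** Y) \<le> norm X * norm Y * K)"
    using mm.pos_bounded by (rule exE) (rule that)
  then have K: "0 < K" "norm (X ** Y) \<le> norm X * norm Y * K" for X Y :: qmat
    by simp_all
  have "invertible (mat 1 + X)" if X: "norm X < 1 / K" for X :: qmat
  proof (rule invertible_if_left_injective)
    fix Y :: qmat assume "(mat 1 + X) ** Y = 0"
    then have "Y = - (X ** Y)" by (simp add: mm_simps eq_neg_iff_add_eq_0)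
    then have "norm Y \<le> (norm X * K) * norm Y"
    proof -
      assume "Y = - (X ** Y)"
      then have "norm Y = norm (X ** Y)" by (metis norm_minus_cancel)
      then show ?thesis using K(2)[of X Y] by (simp add: mult_ac)
    qed
    moreover have "norm X * K < 1" using X K(1) by (simp add: pos_less_divide_eq)
    ultimately show "Y = 0"
      using mult_strict_right_mono[of "norm X * K" 1 "norm Y"] by (cases "Y = 0") auto
  qed
  then show thesis using that[of "1 / K"] K(1) by simp
qed

text \<open>Inversion is read off from the inverse of the polynomial map \<open>(M, Y) \<mapsto> (M, M ** Y)\<close>.\<close>

lemma hol_ext_matrix_inv:
  obtains U where "open U" "mat 1 \<in> U" "\<forall>M\<in>U. invertible (M::qmat)" "hol_ext matrix_inv (mat 1 :: qmat)"
proof -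
  obtain \<delta> where \<delta>: "0 < \<delta>" "\<forall>X::qmat. norm X < \<delta> \<longrightarrow> invertible (mat 1 + X)"
    by (rule invertible_near_one)
  define N where "N = ball (mat 1 :: qmat) \<delta>"
  have N: "invertible M" if "M \<in> N" for M
    using spec[OF \<delta>(2), of "M - mat 1"] that by (simp add: N_def dist_norm norm_minus_commute)
  define f where "f = (\<lambda>w::qmat \<times> qmat. (fst w, fst w ** snd w))"
  have ent: "entire_ext f" unfolding f_def by (intro entire_ext_intros)
  have deriv: "(f has_derivative (\<lambda>h. (fst h, mat 1 ** snd h + fst h ** mat 1))) (at (mat 1, mat 1))"
    unfolding f_def
    by (auto intro!: derivative_eq_intros mm.FDERIV[THEN has_derivative_eq_rhs])
  have inj: "inj (\<lambda>h::qmat \<times> qmat. (fst h, mat 1 ** snd h + fst h ** mat 1))"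
    by (rule injI) (auto simp: prod_eq_iff)
  obtain U V g where h: "open U" "open V" "(mat 1, mat 1) \<in> U" "homeomorphism U V f g" "\<forall>y\<in>V. hol_ext g y"
    by (rule entire_ext_inverse_function[OF ent deriv inj])
  have V1: "(mat 1, mat 1) \<in> V"
  proof -
    have "f (mat 1, mat 1) \<in> f ` U" using h(3) by (rule imageI)
    moreover have "f ` U = V" using h(4) by (simp add: homeomorphism_def)
    ultimately show ?thesis by (simp add: f_def)
  qed
  define W where "W = N \<inter> {M. (M, mat 1) \<in> V}"
  have oW: "open W"
  proof -
    have "open {M. (M, mat 1) \<in> V}" by (rule open_slice[OF h(2)])
    then show ?thesis by (simp add: W_def N_def open_Int)
  qed
  have W1: "mat 1 \<in> W" using \<delta>(1) V1 by (simp add: W_def N_def)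
  have g: "snd (g (M, mat 1)) = matrix_inv M" if M: "M \<in> W" for M
  proof -
    have "f (g (M, mat 1)) = (M, mat 1)"
      using M h(4) unfolding W_def homeomorphism_def by blast
    then have "M ** snd (g (M, mat 1)) = mat 1"
      by (auto simp: f_def prod_eq_iff)
    then have "matrix_inv M ** (M ** snd (g (M, mat 1))) = matrix_inv M ** mat 1" by simp
    then show ?thesis using N[of M] M by (simp add: W_def)
  qed
  have "hol_ext (\<lambda>M. (M, mat 1 :: qmat)) (mat 1 :: qmat)"
    by (intro entire_ext_imp_hol_ext entire_ext_intros)
  then have "hol_ext (\<lambda>M. snd (g (M, mat 1))) (mat 1)"
    by (intro hol_ext_entire_compose[of "\<lambda>M. g (M, mat 1)" _ snd] hol_ext_compose[of "\<lambda>M. (M, mat 1)" _ g] bspec[OF h(5)] V1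
        entire_ext_intros)
  then have "hol_ext matrix_inv (mat 1 :: qmat)"
    by (rule hol_ext_cong[OF _ oW W1 g])
  then show thesis
    using that[of W] oW W1 N by (auto simp: W_def)
qed

lemma conj_mat_one: "conj_mat (mat 1) A = A"
  by (subst conj_mat_eq_iff) (auto simp: invertible_def)

lemma conj_mat_hol_ext: "hol_ext (\<lambda>M. conj_mat M A) (mat 1)"
proof -
  obtain U where U: "hol_ext matrix_inv (mat 1 :: qmat)" by (rule hol_ext_matrix_inv)
  have "entire_ext (\<lambda>w::qmat \<times> qmat. fst w ** A ** snd w)" by (intro entire_ext_intros)
  from hol_ext_entire_compose[OF hol_ext_Pair[OF entire_ext_imp_hol_ext[OF entire_ext_ident] U] this]
  show ?thesis by (simp add: conj_mat_def)
qed

text \<open>The derivative is determined by differentiating the relation \<open>conj_mat M A ** M = M ** A\<close>.\<close>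

lemma conj_mat_has_derivative:
  "((\<lambda>M. conj_mat M A) has_derivative (\<lambda>X. X ** A - A ** X)) (at (mat 1))"
proof -
  obtain U where U: "open U" "mat 1 \<in> U" "\<forall>M\<in>U. invertible (M::qmat)" by (rule hol_ext_matrix_inv)
  obtain D where D: "((\<lambda>M. conj_mat M A) has_derivative D) (at (mat 1))"
    using hol_ext_differentiable[OF conj_mat_hol_ext] unfolding differentiable_def by blast
  have "((\<lambda>M. conj_mat M A ** M) has_derivative (\<lambda>X. conj_mat (mat 1) A ** X + D X ** mat 1)) (at (mat 1))"
    by (rule mm.FDERIV[OF D has_derivative_ident])
  moreover have "((\<lambda>M. conj_mat M A ** M) has_derivative (\<lambda>X. X ** A)) (at (mat 1))"
  proof (rule has_derivative_transform_within_open[OF _ U(1,2)])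
    show "((\<lambda>M. M ** A) has_derivative (\<lambda>X. X ** A)) (at (mat 1))"
      by (rule bounded_linear.has_derivative[OF mm.bounded_linear_left has_derivative_ident])
    show "M ** A = conj_mat M A ** M" if "M \<in> U" for M
      using conj_mat_eq_iff[OF bspec[OF U(3) that]] by blast
  qed
  ultimately have "(\<lambda>X. conj_mat (mat 1) A ** X + D X ** mat 1) = (\<lambda>X. X ** A)"
    by (rule has_derivative_unique)
  then have "D X = X ** A - A ** X" for X
  proof -
    assume "(\<lambda>X. conj_mat (mat 1) A ** X + D X ** mat 1) = (\<lambda>X. X ** A)"
    from fun_cong[OF this, of X] show ?thesis
      by (simp add: conj_mat_one algebra_simps)
  qed
  then have "D = (\<lambda>X. X ** A - A ** X)" by (rule ext)
  with D show ?thesis by simp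
qed

lemma tangent_space_hol_ext:
  assumes "hol_ext f p" "(f has_derivative f') (at p)" "open U" "p \<in> U" "f ` U \<subseteq> S"
  shows "f' v \<in> tangent_space S (f p)"
proof -
  obtain d where d: "0 < d" "(\<lambda>t. f (p + t *\<^sub>R v)) C1_differentiable_on {-d<..<d}"
    by (rule hol_ext_curve[OF assms(1)])
  have "open ((\<lambda>t. p + t *\<^sub>R v) -` U)"
    by (intro open_vimage assms(3) continuous_on_add continuous_on_scaleR continuous_on_id continuous_on_const)
  then obtain e where e: "0 < e" "ball 0 e \<subseteq> (\<lambda>t. p + t *\<^sub>R v) -` U"
    by (rule openE[of _ 0]) (simp add: assms(4))
  define r where "r = min d e"
  have sub: "{-r<..<r} \<subseteq> {-d<..<d}" by (auto simp: r_def)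
  have inU: "p + t *\<^sub>R v \<in> U" if "t \<in> {-r<..<r}" for t
    using e(2) that by (auto simp: r_def subset_iff)
  have "((\<lambda>t. p + t *\<^sub>R v) has_vector_derivative v) (at 0)"
    by (auto intro!: derivative_eq_intros)
  then have "((\<lambda>t. p + t *\<^sub>R v) has_derivative (\<lambda>t. t *\<^sub>R v)) (at 0)"
    by (simp add: has_vector_derivative_def)
  from has_derivative_compose[OF this, of f f'] assms(2)
  have "((\<lambda>t. f (p + t *\<^sub>R v)) has_derivative (\<lambda>t. f' (t *\<^sub>R v))) (at 0)" by simp
  then have deriv: "((\<lambda>t. f (p + t *\<^sub>R v)) has_vector_derivative f' v) (at 0)"
    unfolding has_vector_derivative_def
    by (simp add: linear_scale[OF bounded_linear.linear[OF has_derivative_bounded_linear[OF assms(2)]]])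
  show ?thesis
    unfolding tangent_space_def
  proof (intro CollectI exI conjI)
    show "0 < r" using d e by (simp add: r_def)
    show "(\<lambda>t. f (p + t *\<^sub>R v)) C1_differentiable_on {-r<..<r}"
      using d(2) sub by (rule C1_differentiable_on_subset)
    show "(\<lambda>t. f (p + t *\<^sub>R v)) ` {-r<..<r} \<subseteq> S"
      using inU assms(5) by blast
  qed (use deriv in auto)
qed

lemma tangent_space_mono: "S \<subseteq> T \<Longrightarrow> tangent_space S p \<subseteq> tangent_space T p"
  unfolding tangent_space_def by blast

lemma tangent_space_zero:
  assumes "p \<in> S" shows "0 \<in> tangent_space S p"
  unfolding tangent_space_def
proof (intro CollectI exI conjI)
  show "(0::real) < 1" by simp
  show "(\<lambda>_::real. p) C1_differentiable_on {-1<..<1}" by simp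
qed (use assms in auto)

lemma tangent_space_level:
  assumes "v \<in> tangent_space S p" "(f has_derivative f') (at p)" "\<And>x. x \<in> S \<Longrightarrow> f x = c"
  shows "f' v = 0"
proof -
  obtain e \<gamma> where \<gamma>: "0 < e" "\<gamma> ` {-e<..<e} \<subseteq> S" "\<gamma> 0 = p" "(\<gamma> has_vector_derivative v) (at 0)"
    using assms(1) unfolding tangent_space_def by blast
  have const: "f (\<gamma> t) = c" if "t \<in> {-e<..<e}" for t
    using \<gamma>(2) that assms(3) by blast
  have "((\<lambda>t. f (\<gamma> t)) has_derivative (\<lambda>t. f' (t *\<^sub>R v))) (at 0)"
    using has_derivative_compose[of \<gamma> "\<lambda>t. t *\<^sub>R v" 0 UNIV f f'] \<gamma> assms(2)
    by (simp add: has_vector_derivative_def)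
  moreover have "((\<lambda>t. f (\<gamma> t)) has_derivative (\<lambda>t. 0)) (at 0)"
    by (rule has_derivative_transform_within_open[OF has_derivative_const[of c], of "{-e<..<e}"])
       (use \<gamma>(1) const in auto)
  ultimately have "(\<lambda>t. f' (t *\<^sub>R v)) = (\<lambda>t. 0)"
    by (rule has_derivative_unique)
  then show ?thesis by (metis scaleR_one)
qed

subsection \<open>The tangent spaces of the special linear group\<close>

lemma qdet_eq_inner: "qdet M = inner (M$1$1) (M$1$1) * inner (M$2$2) (M$2$2) + inner (M$1$2) (M$1$2) * inner (M$2$1) (M$2$1)
   - 2 * inner (qcnj (M$2$1) * M$2$2) (qcnj (M$1$1) * M$1$2)"
  by (simp add: qdet_def power2_norm_eq_inner inner_eq_qRe qcnj_mult mult.assoc)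

lemma entire_ext_qdet: "entire_ext f \<Longrightarrow> entire_ext (\<lambda>x. qdet (f x))"
  unfolding qdet_eq_inner
  by (intro entire_ext_intros entire_ext_linear_compose[OF linear_components(1)]
      entire_ext_linear_compose[OF linear_components(2)])

lemma qdet_has_derivative_one: "(qdet has_derivative (\<lambda>m. 2 * tau m)) (at (mat 1))"
proof -
  have bl: "bounded_linear (\<lambda>M::qmat. M $ i $ j)" "bounded_linear qcnj" for i j
    using linear_components by (simp_all add: linear_conv_bounded_linear)
  note c = bounded_linear.has_derivative[OF bl(1) has_derivative_ident]
  note q = bounded_linear.has_derivative[OF bl(2)]
  note n = has_derivative_inner[OF c c]
  note p = has_derivative_mult[OF q[OF c] c]
  show ?thesis
    unfolding qdet_eq_inner[abs_def]
    by (rule has_derivative_eq_rhs,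
        rule has_derivative_diff[OF has_derivative_add[OF has_derivative_mult[OF n n] has_derivative_mult[OF n n]]
          has_derivative_mult_right[OF has_derivative_inner[OF p p]]])
       (simp add: fun_eq_iff inner_eq_qRe tau_def algebra_simps)
qed

text \<open>Multiplicativity moves the computation to the identity matrix.\<close>

lemma qdet_has_derivative:
  assumes "invertible D"
  shows "(qdet has_derivative (\<lambda>v. qdet D * (2 * tau (matrix_inv D ** v)))) (at D)"
proof -
  have 1: "((\<lambda>M. matrix_inv D ** M) has_derivative (\<lambda>v. matrix_inv D ** v)) (at D)"
    by (rule bounded_linear.has_derivative[OF mm.bounded_linear_right has_derivative_ident])
  have "((\<lambda>M. qdet (matrix_inv D ** M)) has_derivative (\<lambda>v. 2 * tau (matrix_inv D ** v))) (at D)"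
    by (rule has_derivative_compose[OF 1]) (simp add: matrix_inv_works[OF assms] qdet_has_derivative_one)
  then have "((\<lambda>M. qdet D * qdet (matrix_inv D ** M)) has_derivative (\<lambda>v. qdet D * (2 * tau (matrix_inv D ** v)))) (at D)"
    by (rule has_derivative_mult_right)
  moreover have "(\<lambda>M. qdet D * qdet (matrix_inv D ** M)) = qdet"
    using assms by (simp add: fun_eq_iff flip: qdet_mult)
  ultimately show ?thesis by simp
qed

text \<open>Rescaling by the factor \<open>k M\<close> with \<open>k M ^ 4 * qdet M = 1\<close> maps a neighbourhood of the identity into
  \<^const>\<open>SL2H\<close>. The inverse function theorem for \<open>(M, k) \<mapsto> (M, k ^ 4 * qdet M)\<close> shows that this factor is
  analytic; the derivative of \<open>s\<close> at the identity is the projection onto the matrices of trace zero.\<close>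

lemma SL2H_retraction:
  obtains U s where "open U" "mat 1 \<in> U" "hol_ext s (mat 1)" "s ` U \<subseteq> SL2H" "s (mat 1) = mat 1"
    "(s has_derivative (\<lambda>m. m - (tau m / 2) *\<^sub>R mat 1)) (at (mat 1))"
proof -
  obtain U0 where U0: "open U0" "mat 1 \<in> U0" "\<forall>M\<in>U0. invertible (M::qmat)" by (rule hol_ext_matrix_inv)
  define f where "f = (\<lambda>w::qmat \<times> real. (fst w, snd w * snd w * snd w * snd w * qdet (fst w)))"
  have ent: "entire_ext f" unfolding f_def by (intro entire_ext_intros entire_ext_qdet)
  have dq: "((\<lambda>w::qmat \<times> real. qdet (fst w)) has_derivative (\<lambda>h. 2 * tau (fst h))) (at (mat 1, 1))"
    by (rule has_derivative_compose[OF has_derivative_fst[OF has_derivative_ident]]) (simp add: qdet_has_derivative_one)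
  have deriv: "(f has_derivative (\<lambda>h. (fst h, 4 * snd h + 2 * tau (fst h)))) (at (mat 1, 1))"
    unfolding f_def
    by (auto intro!: derivative_eq_intros dq[THEN has_derivative_eq_rhs])
  have inj: "inj (\<lambda>h. (fst h, 4 * snd h + 2 * tau (fst h)))"
    by (rule injI) (auto simp: prod_eq_iff)
  obtain U V g where h: "open U" "open V" "(mat 1, 1) \<in> U" "homeomorphism U V f g" "\<forall>y\<in>V. hol_ext g y"
    by (rule entire_ext_inverse_function[OF ent deriv inj])
  have f1: "f (mat 1, 1) = (mat 1, 1)" by (simp add: f_def)
  have V1: "(mat 1, 1) \<in> V" and g1: "g (mat 1, 1) = (mat 1, 1)"
  proof -
    have "f (mat 1, 1) \<in> f ` U" using h(3) by (rule imageI)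
    moreover have "f ` U = V" using h(4) by (simp add: homeomorphism_def)
    ultimately show "(mat 1, 1) \<in> V" by (simp add: f1)
    have "g (f (mat 1, 1)) = (mat 1, 1)" using h(3,4) by (simp add: homeomorphism_def)
    then show "g (mat 1, 1) = (mat 1, 1)" by (simp add: f1)
  qed
  define W where "W = U0 \<inter> {M. (M, 1) \<in> V}"
  have oW: "open W"
  proof -
    have "open {M. (M, 1) \<in> V}" by (rule open_slice[OF h(2)])
    then show ?thesis using U0(1) by (simp add: W_def open_Int)
  qed
  have W1: "mat 1 \<in> W" using V1 U0 by (simp add: W_def)
  define k where "k M = snd (g (M, 1))" for M
  have k: "k M * k M * k M * k M * qdet M = 1" if M: "M \<in> W" for M
  proof -
    have "f (g (M, 1)) = (M, 1)"
      using M h(4) unfolding W_def homeomorphism_def by blast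
    then show ?thesis by (auto simp: f_def prod_eq_iff k_def)
  qed
  have hol1: "hol_ext (\<lambda>M. (M, 1::real)) (mat 1 :: qmat)"
    by (intro entire_ext_imp_hol_ext entire_ext_intros)
  have holk: "hol_ext k (mat 1)"
    unfolding k_def[abs_def]
    by (intro hol_ext_entire_compose[of "\<lambda>M. g (M, 1)" _ snd] hol_ext_compose[of "\<lambda>M. (M, 1)" _ g] hol1 bspec[OF h(5)] V1
        entire_ext_intros)
  obtain k' where k': "(k has_derivative k') (at (mat 1))"
    using hol_ext_differentiable[OF holk] unfolding differentiable_def by blast
  have k1: "k (mat 1) = 1" by (simp add: k_def g1)
  have "((\<lambda>M. k M * k M * k M * k M * qdet M) has_derivative (\<lambda>m. 4 * k' m + 2 * tau m)) (at (mat 1))"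
    by (auto intro!: derivative_eq_intros k'[THEN has_derivative_eq_rhs]
        qdet_has_derivative_one[THEN has_derivative_eq_rhs] simp: k1)
  moreover have "((\<lambda>M. k M * k M * k M * k M * qdet M) has_derivative (\<lambda>m. 0)) (at (mat 1))"
    by (rule has_derivative_transform_within_open[OF has_derivative_const[of 1] oW W1]) (simp add: k)
  ultimately have "(\<lambda>m. 4 * k' m + 2 * tau m) = (\<lambda>m. 0)"
    by (rule has_derivative_unique)
  then have k'_eq: "k' m = - (tau m / 2)" for m
    using fun_cong[of _ _ m] by fastforce
  define s where "s M = k M *\<^sub>R M" for M
  have "entire_ext (\<lambda>w::real \<times> qmat. fst w *\<^sub>R snd w)" by (intro entire_ext_intros)
  from hol_ext_entire_compose[OF hol_ext_Pair[OF holk entire_ext_imp_hol_ext[OF entire_ext_ident]] this]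
  have "hol_ext s (mat 1)" by (simp add: s_def[abs_def])
  moreover have "s ` W \<subseteq> SL2H"
  proof
    fix Z assume "Z \<in> s ` W"
    then obtain M where M: "M \<in> W" "Z = s M" by blast
    have "k M \<noteq> 0" using k[OF M(1)] by auto
    then show "Z \<in> SL2H"
      using M k[OF M(1)] bspec[OF U0(3), of M]
      by (simp add: SL2H_iff s_def W_def invertible_scaleR qdet_scaleR power4_eq_xxxx)
  qed
  moreover have "(s has_derivative (\<lambda>m. m - (tau m / 2) *\<^sub>R mat 1)) (at (mat 1))"
    unfolding s_def[abs_def]
    by (rule has_derivative_eq_rhs, rule has_derivative_scaleR[OF k' has_derivative_ident])
       (simp add: k1 k'_eq fun_eq_iff)
  ultimately show thesis
    using that[OF oW W1] by (simp add: s_def k1)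
qed

text \<open>Tangent vectors are annihilated by the derivative of \<^const>\<open>qdet\<close>. Conversely, the left translate
  of the retraction supplies a curve for every vector annihilated by it.\<close>

theorem tangent_space_SL2H:
  assumes "D \<in> SL2H"
  shows "tangent_space SL2H D = {v. tau (matrix_inv D ** v) = 0}"
proof (intro equalityI subsetI CollectI)
  fix v assume "v \<in> tangent_space SL2H D"
  from tangent_space_level[OF this qdet_has_derivative[OF SL2H_invertible[OF assms]], of 1]
  show "tau (matrix_inv D ** v) = 0"
    using assms by (simp add: SL2H_iff)
next
  fix v assume "v \<in> {v. tau (matrix_inv D ** v) = 0}"
  then have v: "tau (matrix_inv D ** v) = 0" by simp
  obtain U s where s: "open U" "mat 1 \<in> U" "hol_ext s (mat 1)" "s ` U \<subseteq> SL2H" "s (mat 1) = mat 1"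
    "(s has_derivative (\<lambda>m. m - (tau m / 2) *\<^sub>R mat 1)) (at (mat 1))"
    by (rule SL2H_retraction)
  have hol: "hol_ext (\<lambda>M. D ** s M) (mat 1)"
    by (rule hol_ext_entire_compose[OF s(3)]) (intro entire_ext_intros)
  have der: "((\<lambda>M. D ** s M) has_derivative (\<lambda>m. D ** (m - (tau m / 2) *\<^sub>R mat 1))) (at (mat 1))"
    by (rule bounded_linear.has_derivative[OF mm.bounded_linear_right s(6)])
  have "D ** ((matrix_inv D ** v) - (tau (matrix_inv D ** v) / 2) *\<^sub>R mat 1) \<in> tangent_space SL2H (D ** s (mat 1))"
    by (rule tangent_space_hol_ext[OF hol der s(1,2)]) (use s(4) assms SL2H_mult in blast)
  then show "v \<in> tangent_space SL2H D"
    using v s(5) SL2H_invertible[OF assms] by simp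
qed

lemma sl2H_eq: "sl2H = {X. tau X = 0}"
proof -
  have "matrix_inv (mat 1 :: qmat) = mat 1" by (rule matrix_inv_eqI) simp_all
  then show ?thesis unfolding sl2H_def by (simp add: tangent_space_SL2H SL2H_one)
qed

text \<open>The trace-free part of a matrix commuting with \<open>A\<close> and \<open>B\<close> lies in both centralizers.\<close>

lemma commutant_trivial:
  assumes "lie_centralizer A \<inter> lie_centralizer B = {0}" "A \<in> SL2H" "B \<in> SL2H"
    and "A ** M = M ** A" "B ** M = M ** B"
  shows "M = (tau M / 2) *\<^sub>R mat 1"
proof -
  define X where "X = M - (tau M / 2) *\<^sub>R mat 1"
  have "A ** X = X ** A" "B ** X = X ** B"
    using assms(4,5) by (simp_all add: X_def mm_simps)
  then have "conj_mat A X = X" "conj_mat B X = X"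
    using conj_mat_eq_iff[OF SL2H_invertible] assms(2,3) by blast+
  moreover have "tau X = 0" by (simp add: X_def)
  ultimately have "X \<in> lie_centralizer A \<inter> lie_centralizer B"
    by (simp add: lie_centralizer_def sl2H_eq)
  then have "X = 0" using assms(1) by blast
  then show ?thesis by (simp add: X_def)
qed

lemma tangent_space_conj_classes:
  "(X ** A - A ** X, Y ** B - B ** Y) \<in> tangent_space (conj_class A \<times> conj_class B) (A, B)"
proof -
  obtain U where U: "open U" "mat 1 \<in> U" "\<forall>M\<in>U. invertible (M::qmat)" by (rule hol_ext_matrix_inv)
  define f where "f w = (conj_mat (fst w) A, conj_mat (snd w) B)" for w
  have p: "hol_ext (fst :: qmat \<times> qmat \<Rightarrow> qmat) q" "hol_ext (snd :: qmat \<times> qmat \<Rightarrow> qmat) q" for q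
    by (intro hol_ext_linear linear_fst linear_snd)+
  have hol: "hol_ext f (mat 1, mat 1)"
    unfolding f_def[abs_def]
    by (intro hol_ext_Pair hol_ext_compose[OF p(1)] hol_ext_compose[OF p(2)]) (simp_all add: conj_mat_hol_ext)
  have der: "(f has_derivative (\<lambda>h. (fst h ** A - A ** fst h, snd h ** B - B ** snd h))) (at (mat 1, mat 1))"
    unfolding f_def[abs_def]
    by (intro has_derivative_Pair has_derivative_compose[OF has_derivative_fst[OF has_derivative_ident]]
        has_derivative_compose[OF has_derivative_snd[OF has_derivative_ident]])
       (simp_all add: conj_mat_has_derivative)
  have "f ` (U \<times> U) \<subseteq> conj_class A \<times> conj_class B"
  proof -
    have "conj_mat M A \<in> conj_class A" if "M \<in> U" for M A
      unfolding conj_class_iff using bspec[OF U(3) that] conj_mat_eq_iff[OF bspec[OF U(3) that]] by blast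
    then show ?thesis by (auto simp: f_def)
  qed
  from tangent_space_hol_ext[OF hol der open_Times[OF U(1) U(1)] _ this, of "(X, Y)"] U(2)
  show ?thesis by (simp add: f_def conj_mat_one)
qed

section \<open>Transversality\<close>

text \<open>The argument of \<open>tau\<close> in \<open>orth\<close> runs through the image of the differential of the multiplication map.
  Annihilating its values for \<open>Y = 0\<close> means \<open>A B Z = B Z A\<close>, and for \<open>X = 0\<close> it means \<open>B Z A = Z A B\<close>;
  together they say that \<open>A B Z\<close> commutes with \<open>A\<close> and with \<open>B\<close>.\<close>

lemma double_commutator_orthogonal:
  assumes cent: "\<And>M. A ** M = M ** A \<Longrightarrow> B ** M = M ** B \<Longrightarrow> M = (tau M / 2) *\<^sub>R mat 1"
    and orth: "\<And>X Y. tau (Z ** ((X ** A - A ** X) ** B + A ** (Y ** B - B ** Y))) = 0"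
  shows "\<exists>\<mu>. A ** B ** Z = \<mu> *\<^sub>R mat 1"
proof -
  have 1: "A ** B ** Z = B ** Z ** A"
  proof -
    have "tau ((A ** B ** Z - B ** Z ** A) ** X) = 0" for X
    proof -
      have "tau (A ** B ** Z ** X) = tau (Z ** X ** (A ** B))"
        using tau_commute[of "A ** B" "Z ** X"] by (simp add: matrix_mul_assoc)
      moreover have "tau (B ** Z ** A ** X) = tau (Z ** A ** X ** B)"
        using tau_commute[of B "Z ** A ** X"] by (simp add: matrix_mul_assoc)
      ultimately show ?thesis
        using orth[of X 0] by (simp add: mm_simps matrix_mul_assoc)
    qed
    from tau_nondegenerate[OF this] show ?thesis by simp
  qed
  have 2: "B ** Z ** A = Z ** A ** B"
  proof -
    have "tau ((B ** Z ** A - Z ** A ** B) ** Y) = 0" for Y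
    proof -
      have "tau (B ** Z ** A ** Y) = tau (Z ** A ** Y ** B)"
        using tau_commute[of B "Z ** A ** Y"] by (simp add: matrix_mul_assoc)
      then show ?thesis
        using orth[of 0 Y] by (simp add: mm_simps matrix_mul_assoc)
    qed
    from tau_nondegenerate[OF this] show ?thesis by simp
  qed
  have "A ** (A ** B ** Z) = (A ** B ** Z) ** A"
    by (subst 1) (simp add: matrix_mul_assoc)
  moreover have "B ** (A ** B ** Z) = (A ** B ** Z) ** B"
  proof -
    have "B ** (A ** B ** Z) = B ** (Z ** A ** B)" using 1 2 by simp
    also have "\<dots> = (B ** Z ** A) ** B" by (simp add: matrix_mul_assoc)
    finally show ?thesis using 1 by simp
  qed
  ultimately show ?thesis using cent by blast
qed

text \<open>The annihilator of the image consists of multiples of \<open>(A ** B)\<inverse>\<close>, and these annihilate the tangent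
  space of \<^const>\<open>SL2H\<close> at \<open>A ** B\<close>.\<close>

lemma double_commutator_surjective:
  assumes "A \<in> SL2H" "B \<in> SL2H"
    and cent: "\<And>M. A ** M = M ** A \<Longrightarrow> B ** M = M ** B \<Longrightarrow> M = (tau M / 2) *\<^sub>R mat 1"
    and v: "tau (matrix_inv (A ** B) ** v) = 0"
  shows "\<exists>X Y. v = (X ** A - A ** X) ** B + A ** (Y ** B - B ** Y)"
proof -
  define L where "L = (\<lambda>(X, Y). (X ** A - A ** X) ** B + A ** (Y ** B - B ** Y))"
  have "linear L"
    by (rule linearI) (auto simp: L_def mm_simps algebra_simps)
  then have "subspace (range L)"
    by (rule linear_subspace_image) simp
  then have "v \<in> range L"
  proof (rule tau_orthogonal_membership)
    fix Z assume Z: "\<And>s. s \<in> range L \<Longrightarrow> tau (Z ** s) = 0"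
    have "tau (Z ** ((X ** A - A ** X) ** B + A ** (Y ** B - B ** Y))) = 0" for X Y
      using Z[OF rangeI[of L "(X, Y)"]] by (simp add: L_def)
    from double_commutator_orthogonal[OF cent this]
    obtain \<mu> where \<mu>: "A ** B ** Z = \<mu> *\<^sub>R mat 1" by blast
    have "matrix_inv (A ** B) ** (A ** B ** Z) = matrix_inv (A ** B) ** (\<mu> *\<^sub>R mat 1)"
      by (simp only: \<mu>)
    then have "Z = \<mu> *\<^sub>R matrix_inv (A ** B)"
      using SL2H_invertible[OF SL2H_mult[OF assms(1,2)]] by (simp add: mm_simps)
    then show "tau (Z ** v) = 0" using v by (simp add: mm_simps)
  qed
  then show ?thesis by (auto simp: L_def)
qed

text \<open>The differential of the multiplication map alone is already onto the tangent space of \<^const>\<open>SL2H\<close>;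
  from the tangent space of the third class only its inclusion into that space is required.\<close>

theorem multiplication_transverse:
  assumes "A \<in> SL2H" "B \<in> SL2H"
    and cent: "\<And>M. A ** M = M ** A \<Longrightarrow> B ** M = M ** B \<Longrightarrow> M = (tau M / 2) *\<^sub>R mat 1"
  shows "transverse_at (\<lambda>(A', B'). A' ** B') (conj_class A \<times> conj_class B) (conj_class (A ** B)) SL2H (A, B)"
proof -
  define F where "F = (\<lambda>(A' :: qmat, B' :: qmat). A' ** B')"
  define F' where "F' h = A ** snd h + fst h ** B" for h
  have F': "(F has_derivative F') (at (A, B))"
    unfolding F_def F'_def[abs_def] case_prod_unfold
    by (rule has_derivative_eq_rhs, rule mm.FDERIV[OF has_derivative_fst[OF has_derivative_ident]
        has_derivative_snd[OF has_derivative_ident]]) simp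
  have AB: "A ** B \<in> SL2H" using assms SL2H_mult by blast
  note T = tangent_space_SL2H[OF AB]
  have im: "F' h \<in> tangent_space SL2H (A ** B)" if h: "h \<in> tangent_space (conj_class A \<times> conj_class B) (A, B)" for h
  proof -
    have "((\<lambda>w. qdet (F w)) has_derivative (\<lambda>h. qdet (A ** B) * (2 * tau (matrix_inv (A ** B) ** F' h)))) (at (A, B))"
      using has_derivative_compose[OF F'] qdet_has_derivative[OF SL2H_invertible[OF AB]] by (simp add: F_def)
    moreover have "qdet (F w) = 1" if "w \<in> conj_class A \<times> conj_class B" for w
    proof -
      have "fst w \<in> SL2H" "snd w \<in> SL2H"
        using that subsetD[OF conj_class_SL2H[OF assms(1)]] subsetD[OF conj_class_SL2H[OF assms(2)]] by auto
      from SL2H_mult[OF this] show ?thesis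
        by (simp add: F_def SL2H_iff case_prod_unfold)
    qed
    ultimately have "qdet (A ** B) * (2 * tau (matrix_inv (A ** B) ** F' h)) = 0"
      by (rule tangent_space_level[OF h])
    then show ?thesis using AB by (simp add: T SL2H_iff)
  qed
  have Z: "tangent_space (conj_class (A ** B)) (A ** B) \<subseteq> tangent_space SL2H (A ** B)"
    by (rule tangent_space_mono[OF conj_class_SL2H[OF AB]])
  have sur: "v \<in> F' ` tangent_space (conj_class A \<times> conj_class B) (A, B)" if v: "v \<in> tangent_space SL2H (A ** B)" for v
  proof -
    obtain X Y where "v = (X ** A - A ** X) ** B + A ** (Y ** B - B ** Y)"
      using double_commutator_surjective[OF assms(1,2) cent, of v] v by (auto simp: T)
    then have "v = F' (X ** A - A ** X, Y ** B - B ** Y)" by (simp add: F'_def add.commute)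
    then show ?thesis using tangent_space_conj_classes by blast
  qed
  have "{u + v |u v. u \<in> F' ` tangent_space (conj_class A \<times> conj_class B) (A, B) \<and>
      v \<in> tangent_space (conj_class (A ** B)) (A ** B)} = tangent_space SL2H (A ** B)"
  proof (intro equalityI subsetI)
    fix w assume "w \<in> {u + v |u v. u \<in> F' ` tangent_space (conj_class A \<times> conj_class B) (A, B) \<and>
      v \<in> tangent_space (conj_class (A ** B)) (A ** B)}"
    then obtain h v where "w = F' h + v" "h \<in> tangent_space (conj_class A \<times> conj_class B) (A, B)"
      "v \<in> tangent_space (conj_class (A ** B)) (A ** B)" by blast
    then show "w \<in> tangent_space SL2H (A ** B)"
      using im Z by (auto simp: T mm_simps)
  next
    fix w assume "w \<in> tangent_space SL2H (A ** B)"
    moreover have "0 \<in> tangent_space (conj_class (A ** B)) (A ** B)"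
      by (rule tangent_space_zero[OF conj_class_refl])
    ultimately show "w \<in> {u + v |u v. u \<in> F' ` tangent_space (conj_class A \<times> conj_class B) (A, B) \<and>
      v \<in> tangent_space (conj_class (A ** B)) (A ** B)}"
      using sur by (metis (mono_tags, lifting) CollectI add.right_neutral)
  qed
  moreover have "frechet_derivative F (at (A, B)) = F'"
    by (rule frechet_derivative_at[OF F', symmetric])
  ultimately show ?thesis
    unfolding transverse_at_def F_def[symmetric] by (simp add: F_def)
qed

section \<open>Local slices for conjugation\<close>

text \<open>Single matrices and pairs of matrices, multiplied by a matrix from the left or from the right, are
  treated together: \<open>rm w P = lm P w'\<close> says that \<open>w\<close> is the conjugate of \<open>w'\<close> by \<open>P\<close>.\<close>

locale two_sided_action =
  fixes lm :: "qmat \<Rightarrow> 'w::euclidean_space \<Rightarrow> 'w" and rm :: "'w \<Rightarrow> qmat \<Rightarrow> 'w"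
  assumes bilinear_lm: "bounded_bilinear lm" and bilinear_rm: "bounded_bilinear rm"
    and lm_one [simp]: "lm (mat 1) w = w" and rm_one [simp]: "rm w (mat 1) = w"
begin

sublocale lm: bounded_bilinear lm by (rule bilinear_lm)
sublocale rm: bounded_bilinear rm by (rule bilinear_rm)

definition ad :: "'w \<Rightarrow> qmat \<Rightarrow> 'w"
  where "ad x0 X = rm x0 X - lm X x0"

lemma linear_ad: "linear (ad x0)"
  by (rule linearI) (simp_all add: ad_def lm.add_left rm.add_right lm.scaleR_left rm.scaleR_right algebra_simps)

text \<open>The point \<open>y\<close> is the conjugate of \<open>x0 + z\<close> by \<open>1 + X\<close>, and \<open>(X, z)\<close> satisfies a gauge condition given
  by a linear map \<open>l\<close>. For suitable \<open>l\<close> this condition forces \<open>z\<close> into a complement of the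
  orbit directions, and also \<open>X\<close> into a complement of the infinitesimal stabilizer.\<close>

definition sliced :: "'w \<Rightarrow> ('w \<Rightarrow> qmat) \<Rightarrow> 'w \<Rightarrow> qmat \<Rightarrow> 'w \<Rightarrow> bool"
  where "sliced x0 l y X z \<longleftrightarrow> rm y (mat 1 + X) = lm (mat 1 + X) (x0 + z) \<and> X - l (ad x0 X) + l z = 0"

text \<open>The conjugation equation and the gauge condition are polynomial equations for \<open>(X, z)\<close> with
  parameter \<open>y\<close>. In the linearization at \<open>y = x0\<close> the first one becomes \<open>z = ad x0 X\<close>, which turns the
  second one into \<open>X = 0\<close>, whatever \<open>l\<close> is. Hence the inverse function theorem yields a unique small
  solution that depends analytically on \<open>y\<close>.\<close>

theorem local_slice:
  fixes l :: "'w \<Rightarrow> qmat"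
  assumes l: "linear l" and "0 < \<epsilon>"
  obtains N s \<rho> where "open N" "x0 \<in> N" "\<forall>y\<in>N. hol_ext s y"
    "\<forall>y\<in>N. sliced x0 l y (fst (s y)) (snd (s y)) \<and> norm (fst (s y)) < \<epsilon> \<and> norm (snd (s y)) < \<epsilon>"
    "0 < \<rho>" "\<forall>y\<in>N. \<forall>X z. norm X < \<rho> \<longrightarrow> norm z < \<rho> \<longrightarrow> sliced x0 l y X z \<longrightarrow> s y = (X, z)"
proof -
  define \<Theta> where "\<Theta> = (\<lambda>w::qmat \<times> 'w \<times> 'w.
    (fst w - l (ad x0 (fst w)) + l (fst (snd w)),
     rm (snd (snd w)) (mat 1 + fst w) - lm (mat 1 + fst w) (x0 + fst (snd w)), snd (snd w)))"
  have ent: "entire_ext \<Theta>"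
    unfolding \<Theta>_def
    by (intro entire_ext_intros entire_ext_bilinear[OF bilinear_lm] entire_ext_bilinear[OF bilinear_rm]
        entire_ext_linear_compose[OF l] entire_ext_linear_compose[OF linear_ad])
  define \<Theta>' where "\<Theta>' = (\<lambda>h::qmat \<times> 'w \<times> 'w.
    (fst h - l (ad x0 (fst h)) + l (fst (snd h)),
     ad x0 (fst h) + snd (snd h) - fst (snd h), snd (snd h)))"
  note lin = bounded_linear.has_derivative[OF linear_conv_bounded_linear[THEN iffD1, OF l]]
    bounded_linear.has_derivative[OF linear_conv_bounded_linear[THEN iffD1, OF linear_ad]]
  have deriv: "(\<Theta> has_derivative \<Theta>') (at (0, 0, x0))"
    unfolding \<Theta>_def \<Theta>'_def
    by (auto intro!: derivative_eq_intros lin[THEN has_derivative_eq_rhs] lm.FDERIV[THEN has_derivative_eq_rhs]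
        rm.FDERIV[THEN has_derivative_eq_rhs] simp: lm.zero_left rm.zero_right ad_def algebra_simps)
  have lin\<Theta>': "linear \<Theta>'"
    using has_derivative_bounded_linear[OF deriv] by (simp add: linear_conv_bounded_linear)
  have inj: "inj \<Theta>'"
    unfolding linear_injective_0[OF lin\<Theta>']
  proof (intro allI impI)
    fix h assume h: "\<Theta>' h = 0"
    obtain X z y where h_eq: "h = (X, z, y)" by (cases h) auto
    have "y = 0" "z = ad x0 X" "X - l (ad x0 X) + l z = 0"
      using h by (auto simp: \<Theta>'_def h_eq zero_prod_def)
    then show "h = 0"
      by (simp add: h_eq zero_prod_def linear_0[OF linear_ad])
  qed
  obtain U V g where h: "open U" "open V" "(0, 0, x0) \<in> U" "homeomorphism U V \<Theta> g" "\<forall>y\<in>V. hol_ext g y"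
    by (rule entire_ext_inverse_function[OF ent deriv inj])
  have gU: "g v \<in> U" "\<Theta> (g v) = v" if "v \<in> V" for v
    using h(4) that unfolding homeomorphism_def by auto
  have gT: "g (\<Theta> w) = w" "\<Theta> w \<in> V" if "w \<in> U" for w
    using h(4) that unfolding homeomorphism_def by auto
  have \<Theta>0: "\<Theta> (0, 0, x0) = (0, 0, x0)"
    by (simp add: \<Theta>_def linear_0[OF l] linear_0[OF linear_ad])
  have V0: "(0, 0, x0) \<in> V" and g0: "g (0, 0, x0) = (0, 0, x0)"
    using gT[OF h(3)] by (simp_all add: \<Theta>0)
  define s where "s y = (fst (g (0, 0, y)), fst (snd (g (0, 0, y))))" for y
  define N0 where "N0 = {y. (0, 0, y) \<in> V}"
  have oN0: "open N0"
    using open_vimage[of V "\<lambda>y. (0, 0, y)"] h(2) by (simp add: N0_def vimage_def continuous_on_Pair)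
  have hols: "hol_ext s y" if y: "y \<in> N0" for y
  proof -
    have 1: "hol_ext (\<lambda>y. (0::qmat, 0::'w, y)) y"
      by (intro entire_ext_imp_hol_ext entire_ext_intros)
    have "hol_ext (\<lambda>y. g (0, 0, y)) y"
      by (rule hol_ext_compose[OF 1]) (use h(5) y in \<open>simp add: N0_def\<close>)
    moreover have "entire_ext (\<lambda>w::qmat \<times> 'w \<times> 'w. (fst w, fst (snd w)))"
      by (intro entire_ext_intros)
    ultimately show ?thesis
      unfolding s_def[abs_def] by (rule hol_ext_entire_compose)
  qed
  have g_eq: "g (0, 0, y) = (fst (s y), snd (s y), y)" if y: "y \<in> N0" for y
  proof -
    have "snd (snd (\<Theta> (g (0, 0, y)))) = y"
      using gU(2)[of "(0, 0, y)"] y by (simp add: N0_def)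
    then show ?thesis by (simp add: \<Theta>_def s_def prod_eq_iff)
  qed
  have sl: "sliced x0 l y (fst (s y)) (snd (s y))" if y: "y \<in> N0" for y
  proof -
    have "\<Theta> (fst (s y), snd (s y), y) = (0, 0, y)"
      using gU(2)[of "(0, 0, y)"] y g_eq[OF y] by (simp add: N0_def)
    then show ?thesis by (simp add: \<Theta>_def sliced_def)
  qed
  obtain U1 U2 where U12: "open U1" "open U2" "0 \<in> U1" "(0, x0) \<in> U2" "U1 \<times> U2 \<subseteq> U"
    using h(1,3) unfolding open_prod_def by (metis mem_Sigma_iff)
  obtain U3 U4 where U34: "open U3" "open U4" "0 \<in> U3" "x0 \<in> U4" "U3 \<times> U4 \<subseteq> U2"
    using U12(2,4) unfolding open_prod_def by (metis mem_Sigma_iff)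
  obtain r1 where r1: "0 < r1" "ball 0 r1 \<subseteq> U1" using U12(1,3) by (rule openE)
  obtain r3 where r3: "0 < r3" "ball 0 r3 \<subseteq> U3" using U34(1,3) by (rule openE)
  define N where "N = {y \<in> N0. norm (fst (s y)) < \<epsilon> \<and> norm (snd (s y)) < \<epsilon>} \<inter> U4"
  have conts: "continuous_on N0 s"
    using hols hol_ext_continuous by (auto intro!: continuous_at_imp_continuous_on)
  have o: "open (N0 \<inter> (\<lambda>y. norm (fst (s y))) -` {..<\<epsilon>})" "open (N0 \<inter> (\<lambda>y. norm (snd (s y))) -` {..<\<epsilon>})"
    by (intro continuous_open_preimage oN0 open_lessThan continuous_on_norm continuous_on_fst continuous_on_snd conts)+
  have "open ((N0 \<inter> (\<lambda>y. norm (fst (s y))) -` {..<\<epsilon>}) \<inter> (N0 \<inter> (\<lambda>y. norm (snd (s y))) -` {..<\<epsilon>}) \<inter> U4)"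
    by (rule open_Int[OF open_Int[OF o] U34(2)])
  moreover have "(N0 \<inter> (\<lambda>y. norm (fst (s y))) -` {..<\<epsilon>}) \<inter> (N0 \<inter> (\<lambda>y. norm (snd (s y))) -` {..<\<epsilon>}) \<inter> U4 = N"
    by (auto simp: N_def)
  ultimately have oN: "open N" by simp
  have xN: "x0 \<in> N"
    using V0 U34(4) \<open>0 < \<epsilon>\<close> by (simp add: N_def N0_def s_def g0)
  have uniq: "s y = (X, z)" if "y \<in> N" "norm X < min r1 r3" "norm z < min r1 r3" "sliced x0 l y X z" for y X z
  proof -
    have "X \<in> U1" "z \<in> U3" "y \<in> U4"
      using that(1-3) r1(2) r3(2) by (auto simp: N_def)
    then have w: "(X, z, y) \<in> U" using U12(5) U34(5) by blast
    have "\<Theta> (X, z, y) = (0, 0, y)"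
      using that(4) by (simp add: \<Theta>_def sliced_def)
    then have "g (0, 0, y) = (X, z, y)" using gT(1)[OF w] by simp
    then show ?thesis by (simp add: s_def)
  qed
  show thesis
  proof (rule that[of N s "min r1 r3"])
    show "\<forall>y\<in>N. hol_ext s y" using hols by (simp add: N_def)
    show "\<forall>y\<in>N. sliced x0 l y (fst (s y)) (snd (s y)) \<and> norm (fst (s y)) < \<epsilon> \<and> norm (snd (s y)) < \<epsilon>"
      using sl by (simp add: N_def)
    show "\<forall>y\<in>N. \<forall>X z. norm X < min r1 r3 \<longrightarrow> norm z < min r1 r3 \<longrightarrow> sliced x0 l y X z \<longrightarrow> s y = (X, z)"
      using uniq by blast
  qed (use oN xN r1 r3 in auto)
qed

end

interpretation single: two_sided_action "(**) :: qmat \<Rightarrow> qmat \<Rightarrow> qmat" "(**) :: qmat \<Rightarrow> qmat \<Rightarrow> qmat"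
  by unfold_locales (simp_all add: bounded_bilinear_mmult)

lemma linear_pseudo_inverse:
  fixes f :: "'a::euclidean_space \<Rightarrow> 'b::euclidean_space"
  assumes "linear f"
  obtains l where "linear l" "\<And>x. f (l (f x)) = f x"
  using real_vector.linear_exists_right_inverse_on[OF assms subspace_UNIV] by (metis UNIV_I imageI)

text \<open>If the kernel of the differential of conjugation invariants consists of commutators, the invariants
  separate the conjugacy classes near \<open>D\<close>. With a pseudo-inverse \<open>l\<close> of the commutator map, the gauge
  condition puts \<open>z\<close> into the complement \<open>S\<close> of the commutators, on which the differential is injective,
  hence bounded below. If \<open>D + z\<close> has the same invariants as \<open>D\<close> and \<open>z\<close> is small, then \<open>z = 0\<close>, and so \<open>y\<close> is
  conjugate to \<open>D\<close>.\<close>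

theorem conjugate_if_invariants_agree:
  fixes \<Psi> :: "qmat \<Rightarrow> 'm::euclidean_space"
  assumes \<Psi>': "(\<Psi> has_derivative \<Psi>') (at D)"
    and inv: "\<And>P x y. invertible P \<Longrightarrow> P ** x = y ** P \<Longrightarrow> \<Psi> x = \<Psi> y"
    and ker: "\<And>v. \<Psi>' v = 0 \<Longrightarrow> \<exists>X. v = D ** X - X ** D"
  obtains N where "open N" "D \<in> N" "\<forall>y\<in>N. \<Psi> y = \<Psi> D \<longrightarrow> y \<in> conj_class D"
proof -
  have ad: "single.ad D X = D ** X - X ** D" for X
    by (simp add: single.ad_def)
  obtain l where l: "linear l" "\<And>X. single.ad D (l (single.ad D X)) = single.ad D X"
    using linear_pseudo_inverse[OF single.linear_ad] by blast
  define S where "S = {z. single.ad D (l z) = 0}"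
  have lin: "linear (\<lambda>z. single.ad D (l z))"
    using linear_compose[OF l(1) single.linear_ad] by (simp add: o_def)
  have sub: "subspace S"
    unfolding S_def by (rule linear_subspace_kernel[OF lin])
  have bl: "bounded_linear \<Psi>'" by (rule has_derivative_bounded_linear[OF \<Psi>'])
  have inj: "\<forall>z\<in>S. \<Psi>' z = 0 \<longrightarrow> z = 0"
  proof (intro ballI impI)
    fix z assume "z \<in> S" "\<Psi>' z = 0"
    then obtain X where X: "z = single.ad D X" using ker ad by metis
    then show "z = 0" using \<open>z \<in> S\<close> l(2)[of X] by (simp add: S_def)
  qed
  obtain c where c: "0 < c" "\<forall>z\<in>S. c * norm z \<le> norm (\<Psi>' z)"
    using injective_imp_isometric[OF closed_subspace[OF sub] sub bl inj] by (auto simp: mult.commute)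
  obtain d where d: "0 < d" "\<forall>z. norm z < d \<longrightarrow> norm (\<Psi> (D + z) - \<Psi> D - \<Psi>' z) \<le> (c / 2) * norm z"
  proof -
    have "\<exists>d>0. \<forall>y. norm (y - D) < d \<longrightarrow> norm (\<Psi> y - \<Psi> D - \<Psi>' (y - D)) \<le> (c / 2) * norm (y - D)"
      using \<Psi>' c(1) unfolding has_derivative_at_alt by (meson half_gt_zero)
    then obtain d where "0 < d" "\<forall>y. norm (y - D) < d \<longrightarrow> norm (\<Psi> y - \<Psi> D - \<Psi>' (y - D)) \<le> (c / 2) * norm (y - D)"
      by blast
    then show thesis using that[of d] by (metis add_diff_cancel_left')
  qed
  obtain \<delta> where \<delta>: "0 < \<delta>" "\<forall>X::qmat. norm X < \<delta> \<longrightarrow> invertible (mat 1 + X)"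
    by (rule invertible_near_one)
  obtain N s \<rho> where N: "open N" "D \<in> N"
    "\<forall>y\<in>N. single.sliced D l y (fst (s y)) (snd (s y)) \<and> norm (fst (s y)) < min d \<delta> \<and> norm (snd (s y)) < min d \<delta>"
    using single.local_slice[OF l(1), of "min d \<delta>" D] d(1) \<delta>(1) by (metis min_less_iff_conj)
  have "y \<in> conj_class D" if y: "y \<in> N" "\<Psi> y = \<Psi> D" for y
  proof -
    define X z where "X = fst (s y)" and "z = snd (s y)"
    have h: "y ** (mat 1 + X) = (mat 1 + X) ** (D + z)" "X - l (single.ad D X) + l z = 0"
      "norm X < \<delta>" "norm z < d"
      using N(3) y(1) by (auto simp: single.sliced_def X_def z_def)
    have iX: "invertible (mat 1 + X)" using \<delta> h(3) by blast
    have "single.ad D (X - l (single.ad D X) + l z) = 0"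
      by (simp only: h(2) linear_0[OF single.linear_ad])
    then have zS: "z \<in> S"
      by (simp add: S_def linear_add[OF single.linear_ad] linear_diff[OF single.linear_ad] l(2))
    have "\<Psi> (D + z) = \<Psi> D"
      using inv[OF iX h(1)[symmetric]] y(2) by simp
    then have "norm (\<Psi>' z) \<le> (c / 2) * norm z"
      using d(2) h(4) by force
    then have "c * norm z \<le> (c / 2) * norm z" using c(2) zS by fastforce
    then have "z = 0" using c(1) by (simp add: mult_le_cancel_right)
    then show ?thesis
      unfolding conj_class_iff using iX h(1) by (intro exI[of _ "mat 1 + X"]) simp
  qed
  then show thesis using that[of N] N by blast
qed

section \<open>The invariants cutting out the representation set\<close>

definition traces4 :: "qmat \<Rightarrow> real \<times> real \<times> real \<times> real"
  where "traces4 A = (tau A, tau (A ** A), tau (A ** A ** A), tau (A ** A ** A ** A))"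

definition traces3 :: "qmat \<Rightarrow> real \<times> real \<times> real"
  where "traces3 A = (tau A, tau (A ** A), tau (A ** A ** A))"

definition traces4' :: "qmat \<Rightarrow> qmat \<Rightarrow> real \<times> real \<times> real \<times> real"
  where "traces4' A v = (tau v, 2 * tau (A ** v), 3 * tau (A ** A ** v), 4 * tau (A ** A ** A ** v))"

definition traces3' :: "qmat \<Rightarrow> qmat \<Rightarrow> real \<times> real \<times> real"
  where "traces3' A v = (tau v, 2 * tau (A ** v), 3 * tau (A ** A ** v))"

lemma tau_similar:
  assumes "invertible P" "P ** x = y ** P" shows "tau x = tau y"
proof -
  have "x = matrix_inv P ** (y ** P)"
    using assms by (metis matrix_inv_cancel(2))
  then have "tau x = tau (y ** P ** matrix_inv P)"
    by (simp add: tau_commute[of "matrix_inv P"])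
  then show ?thesis using assms(1) by simp
qed

lemma traces_similar:
  assumes "invertible P" "P ** x = y ** P"
  shows "traces4 x = traces4 y" "traces3 x = traces3 y"
proof -
  note p1 = assms(2)
  note p2 = similar_product[OF p1 p1]
  note p3 = similar_product[OF p2 p1]
  note p4 = similar_product[OF p3 p1]
  show "traces4 x = traces4 y" "traces3 x = traces3 y"
    using tau_similar[OF assms(1)] p1 p2 p3 p4 by (simp_all add: traces4_def traces3_def)
qed

lemma qdet_similar:
  assumes "invertible P" "P ** x = y ** P" shows "qdet x = qdet y"
  using arg_cong[OF assms(2), of qdet] qdet_pos[OF assms(1)] by (simp add: qdet_mult)

lemma tau_has_derivative: "(f has_derivative f') F \<Longrightarrow> ((\<lambda>x. tau (f x)) has_derivative (\<lambda>h. tau (f' h))) F"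
  by (rule bounded_linear.has_derivative[OF linear_conv_bounded_linear[THEN iffD1, OF linear_tau]])

lemma traces_has_derivative:
  "(traces4 has_derivative traces4' A) (at A)" "(traces3 has_derivative traces3' A) (at A)"
proof -
  note d2 = mm.FDERIV[OF has_derivative_ident[of "at A"] has_derivative_ident]
  note d3 = mm.FDERIV[OF d2 has_derivative_ident]
  note d4 = mm.FDERIV[OF d3 has_derivative_ident]
  have c2: "tau (h ** A) = tau (A ** h)" for h
    by (rule tau_commute)
  have c3: "tau (A ** h ** A) = tau (A ** A ** h)" "tau (h ** A ** A) = tau (A ** A ** h)" for h
    using tau_commute[of "A ** h" A] tau_commute[of h "A ** A"] by (simp_all add: matrix_mul_assoc)
  have c4: "tau (A ** A ** h ** A) = tau (A ** A ** A ** h)" "tau (A ** h ** A ** A) = tau (A ** A ** A ** h)"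
     "tau (h ** A ** A ** A) = tau (A ** A ** A ** h)" for h
    using tau_commute[of "A ** A ** h" A] tau_commute[of "A ** h" "A ** A"] tau_commute[of h "A ** A ** A"]
    by (simp_all add: matrix_mul_assoc)
  have 1: "(tau has_derivative tau) (at A)"
    by (rule tau_has_derivative[OF has_derivative_ident])
  have 2: "((\<lambda>A. tau (A ** A)) has_derivative (\<lambda>v. 2 * tau (A ** v))) (at A)"
    by (rule has_derivative_eq_rhs[OF tau_has_derivative[OF d2]]) (simp add: fun_eq_iff c2)
  have 3: "((\<lambda>A. tau (A ** A ** A)) has_derivative (\<lambda>v. 3 * tau (A ** A ** v))) (at A)"
    by (rule has_derivative_eq_rhs[OF tau_has_derivative[OF d3]]) (simp add: fun_eq_iff mm_simps c3)
  have 4: "((\<lambda>A. tau (A ** A ** A ** A)) has_derivative (\<lambda>v. 4 * tau (A ** A ** A ** v))) (at A)"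
    by (rule has_derivative_eq_rhs[OF tau_has_derivative[OF d4]]) (simp add: fun_eq_iff mm_simps c4)
  show "(traces4 has_derivative traces4' A) (at A)" "(traces3 has_derivative traces3' A) (at A)"
    unfolding traces4_def[abs_def] traces4'_def[abs_def] traces3_def[abs_def] traces3'_def[abs_def]
    by (intro has_derivative_Pair 1 2 3 4)+
qed

lemma tau_commutator_zero:
  assumes "M ** D = D ** (M::qmat)" shows "tau (M ** (D ** X - X ** D)) = 0"
proof -
  have "tau (M ** X ** D) = tau (D ** M ** X)"
    using tau_commute[of "M ** X" D] by (simp add: matrix_mul_assoc)
  then show ?thesis by (simp add: mm_simps matrix_mul_assoc assms)
qed

text \<open>Under the trace form, the annihilator of the commutators with \<open>D\<close> is the commutant of \<open>D\<close>.\<close>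

lemma commutator_range:
  fixes D v :: qmat
  assumes "\<And>Y. D ** Y = Y ** D \<Longrightarrow> tau (Y ** v) = 0"
  shows "\<exists>X. v = D ** X - X ** D"
proof -
  have lin: "linear (\<lambda>X::qmat. D ** X - X ** D)"
    by (rule linearI) (simp_all add: mm_simps algebra_simps)
  have "v \<in> range (\<lambda>X::qmat. D ** X - X ** D)"
  proof (rule tau_orthogonal_membership)
    show "subspace (range (\<lambda>X::qmat. D ** X - X ** D))"
      by (rule linear_subspace_image[OF lin]) simp
    fix Y assume Y: "\<And>s. s \<in> range (\<lambda>X::qmat. D ** X - X ** D) \<Longrightarrow> tau (Y ** s) = 0"
    have "tau ((Y ** D - D ** Y) ** X) = 0" for X
    proof -
      have "tau (D ** Y ** X) = tau (Y ** X ** D)"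
        using tau_commute[of D "Y ** X"] by (simp add: matrix_mul_assoc)
      then show ?thesis
        using Y[OF rangeI[of _ X]] by (simp add: mm_simps matrix_mul_assoc)
    qed
    then have "Y ** D - D ** Y = 0" by (rule tau_nondegenerate)
    then show "tau (Y ** v) = 0" using assms by simp
  qed
  then show ?thesis by blast
qed

text \<open>The differentials of the four traces pair \<open>v\<close> with multiples of 1, \<open>A\<close>, \<open>A\<^sup>2\<close>, \<open>A\<^sup>3\<close>, which
  span the commutant of \<open>A\<close>.\<close>

lemma cyclic_conjugate_traces4:
  assumes "cyclic A"
  obtains N where "open N" "A \<in> N" "\<forall>y\<in>N. traces4 y = traces4 A \<longrightarrow> y \<in> conj_class A"
proof (rule conjugate_if_invariants_agree[OF traces_has_derivative(1)[of A]])
  show "\<exists>X. v = A ** X - X ** A" if v: "traces4' A v = 0" for v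
  proof (rule commutator_range)
    fix Y assume "A ** Y = Y ** A"
    then obtain p q r s where "Y = cubic p q r s A"
      using assms unfolding cyclic_def by blast
    then show "tau (Y ** v) = 0"
      using v by (simp add: cubic_def traces4'_def mm_simps zero_prod_def)
  qed
qed (use traces_similar that in blast)+

text \<open>In \<^const>\<open>SL2H\<close> the determinant replaces the fourth trace. Its differential pairs \<open>v\<close> with \<open>D\<inverse>\<close>, and
  \<open>D\<inverse>\<close>, 1, \<open>D\<close>, \<open>D\<^sup>2\<close> span the commutant of \<open>D\<close> as well.\<close>

lemma cyclic_conjugate_traces3:
  assumes "cyclic D" "D \<in> SL2H"
  obtains N where "open N" "D \<in> N" "\<forall>y\<in>N. y \<in> SL2H \<longrightarrow> traces3 y = traces3 D \<longrightarrow> y \<in> conj_class D"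
proof -
  have iD: "invertible D" using assms(2) by (rule SL2H_invertible)
  have deriv: "((\<lambda>y. (traces3 y, qdet y)) has_derivative
      (\<lambda>v. (traces3' D v, qdet D * (2 * tau (matrix_inv D ** v))))) (at D)"
    by (intro has_derivative_Pair traces_has_derivative qdet_has_derivative iD)
  obtain N where N: "open N" "D \<in> N" "\<forall>y\<in>N. (traces3 y, qdet y) = (traces3 D, qdet D) \<longrightarrow> y \<in> conj_class D"
  proof (rule conjugate_if_invariants_agree[OF deriv])
    show "\<exists>X. v = D ** X - X ** D" if v: "(traces3' D v, qdet D * (2 * tau (matrix_inv D ** v))) = 0" for v
    proof (rule commutator_range)
      fix Y assume Y: "D ** Y = Y ** D"
      have "D ** (D ** Y) = (D ** Y) ** D" by (simp add: Y matrix_mul_assoc)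
      then obtain p q r s where "D ** Y = cubic p q r s D"
        using assms unfolding cyclic_def by blast
      then have "matrix_inv D ** (D ** Y) = matrix_inv D ** cubic p q r s D" by simp
      then have "Y = p *\<^sub>R matrix_inv D + q *\<^sub>R mat 1 + r *\<^sub>R D + s *\<^sub>R (D ** D)"
        using iD by (simp add: cubic_def mm_simps matrix_inv_works flip: matrix_mul_assoc)
      moreover have "tau (matrix_inv D ** v) = 0" "tau v = 0" "tau (D ** v) = 0" "tau (D ** D ** v) = 0"
        using v qdet_pos[OF iD] by (auto simp: traces3'_def zero_prod_def)
      ultimately show "tau (Y ** v) = 0"
        by (simp add: mm_simps)
    qed
    show "(traces3 x, qdet x) = (traces3 y, qdet y)" if "invertible P" "P ** x = y ** P" for P x y
      using traces_similar(2)[OF that] qdet_similar[OF that] by simp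
  qed (use that in blast)
  then show thesis using that[of N] assms(2) by (auto simp: SL2H_iff)
qed

type_synonym invariants = "(real \<times> real \<times> real \<times> real) \<times> (real \<times> real \<times> real \<times> real) \<times> (real \<times> real \<times> real)"

text \<open>The determinants of the factors are functions of their traces and determine that of the product,
  so a fourth trace of the product would depend on the eleven numbers listed here.\<close>

definition invariants :: "qmat \<times> qmat \<Rightarrow> invariants"
  where "invariants y = (traces4 (fst y), traces4 (snd y), traces3 (fst y ** snd y))"

definition invariants' :: "qmat \<times> qmat \<Rightarrow> qmat \<times> qmat \<Rightarrow> invariants"
  where "invariants' x v = (traces4' (fst x) (fst v), traces4' (snd x) (snd v),
    traces3' (fst x ** snd x) (fst x ** snd v + fst v ** snd x))"

lemma invariants_has_derivative: "(invariants has_derivative invariants' x) (at x)"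
proof -
  have 3: "((\<lambda>y. traces3 (fst y ** snd y)) has_derivative (\<lambda>v. traces3' (fst x ** snd x) (fst x ** snd v + fst v ** snd x))) (at x)"
    by (rule has_derivative_compose[OF mm.FDERIV[OF has_derivative_fst[OF has_derivative_ident]
        has_derivative_snd[OF has_derivative_ident]]]) (simp add: traces_has_derivative)
  show ?thesis
    unfolding invariants_def[abs_def] invariants'_def[abs_def]
    by (intro has_derivative_Pair has_derivative_compose[OF has_derivative_fst[OF has_derivative_ident] traces_has_derivative(1)]
        has_derivative_compose[OF has_derivative_snd[OF has_derivative_ident] traces_has_derivative(1)] 3)
qed

lemma linear_invariants': "linear (invariants' x)"
  using has_derivative_bounded_linear[OF invariants_has_derivative] by (simp add: linear_conv_bounded_linear)

lemma entire_ext_invariants: "entire_ext invariants"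
  unfolding invariants_def[abs_def] traces4_def traces3_def
  by (intro entire_ext_intros entire_ext_linear_compose[OF linear_tau])

lemma rep_set_level_set:
  assumes AB: "A \<in> SL2H" "B \<in> SL2H" and C: "C = matrix_inv (A ** B)"
    and cyc: "cyclic A" "cyclic B" "cyclic (A ** B)"
  obtains N where "open N" "(A, B) \<in> N"
    "\<forall>y\<in>N. y \<in> rep_set A B C \<longleftrightarrow> invariants y = invariants (A, B)"
proof -
  obtain N1 where N1: "open N1" "A \<in> N1" "\<forall>y\<in>N1. traces4 y = traces4 A \<longrightarrow> y \<in> conj_class A"
    by (rule cyclic_conjugate_traces4[OF cyc(1)])
  obtain N2 where N2: "open N2" "B \<in> N2" "\<forall>y\<in>N2. traces4 y = traces4 B \<longrightarrow> y \<in> conj_class B"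
    by (rule cyclic_conjugate_traces4[OF cyc(2)])
  obtain N3 where N3: "open N3" "A ** B \<in> N3" "\<forall>y\<in>N3. y \<in> SL2H \<longrightarrow> traces3 y = traces3 (A ** B) \<longrightarrow> y \<in> conj_class (A ** B)"
    by (rule cyclic_conjugate_traces3[OF cyc(3) SL2H_mult[OF AB]])
  define N where "N = (N1 \<times> N2) \<inter> (\<lambda>y. fst y ** snd y) -` N3"
  have "continuous_on UNIV (\<lambda>y::qmat \<times> qmat. fst y ** snd y)"
    by (intro mm.continuous_on continuous_on_fst continuous_on_snd continuous_on_id)
  from open_vimage[OF N3(1) this] have oN: "open N"
    unfolding N_def by (intro open_Int open_Times N1(1) N2(1))
  have "y \<in> rep_set A B C \<longleftrightarrow> invariants y = invariants (A, B)" if y: "y \<in> N" for y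
  proof
    assume "y \<in> rep_set A B C"
    then have "fst y \<in> conj_class A" "snd y \<in> conj_class B" "fst y ** snd y \<in> conj_class (A ** B)"
      by (simp_all add: rep_set_iff[OF AB C])
    then show "invariants y = invariants (A, B)"
      unfolding conj_class_iff by (auto simp: invariants_def dest: traces_similar)
  next
    assume e: "invariants y = invariants (A, B)"
    have 1: "fst y \<in> conj_class A" "snd y \<in> conj_class B"
      using y e N1(3) N2(3) by (auto simp: N_def invariants_def)
    then have "fst y ** snd y \<in> SL2H"
      using subsetD[OF conj_class_SL2H[OF AB(1)]] subsetD[OF conj_class_SL2H[OF AB(2)]] SL2H_mult by blast
    then have "fst y ** snd y \<in> conj_class (A ** B)"
      using y e N3(3) by (auto simp: N_def invariants_def)
    with 1 show "y \<in> rep_set A B C"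
      by (simp add: rep_set_iff[OF AB C])
  qed
  then show thesis using that[of N] oN N1 N2 N3 by (auto simp: N_def)
qed

text \<open>A linear relation between the differentials consists of polynomials \<open>p\<close>, \<open>q\<close>, \<open>n\<close> in \<open>A\<close>, \<open>B\<close>,
  \<open>A ** B\<close> with \<open>p + B n = 0\<close> and \<open>q + n A = 0\<close>. Since \<open>p\<close> and \<open>q\<close> annihilate the commutators with \<open>A\<close> and
  \<open>B\<close>, the matrix \<open>n\<close> annihilates the image of the differential of the multiplication map, so \<open>A B n\<close> is
  scalar. As a cubic polynomial in \<open>A ** B\<close> with vanishing constant term, it can only be scalar if all its
  coefficients vanish. Then \<open>p\<close> and \<open>q\<close> vanish, and with them their coefficients.\<close>

lemma invariants'_surjective:
  assumes cyc: "cyclic A" "cyclic B" "cyclic (A ** B)"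
    and cent: "\<And>M. A ** M = M ** A \<Longrightarrow> B ** M = M ** B \<Longrightarrow> M = (tau M / 2) *\<^sub>R mat 1"
  shows "surj (invariants' (A, B))"
proof -
  have "c = 0" if c: "\<And>v. inner (invariants' (A, B) v) c = 0" for c
  proof -
    obtain a0 a1 a2 a3 b0 b1 b2 b3 d0 d1 d2 where
      c_eq: "c = ((a0, a1, a2, a3), (b0, b1, b2, b3), (d0, d1, d2))"
      by (cases c) (metis prod.exhaust)
    define p q n where "p = cubic a0 (2 * a1) (3 * a2) (4 * a3) A"
      and "q = cubic b0 (2 * b1) (3 * b2) (4 * b3) B" and "n = cubic d0 (2 * d1) (3 * d2) 0 (A ** B)"
    have tr4: "inner (traces4' M v) (e0, e1, e2, e3) = tau (cubic e0 (2 * e1) (3 * e2) (4 * e3) M ** v)" for M v e0 e1 e2 e3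
      by (simp add: traces4'_def cubic_def mm_simps)
    have tr3: "inner (traces3' M v) (e0, e1, e2) = tau (cubic e0 (2 * e1) (3 * e2) 0 M ** v)" for M v e0 e1 e2
      by (simp add: traces3'_def cubic_def mm_simps)
    have pair: "tau (p ** u) + tau (q ** w) + tau (n ** (A ** w + u ** B)) = 0" for u w
      using c[of "(u, w)"] unfolding c_eq
      by (simp add: invariants'_def inner_Pair tr4 tr3 p_def q_def n_def del: inner_prod_def)
    have "tau ((p + B ** n) ** u) = 0" for u
    proof -
      have "tau (n ** u ** B) = tau (B ** n ** u)"
        using tau_commute[of "n ** u" B] by (simp add: matrix_mul_assoc)
      then show ?thesis using pair[of u 0] by (simp add: mm_simps matrix_mul_assoc)
    qed
    then have p: "p + B ** n = 0" by (rule tau_nondegenerate)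
    have "tau ((q + n ** A) ** w) = 0" for w
      using pair[of 0 w] by (simp add: mm_simps matrix_mul_assoc)
    then have q: "q + n ** A = 0" by (rule tau_nondegenerate)
    have Ap: "A ** p = p ** A" and Bq: "B ** q = q ** B"
      by (simp_all add: p_def q_def cubic_def mm_simps matrix_mul_assoc)
    have comm: "tau (p ** (X ** A - A ** X)) = 0" "tau (q ** (Y ** B - B ** Y)) = 0" for X Y
      using tau_commutator_zero[OF Ap[symmetric], of X] tau_commutator_zero[OF Bq[symmetric], of Y]
      by (simp_all add: mm_simps)
    have "tau (n ** ((X ** A - A ** X) ** B + A ** (Y ** B - B ** Y))) = 0" for X Y
      using pair[of "X ** A - A ** X" "Y ** B - B ** Y"] by (simp add: comm add.commute)
    from double_commutator_orthogonal[OF cent this] obtain \<mu> where \<mu>: "A ** B ** n = \<mu> *\<^sub>R mat 1"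
      by blast
    have "cubic (- \<mu>) d0 (2 * d1) (3 * d2) (A ** B) = A ** B ** n - \<mu> *\<^sub>R mat 1"
      by (simp add: n_def cubic_def mm_simps matrix_mul_assoc)
    then have "cubic (- \<mu>) d0 (2 * d1) (3 * d2) (A ** B) = 0" using \<mu> by simp
    then have d: "d0 = 0" "2 * d1 = 0" "3 * d2 = 0"
      using cyc(3) unfolding cyclic_def by blast+
    then have "n = 0" by (simp add: n_def cubic_def)
    then have "p = 0" "q = 0" using p q by simp_all
    then have "a0 = 0 \<and> 2 * a1 = 0 \<and> 3 * a2 = 0 \<and> 4 * a3 = 0" "b0 = 0 \<and> 2 * b1 = 0 \<and> 3 * b2 = 0 \<and> 4 * b3 = 0"
      using cyc(1,2) unfolding cyclic_def p_def q_def by blast+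
    with d show "c = 0" by (simp add: c_eq zero_prod_def)
  qed
  then have "adjoint (invariants' (A, B)) c = 0 \<Longrightarrow> c = 0" for c
    using adjoint_works[OF linear_invariants', of _ "(A, B)" c] by (metis inner_zero_right)
  then have "inj (adjoint (invariants' (A, B)))"
    by (simp add: linear_injective_0[OF adjoint_linear[OF linear_invariants']])
  then show ?thesis
    by (simp add: linear_invariants')
qed

text \<open>The Moore-Penrose inverse of a surjection.\<close>

lemma surjective_adjoint_right_inverse:
  fixes f :: "'a::euclidean_space \<Rightarrow> 'b::euclidean_space"
  assumes "linear f" "surj f"
  obtains r where "linear r" "\<And>c. f (r c) = c" "\<And>c v. f v = 0 \<Longrightarrow> inner v (r c) = 0"
proof -
  have la: "linear (adjoint f)" by (rule adjoint_linear[OF assms(1)])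
  have lin: "linear (\<lambda>c. f (adjoint f c))"
    using linear_compose[OF la assms(1)] by (simp add: o_def)
  have "c = 0" if "f (adjoint f c) = 0" for c
  proof -
    have "inner (adjoint f c) (adjoint f c) = inner (f (adjoint f c)) c"
      by (rule adjoint_works[OF assms(1)])
    then have "adjoint f c = 0" using that by simp
    moreover have "inj (adjoint f)" using assms by simp
    ultimately show ?thesis
      using linear_injective_0[OF la] by blast
  qed
  then have "inj (\<lambda>c. f (adjoint f c))"
    by (simp add: linear_injective_0[OF lin])
  then obtain k where k: "linear k" "\<forall>c. f (adjoint f (k c)) = c"
    using linear_injective_isomorphism[OF lin] by blast
  show thesis
  proof
    show "linear (\<lambda>c. adjoint f (k c))"
      using linear_compose[OF k(1) la] by (simp add: o_def)
    show "f (adjoint f (k c)) = c" for c using k by blast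
    show "inner v (adjoint f (k c)) = 0" if "f v = 0" for c v
      using that by (simp add: adjoint_works[OF assms(1)])
  qed
qed

text \<open>Adding \<open>r\<close> applied to the Taylor remainder of \<open>\<Phi>\<close> to the displacement \<open>y - x0\<close> makes
  \<open>\<Phi>' \<circ> f\<close> equal to \<open>\<Phi> - \<Phi> x0\<close>, so \<open>f\<close> takes the level set through \<open>x0\<close> to the kernel of \<open>\<Phi>'\<close>. The
  correction is orthogonal to this kernel; inner products with vectors of the kernel, such as the
  orbit directions, are therefore unchanged by \<open>f\<close>.\<close>

lemma straightening_chart:
  fixes \<Phi> :: "'a::euclidean_space \<Rightarrow> 'b::euclidean_space"
  assumes ent: "entire_ext \<Phi>" and \<Phi>': "(\<Phi> has_derivative \<Phi>') (at x0)" and surj: "surj \<Phi>'"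
    and N: "open N" "x0 \<in> N"
  obtains f r U V g where "f = (\<lambda>y. (y - x0) + r (\<Phi> y - \<Phi> x0 - \<Phi>' (y - x0)))"
    "linear r" "\<forall>c v. \<Phi>' v = 0 \<longrightarrow> inner v (r c) = 0"
    "\<forall>y. \<Phi>' (f y) = \<Phi> y - \<Phi> x0" "entire_ext f"
    "open U" "open V" "x0 \<in> U" "U \<subseteq> N" "homeomorphism U V f g" "\<forall>y\<in>V. hol_ext g y"
proof -
  have lin: "linear \<Phi>'" using has_derivative_bounded_linear[OF \<Phi>'] by (simp add: linear_conv_bounded_linear)
  obtain r where r: "linear r" "\<And>c. \<Phi>' (r c) = c" "\<And>c v. \<Phi>' v = 0 \<Longrightarrow> inner v (r c) = 0"
    using surjective_adjoint_right_inverse[OF lin surj] by blast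
  define f where "f = (\<lambda>y. (y - x0) + r (\<Phi> y - \<Phi> x0 - \<Phi>' (y - x0)))"
  have entf: "entire_ext f"
    unfolding f_def by (intro entire_ext_intros entire_ext_linear_compose[OF r(1)] entire_ext_linear_compose[OF lin] ent)
  have br: "bounded_linear r" "bounded_linear \<Phi>'"
    using r(1) lin by (simp_all add: linear_conv_bounded_linear)
  have "(f has_derivative (\<lambda>h. (h - 0) + r (\<Phi>' h - 0 - \<Phi>' (h - 0)))) (at x0)"
    unfolding f_def
    by (intro has_derivative_add has_derivative_diff has_derivative_ident has_derivative_const \<Phi>'
        bounded_linear.has_derivative[OF br(1)] bounded_linear.has_derivative[OF br(2)])
  then have deriv: "(f has_derivative (\<lambda>h. h)) (at x0)"
    by (simp add: linear_0[OF r(1)])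
  have f\<Phi>: "\<Phi>' (f y) = \<Phi> y - \<Phi> x0" for y
    by (simp add: f_def linear_add[OF lin] r(2))
  obtain U V g where h: "open U" "open V" "x0 \<in> U" "U \<subseteq> N" "homeomorphism U V f g" "\<forall>y\<in>V. hol_ext g y"
    using entire_ext_inverse_function_within[OF entf deriv _ N] by (metis inj_on_id2)
  show thesis
    by (rule that[of f r U V g]) (use f_def r f\<Phi> entf h in auto)
qed

lemma rank_nullity:
  fixes f :: "'a::euclidean_space \<Rightarrow> 'b::euclidean_space"
  assumes "linear f"
  shows "dim {x. f x = 0} + dim (range f) = DIM('a)"
proof -
  define K where "K = {x. f x = 0}"
  define K' where "K' = {y \<in> UNIV. \<forall>x\<in>K. orthogonal x y}"
  have subK: "subspace K" unfolding K_def by (rule real_vector.linear_subspace_kernel[OF assms])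
  have subK': "subspace K'"
    unfolding K'_def subspace_def by (auto simp: orthogonal_clauses)
  have "dim K' + dim K = dim (UNIV :: 'a set)"
    unfolding K'_def by (rule dim_subspace_orthogonal_to_vectors[OF subK subspace_UNIV subset_UNIV])
  moreover have "f ` K' = range f"
  proof (intro equalityI subsetI)
    fix y assume "y \<in> range f"
    then obtain x where x: "y = f x" by blast
    obtain k k' where k: "k \<in> span K" "\<And>w. w \<in> span K \<Longrightarrow> orthogonal k' w" "x = k + k'"
      using orthogonal_subspace_decomp_exists[of K x] by blast
    have sp: "span K = K" using subK by (simp add: span_eq_iff)
    have "k' \<in> K'" using k(2) by (auto simp: K'_def sp orthogonal_commute)
    moreover have "f k' = y"
      using k(1) by (simp add: x k(3) sp linear_add[OF assms]) (simp add: K_def)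
    ultimately show "y \<in> f ` K'" by blast
  qed auto
  moreover have "dim (f ` K') = dim K'"
  proof (rule dim_image_eq[OF assms])
    have "inj_on f K'"
    proof (rule inj_onI)
      fix x y assume xy: "x \<in> K'" "y \<in> K'" "f x = f y"
      have "x - y \<in> K'" by (rule subspace_diff[OF subK' xy(1,2)])
      moreover have "x - y \<in> K" using xy(3) by (simp add: K_def linear_diff[OF assms])
      ultimately have "orthogonal (x - y) (x - y)" by (simp add: K'_def)
      then show "x = y" by (simp add: orthogonal_def)
    qed
    then show "inj_on f (span K')" using subK' by (simp add: span_eq_iff[THEN iffD2])
  qed
  ultimately show ?thesis by (simp add: K_def)
qed

text \<open>Near \<open>(A, B)\<close> the set is a level set of eleven functions with independent differentials on a space
  of dimension 32.\<close>

theorem rep_set_submanifold: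
  assumes AB: "A \<in> SL2H" "B \<in> SL2H" and C: "C = matrix_inv (A ** B)"
    and cyc: "cyclic A" "cyclic B" "cyclic (A ** B)"
    and cent: "\<And>M. A ** M = M ** A \<Longrightarrow> B ** M = M ** B \<Longrightarrow> M = (tau M / 2) *\<^sub>R mat 1"
  shows "\<exists>W. open W \<and> (A, B) \<in> W \<and> analytic_submanifold 21 (rep_set A B C \<inter> W)"
proof -
  obtain N where N: "open N" "(A, B) \<in> N" "\<forall>y\<in>N. y \<in> rep_set A B C \<longleftrightarrow> invariants y = invariants (A, B)"
    by (rule rep_set_level_set[OF AB C cyc])
  have surj: "surj (invariants' (A, B))"
    by (rule invariants'_surjective[OF cyc cent])
  obtain f r U V g where "f = (\<lambda>y. (y - (A, B)) + r (invariants y - invariants (A, B) - invariants' (A, B) (y - (A, B))))"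
    "linear r" "\<forall>c v. invariants' (A, B) v = 0 \<longrightarrow> inner v (r c) = 0"
    and h: "\<forall>y. invariants' (A, B) (f y) = invariants y - invariants (A, B)" "entire_ext f"
    "open U" "open V" "(A, B) \<in> U" "U \<subseteq> N" "homeomorphism U V f g" "\<forall>y\<in>V. hol_ext g y"
    by (rule straightening_chart[OF entire_ext_invariants invariants_has_derivative surj N(1,2)])
  define L where "L = {v. invariants' (A, B) v = 0}"
  have subL: "subspace L" unfolding L_def by (rule linear_subspace_kernel[OF linear_invariants'])
  have dimL: "dim L = 21"
    using rank_nullity[OF linear_invariants'[of "(A, B)"]] surj by (simp add: L_def DIM_quat)
  have "analytic_diffeo f U V"
    by (rule analytic_diffeoI[OF h(3,4,7)]) (use h(2,8) entire_ext_imp_hol_ext in blast)+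
  moreover have "f ` (rep_set A B C \<inter> U \<inter> U) = L \<inter> V"
  proof -
    have "y \<in> rep_set A B C \<longleftrightarrow> f y \<in> L" if "y \<in> U" for y
    proof -
      have "invariants' (A, B) (f y) = invariants y - invariants (A, B)" using h(1) by blast
      then show ?thesis using that h(6) N(3) by (auto simp: L_def)
    qed
    moreover have "f ` U = V" using h(7) by (simp add: homeomorphism_def)
    ultimately show ?thesis by blast
  qed
  ultimately have "analytic_submanifold 21 (rep_set A B C \<inter> U)"
    unfolding analytic_submanifold_def using subL dimL by blast
  then show ?thesis using h(3,5) by blast
qed

section \<open>The orbit space near a pair with trivial commutant\<close>

definition plm :: "qmat \<Rightarrow> qmat \<times> qmat \<Rightarrow> qmat \<times> qmat"
  where "plm P w = (P ** fst w, P ** snd w)"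

definition prm :: "qmat \<times> qmat \<Rightarrow> qmat \<Rightarrow> qmat \<times> qmat"
  where "prm w P = (fst w ** P, snd w ** P)"

interpretation pair: two_sided_action plm prm
proof (rule two_sided_action.intro)
  have "bilinear plm" "bilinear prm"
    by (auto simp: bilinear_def plm_def prm_def mm_simps prod_eq_iff intro!: linearI)
  then show "bounded_bilinear plm" "bounded_bilinear prm"
    by (simp_all add: bilinear_conv_bounded_bilinear)
qed (simp_all add: plm_def prm_def)

lemma pair_similar_iff: "plm P x = prm y P \<longleftrightarrow> P ** fst x = fst y ** P \<and> P ** snd x = snd y ** P"
  by (auto simp: plm_def prm_def)

lemma conj_orbit_pair_iff: "y \<in> conj_orbit x \<longleftrightarrow> (\<exists>P. invertible P \<and> plm P x = prm y P)"
  by (simp add: conj_orbit_iff pair_similar_iff)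

lemma conj_class_similar:
  assumes "invertible P" "P ** x = y ** P" "x \<in> conj_class A" shows "y \<in> conj_class A"
proof -
  obtain Q where Q: "invertible Q" "Q ** A = x ** Q"
    using assms(3) unfolding conj_class_iff by blast
  show ?thesis
    unfolding conj_class_iff
    using similar_transitive[OF Q(2) assms(2)] invertible_mult[OF assms(1) Q(1)] by blast
qed

lemma rep_set_similar:
  assumes "A \<in> SL2H" "B \<in> SL2H" "C = matrix_inv (A ** B)"
    and "invertible P" "plm P x = prm y P" "x \<in> rep_set A B C"
  shows "y \<in> rep_set A B C"
  using assms(5,6) conj_class_similar[OF assms(4)] similar_product
  unfolding rep_set_iff[OF assms(1-3)] pair_similar_iff by metis

text \<open>Conjugation with a fixed matrix, as a linear automorphism of the space of all pairs; it moves the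
  local constructions at \<open>(A, B)\<close> along the orbits.\<close>

definition pconj :: "qmat \<Rightarrow> qmat \<times> qmat \<Rightarrow> qmat \<times> qmat"
  where "pconj P w = (conj_mat P (fst w), conj_mat P (snd w))"

lemma linear_pconj: "linear (pconj P)"
  by (rule linearI) (simp_all add: pconj_def conj_mat_def mm_simps)

lemma pconj_similar: "invertible P \<Longrightarrow> plm P w = prm (pconj P w) P"
  by (simp add: pair_similar_iff pconj_def flip: conj_mat_eq_iff)

lemma pconj_eq_iff: "invertible P \<Longrightarrow> pconj P w = y \<longleftrightarrow> plm P w = prm y P"
  unfolding pair_similar_iff pconj_def by (cases y) (auto simp: conj_mat_eq_iff)

lemma pconj_inverse:
  assumes "invertible P" shows "pconj (matrix_inv P) (pconj P w) = w" "pconj P (pconj (matrix_inv P) w) = w"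
proof -
  have inv2: "matrix_inv (matrix_inv P) = P"
    by (intro matrix_inv_eqI matrix_inv_works assms)
  show "pconj (matrix_inv P) (pconj P w) = w" "pconj P (pconj (matrix_inv P) w) = w"
    using assms by (simp_all add: pconj_def conj_mat_def inv2 matrix_mul_assoc matrix_inv_works)
qed

lemma conj_orbit_pconj: "invertible P \<Longrightarrow> conj_orbit (pconj P w) = conj_orbit w"
proof -
  assume "invertible P"
  then have "pconj P w \<in> conj_orbit w"
    unfolding conj_orbit_pair_iff using pconj_similar by blast
  then show ?thesis using conj_orbit_eq_iff by blast
qed

lemma conj_orbit_eq_obtains:
  assumes "conj_orbit x = conj_orbit y"
  obtains P where "invertible P" "y = pconj P x"
proof -
  have "y \<in> conj_orbit x" using assms conj_orbit_eq_iff by blast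
  then obtain P where P: "invertible P" "plm P x = prm y P"
    unfolding conj_orbit_pair_iff by blast
  then show thesis using that[of P] pconj_eq_iff by metis
qed

lemma openin_rep_quotient:
  "openin (rep_quotient A B C) S \<longleftrightarrow>
    S \<subseteq> conj_orbit ` rep_set A B C \<and> openin (top_of_set (rep_set A B C)) {x \<in> rep_set A B C. conj_orbit x \<in> S}"
  by (simp add: rep_quotient_def openin_quotient_topology)

lemma pair_ad: "pair.ad (A, B) X = (A ** X - X ** A, B ** X - X ** B)"
  by (simp add: pair.ad_def plm_def prm_def)

locale schur_pair =
  fixes A B C :: qmat
  assumes SL: "A \<in> SL2H" "B \<in> SL2H" and C_eq: "C = matrix_inv (A ** B)"
    and cyc: "cyclic A" "cyclic B" "cyclic (A ** B)"
    and cent: "\<And>M. A ** M = M ** A \<Longrightarrow> B ** M = M ** B \<Longrightarrow> M = (tau M / 2) *\<^sub>R mat 1"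
begin

abbreviation "R \<equiv> rep_set A B C"
abbreviation "x0 \<equiv> (A, B)"
abbreviation "adx \<equiv> pair.ad x0"

lemma adx_eq_0_iff: "adx X = 0 \<longleftrightarrow> X = (tau X / 2) *\<^sub>R mat 1"
proof
  assume "adx X = 0"
  then show "X = (tau X / 2) *\<^sub>R mat 1"
    by (intro cent) (simp_all add: pair_ad zero_prod_def)
next
  assume X: "X = (tau X / 2) *\<^sub>R mat 1"
  show "adx X = 0"
    by (subst X) (simp add: pair_ad mm_simps zero_prod_def)
qed

lemma dim_orbit_directions: "dim (range adx) = 15"
proof -
  have "{X. adx X = 0} = span {mat 1}"
  proof (intro equalityI subsetI)
    fix X assume "X \<in> {X. adx X = 0}"
    then have "X = (tau X / 2) *\<^sub>R mat 1" by (simp add: adx_eq_0_iff)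
    then show "X \<in> span {mat 1}" by (metis span_base span_scale singletonI)
  next
    fix X assume "X \<in> span {mat 1 :: qmat}"
    then obtain k where "X = k *\<^sub>R mat 1" by (auto simp: span_singleton)
    then show "X \<in> {X. adx X = 0}" by (simp add: adx_eq_0_iff)
  qed
  moreover have "dim (span {mat 1 :: qmat}) = 1"
    by (simp add: qmat_eq_iff)
  ultimately show ?thesis
    using rank_nullity[OF pair.linear_ad[of x0]] by (simp add: DIM_quat)
qed

text \<open>The orbit directions are tangent to the level sets of the invariants.\<close>

lemma invariants'_adx: "invariants' x0 (adx X) = 0"
proof -
  have t: "traces4' D (D ** X - X ** D) = 0" "traces3' D (D ** X - X ** D) = 0" for D
    using tau_commutator_zero[of "mat 1" D X] tau_commutator_zero[of D D X]
      tau_commutator_zero[of "D ** D" D X] tau_commutator_zero[of "D ** D ** D" D X]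
    by (simp_all add: traces4'_def traces3'_def zero_prod_def matrix_mul_assoc)
  have "A ** (B ** X - X ** B) + (A ** X - X ** A) ** B = (A ** B) ** X - X ** (A ** B)"
    by (simp add: mm_simps matrix_mul_assoc)
  then show ?thesis
    by (simp add: invariants'_def pair_ad t zero_prod_def)
qed

text \<open>The trace-free matrices are a complement of the infinitesimal stabilizer, on which the map \<open>adx\<close>
  is injective. Its Moore-Penrose inverse \<open>l\<close> recovers the trace-free part of \<open>X\<close> from \<open>adx X\<close> and has
  as kernel the orthogonal complement of the orbit directions. As the values of \<open>l\<close> have trace zero, the
  gauge condition of a local slice for this \<open>l\<close> says that \<open>X\<close> has trace zero and that \<open>z\<close> is orthogonal
  to the orbit.\<close>

lemma slice_projection:
  obtains l where "linear l" "\<And>X. l (adx X) = X - (tau X / 2) *\<^sub>R mat 1"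
    "\<And>w. (\<And>X. inner (adx X) w = 0) \<Longrightarrow> l w = 0" "\<And>w. tau (l w) = 0"
    "\<And>w X. l w = 0 \<Longrightarrow> inner (adx X) w = 0"
proof -
  define m where "m = adjoint adx"
  have m: "linear m" "inner X (m w) = inner (adx X) w" for X w
    unfolding m_def by (rule adjoint_linear[OF pair.linear_ad], rule adjoint_works[OF pair.linear_ad])
  define S where "S = {X::qmat. tau X = 0}"
  have S: "subspace S"
    unfolding S_def by (rule real_vector.linear_subspace_kernel[OF linear_tau])
  have lin: "linear (\<lambda>X. m (adx X))"
    using linear_compose[OF pair.linear_ad m(1)] by (simp add: o_def)
  have inj: "inj_on (\<lambda>X. m (adx X)) S"
  proof (rule inj_onI)
    fix X Y assume XY: "X \<in> S" "Y \<in> S" "m (adx X) = m (adx Y)"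
    have "m (adx (X - Y)) = 0"
      using XY(3) by (simp add: linear_diff[OF lin])
    then have "inner (adx (X - Y)) (adx (X - Y)) = 0"
      using m(2)[of "X - Y" "adx (X - Y)"] by simp
    then have "X - Y = (tau (X - Y) / 2) *\<^sub>R mat 1"
      by (simp add: adx_eq_0_iff)
    then show "X = Y" using XY(1,2) by (simp add: S_def)
  qed
  obtain k where k: "range k \<subseteq> S" "linear k" "\<forall>v\<in>S. k (m (adx v)) = v"
    using real_vector.linear_exists_left_inverse_on[OF lin S inj] by auto
  have adx_trace_free: "adx (X - (tau X / 2) *\<^sub>R mat 1) = adx X" for X
  proof -
    have "adx ((tau X / 2) *\<^sub>R mat 1) = 0" by (simp add: adx_eq_0_iff)
    then show ?thesis by (simp add: linear_diff[OF pair.linear_ad])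
  qed
  have k_adx: "k (m (adx X)) = X - (tau X / 2) *\<^sub>R mat 1" for X
  proof -
    have "X - (tau X / 2) *\<^sub>R mat 1 \<in> S" by (simp add: S_def)
    then show ?thesis using k(3) adx_trace_free by metis
  qed
  show thesis
  proof
    show "linear (\<lambda>w. k (m w))"
      using linear_compose[OF m(1) k(2)] by (simp add: o_def)
    show "k (m (adx X)) = X - (tau X / 2) *\<^sub>R mat 1" for X by (rule k_adx)
    show "k (m w) = 0" if "\<And>X. inner (adx X) w = 0" for w
    proof -
      have "inner (m w) (m w) = 0" using that m(2) by simp
      then show ?thesis by (simp add: linear_0[OF k(2)])
    qed
    show "tau (k (m w)) = 0" for w
      using k(1) by (auto simp: S_def)
    show "inner (adx X) w = 0" if w: "k (m w) = 0" for w X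
    proof -
      have sub: "subspace (range adx)"
        by (rule linear_subspace_image[OF pair.linear_ad]) simp
      obtain y z where yz: "y \<in> span (range adx)" "\<And>v. v \<in> span (range adx) \<Longrightarrow> orthogonal z v" "w = y + z"
        using orthogonal_subspace_decomp_exists[of "range adx" w] by blast
      have sp: "span (range adx) = range adx" using sub by (simp add: span_eq_iff)
      obtain Y where Y: "y = adx Y" using yz(1) sp by auto
      have z: "inner (adx X) z = 0" for X
        using yz(2)[of "adx X"] sp by (simp add: orthogonal_def inner_commute)
      have "inner (m z) (m z) = 0" using z m(2) by simp
      then have "m z = 0" by simp
      then have "k (m y) = 0"
        using w by (simp add: yz(3) linear_add[OF m(1)])
      then have "adx Y = 0" by (simp add: Y k_adx adx_eq_0_iff)
      then show ?thesis using z by (simp add: yz(3) Y)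
    qed
  qed
qed

text \<open>Schur's lemma with an error term: a matrix conjugating one pair near \<open>(A, B)\<close> to another nearly
  commutes with \<open>A\<close> and \<open>B\<close>, and its trace-free part is bounded by these commutators. So it is nearly
  scalar, although it may be arbitrarily large or small. This takes the place of properness of the
  action.\<close>

lemma approximate_schur:
  assumes "0 < \<eta>"
  obtains \<delta> where "0 < \<delta>" "\<And>y y' P. \<lbrakk>dist y x0 < \<delta>; dist y' x0 < \<delta>; plm P y = prm y' P; P \<noteq> 0\<rbrakk> \<Longrightarrow>
    \<exists>c X. c \<noteq> 0 \<and> P = c *\<^sub>R (mat 1 + X) \<and> tau X = 0 \<and> norm X < \<eta>"
proof -
  obtain l where l: "linear l" "\<And>X. l (adx X) = X - (tau X / 2) *\<^sub>R mat 1"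
    by (rule slice_projection) blast
  have "bounded_linear l" using l(1) by (simp add: linear_conv_bounded_linear)
  then obtain K0 where K0: "0 < K0" "\<And>w. norm (l w) \<le> norm w * K0"
    using bounded_linear.pos_bounded by blast
  obtain K1 where K1: "0 < K1" "\<And>P w. norm (plm P w) \<le> norm P * norm w * K1"
    using pair.lm.pos_bounded by blast
  obtain K2 where K2: "0 < K2" "\<And>w P. norm (prm w P) \<le> norm w * norm P * K2"
    using pair.rm.pos_bounded by blast
  define K where "K = K0 * (K1 + K2)"
  have K: "0 < K" using K0(1) K1(1) K2(1) by (simp add: K_def)
  \<comment> \<open>The trace-free part of \<open>P\<close> will be at most \<open>\<theta> * norm P\<close>. The bound 1/2 makes \<open>norm P\<close> comparable with the
      scalar part of \<open>P\<close>, and the other one makes the quotient of the two parts smaller than \<open>\<eta>\<close>.\<close>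
  define \<theta> where "\<theta> = min (1/2) (\<eta> / (4 * norm (mat 1 :: qmat)))"
  have n1: "0 < norm (mat 1 :: qmat)" by (simp add: qmat_eq_iff)
  have \<theta>: "0 < \<theta>" "\<theta> \<le> 1/2" "\<theta> * norm (mat 1 :: qmat) \<le> \<eta> / 4"
    using \<open>0 < \<eta>\<close> n1 by (auto simp: \<theta>_def min_def field_simps)
  show thesis
  proof (rule that[of "\<theta> / K"])
    show "0 < \<theta> / K" using \<theta> K by simp
    fix y y' P assume h: "dist y x0 < \<theta> / K" "dist y' x0 < \<theta> / K" "plm P y = prm y' P" "P \<noteq> 0"
    define p where "p = tau P / 2"
    define Y where "Y = P - p *\<^sub>R mat 1"
    have lY: "l (adx P) = Y" by (simp add: l(2) Y_def p_def)
    have "adx P = prm (x0 - y') P + plm P (y - x0)"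
      by (simp add: pair.ad_def pair.rm.diff_left pair.lm.diff_right h(3))
    then have "norm (adx P) \<le> norm (prm (x0 - y') P) + norm (plm P (y - x0))"
      by (simp only: norm_triangle_ineq)
    also have "\<dots> \<le> norm (x0 - y') * norm P * K2 + norm P * norm (y - x0) * K1"
      by (intro add_mono K1(2) K2(2))
    also have "\<dots> \<le> (\<theta> / K) * norm P * K2 + norm P * (\<theta> / K) * K1"
      using h(1,2) K1(1) K2(1)
      by (intro add_mono mult_right_mono mult_left_mono) (auto simp: dist_norm norm_minus_commute)
    also have "\<dots> = ((\<theta> / K) * (K1 + K2)) * norm P"
      by (simp add: algebra_simps add_divide_distrib)
    also have "(\<theta> / K) * (K1 + K2) = \<theta> / K0"
    proof -
      have "K1 + K2 \<noteq> 0" using K1(1) K2(1) by linarith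
      then show ?thesis by (simp add: K_def)
    qed
    finally have small: "norm (adx P) \<le> (\<theta> / K0) * norm P" .
    have "norm Y \<le> norm (adx P) * K0"
      using K0(2)[of "adx P"] by (simp only: lY)
    also have "\<dots> \<le> (\<theta> / K0) * norm P * K0"
      by (rule mult_right_mono[OF small]) (use K0(1) in simp)
    finally have Y: "norm Y \<le> \<theta> * norm P" using K0(1) by simp
    have "norm P \<le> norm Y + \<bar>p\<bar> * norm (mat 1 :: qmat)"
      using norm_triangle_ineq[of Y "p *\<^sub>R mat 1"] by (simp add: Y_def)
    moreover have "\<theta> * norm P \<le> (1/2) * norm P" using \<theta>(2) by (rule mult_right_mono) simp
    ultimately have P2: "norm P \<le> 2 * \<bar>p\<bar> * norm (mat 1 :: qmat)" using Y by linarith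
    have p0: "p \<noteq> 0" using P2 h(4) by auto
    define X where "X = (1 / p) *\<^sub>R Y"
    have "norm X = norm Y / \<bar>p\<bar>" by (simp add: X_def)
    also have "\<dots> \<le> \<theta> * (2 * \<bar>p\<bar> * norm (mat 1 :: qmat)) / \<bar>p\<bar>"
      using Y P2 \<theta>(1) by (intro divide_right_mono order_trans[OF Y] mult_left_mono) auto
    also have "\<dots> = 2 * (\<theta> * norm (mat 1 :: qmat))" using p0 by simp
    also have "\<dots> < \<eta>" using \<theta>(3) \<open>0 < \<eta>\<close> by linarith
    finally have "norm X < \<eta>" .
    moreover have "P = p *\<^sub>R (mat 1 + X)"
      using p0 by (simp add: X_def Y_def algebra_simps)
    moreover have "tau X = 0" by (simp add: X_def Y_def p_def)
    ultimately show "\<exists>c X. c \<noteq> 0 \<and> P = c *\<^sub>R (mat 1 + X) \<and> tau X = 0 \<and> norm X < \<eta>"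
      using p0 by blast
  qed
qed

text \<open>The kernel of the differential of the invariants has dimension 21 and contains the orbit directions,
  of dimension 15; let \<open>E\<close> be the orthogonal complement in it, of dimension 6. In the straightening
  chart \<open>E\<close> parametrizes the points \<open>x0 + z\<close> of \<open>R\<close> with \<open>z\<close> orthogonal to the orbit of \<open>x0\<close>; this is the
  map \<open>\<sigma>\<close>. The local slice theorem conjugates every point near \<open>x0\<close> to a point of this form, which
  defines \<open>h\<close>. If two slice points lie in one orbit, then by the approximate Schur lemma a scalar
  multiple of the conjugating matrix is \<open>1 + X\<close> with small \<open>X\<close> of trace zero, and the uniqueness part of
  the local slice theorem shows that the points are equal.\<close>

theorem slice_chart:
  obtains U0 :: "(real^6) set" and \<sigma> N h where
    "open U0" "connected U0" "0 \<in> U0" "\<sigma> 0 = x0" "\<forall>u\<in>U0. hol_ext \<sigma> u" "\<sigma> ` U0 \<subseteq> R"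
    "open N" "\<sigma> ` U0 \<subseteq> N" "\<forall>y\<in>N. hol_ext h y" "\<forall>u\<in>U0. h (\<sigma> u) = u"
    "\<forall>y\<in>R \<inter> N. h y \<in> U0 \<longrightarrow> conj_orbit (\<sigma> (h y)) = conj_orbit y"
    "\<forall>u\<in>U0. \<forall>u'\<in>U0. conj_orbit (\<sigma> u) = conj_orbit (\<sigma> u') \<longrightarrow> u = u'"
proof -
  obtain N0 where N0: "open N0" "x0 \<in> N0" "\<forall>y\<in>N0. y \<in> R \<longleftrightarrow> invariants y = invariants x0"
    by (rule rep_set_level_set[OF SL C_eq cyc])
  have surj: "surj (invariants' x0)" by (rule invariants'_surjective[OF cyc cent])
  obtain f r U V g where f_eq: "f = (\<lambda>y. (y - x0) + r (invariants y - invariants x0 - invariants' x0 (y - x0)))"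
    and r: "linear r" "\<forall>c v. invariants' x0 v = 0 \<longrightarrow> inner v (r c) = 0"
    and f: "\<forall>y. invariants' x0 (f y) = invariants y - invariants x0" "entire_ext f"
    and UV: "open U" "open V" "x0 \<in> U" "U \<subseteq> N0" "homeomorphism U V f g" "\<forall>y\<in>V. hol_ext g y"
    by (rule straightening_chart[OF entire_ext_invariants invariants_has_derivative surj N0(1,2)])
  have gf: "g (f y) = y" "f y \<in> V" if "y \<in> U" for y
    using UV(5) that unfolding homeomorphism_def by auto
  have fg: "f (g v) = v" "g v \<in> U" if "v \<in> V" for v
    using UV(5) that unfolding homeomorphism_def by auto
  have f0: "f x0 = 0" by (simp add: f_eq linear_0[OF r(1)] linear_0[OF linear_invariants'])
  have f_orth: "inner (adx X) (f y) = inner (adx X) (y - x0)" for X y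
  proof -
    have "inner (adx X) (r c) = 0" for c using r(2) invariants'_adx by blast
    then show ?thesis by (simp add: f_eq inner_add_right)
  qed
  have RU: "y \<in> R \<longleftrightarrow> invariants' x0 (f y) = 0" if "y \<in> U" for y
  proof -
    have "invariants' x0 (f y) = invariants y - invariants x0" using f(1) by blast
    then show ?thesis using that UV(4) N0(3) by auto
  qed
  define L where "L = {v. invariants' x0 v = 0}"
  define E where "E = {y \<in> L. \<forall>x\<in>range adx. orthogonal x y}"
  have E_iff: "v \<in> E \<longleftrightarrow> invariants' x0 v = 0 \<and> (\<forall>X. inner (adx X) v = 0)" for v
    by (auto simp: E_def L_def orthogonal_def)
  have subL: "subspace L" unfolding L_def by (rule real_vector.linear_subspace_kernel[OF linear_invariants'])
  have dimL: "dim L = 21"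
    using rank_nullity[OF linear_invariants'[of x0]] surj by (simp add: L_def DIM_quat)
  have "dim E + dim (range adx) = dim L"
    unfolding E_def
    by (rule dim_subspace_orthogonal_to_vectors[OF linear_subspace_image[OF pair.linear_ad subspace_UNIV] subL])
       (auto simp: L_def invariants'_adx)
  then have dimE: "dim E = 6" by (simp add: dimL dim_orbit_directions)
  have subE: "subspace E"
    unfolding subspace_def
    by (auto simp: E_iff linear_add[OF linear_invariants'] linear_0[OF linear_invariants'] linear_scale[OF linear_invariants']
        inner_add_right)
  have dim6: "dim (UNIV :: (real^6) set) = dim E" by (simp add: dimE)
  obtain \<epsilon> e where \<epsilon>: "linear \<epsilon>" "linear e" "\<epsilon> ` (UNIV :: (real^6) set) = E"
    "\<forall>u. e (\<epsilon> u) = u" "\<forall>v\<in>E. \<epsilon> (e v) = v"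
    by (rule isometries_subspaces[OF subspace_UNIV subE dim6]) blast
  obtain l where l: "linear l" "\<And>X. l (adx X) = X - (tau X / 2) *\<^sub>R mat 1"
    "\<And>w. (\<And>X. inner (adx X) w = 0) \<Longrightarrow> l w = 0" "\<And>w. tau (l w) = 0"
    "\<And>w X. l w = 0 \<Longrightarrow> inner (adx X) w = 0"
    using slice_projection by blast
  have sliced_iff: "pair.sliced x0 l y X z \<longleftrightarrow>
      prm y (mat 1 + X) = plm (mat 1 + X) (x0 + z) \<and> tau X = 0 \<and> (\<forall>X. inner (adx X) z = 0)" for y X z
  proof -
    have "X - l (adx X) + l z = 0 \<longleftrightarrow> tau X = 0 \<and> l z = 0"
    proof
      assume a: "X - l (adx X) + l z = 0"
      then have "tau ((tau X / 2) *\<^sub>R mat 1 + l z) = 0" by (simp add: l(2))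
      then have "tau X = 0" by (simp add: l(4))
      with a show "tau X = 0 \<and> l z = 0" by (simp add: l(2))
    qed (simp add: l(2))
    moreover have "l z = 0 \<longleftrightarrow> (\<forall>X. inner (adx X) z = 0)" using l(3,5) by blast
    ultimately show ?thesis unfolding pair.sliced_def by blast
  qed
  obtain \<delta> where \<delta>: "0 < \<delta>" "\<forall>X::qmat. norm X < \<delta> \<longrightarrow> invertible (mat 1 + X)"
    by (rule invertible_near_one)
  obtain \<eta> where \<eta>: "0 < \<eta>" "ball x0 \<eta> \<subseteq> U" using UV(1,3) by (rule openE)
  have "0 < min \<delta> \<eta>" using \<delta> \<eta> by simp
  then obtain N s \<rho> where N: "open N" "x0 \<in> N" "\<forall>y\<in>N. hol_ext s y"
    "\<forall>y\<in>N. pair.sliced x0 l y (fst (s y)) (snd (s y)) \<and> norm (fst (s y)) < min \<delta> \<eta> \<and> norm (snd (s y)) < min \<delta> \<eta>"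
    "0 < \<rho>" "\<forall>y\<in>N. \<forall>X z. norm X < \<rho> \<longrightarrow> norm z < \<rho> \<longrightarrow> pair.sliced x0 l y X z \<longrightarrow> s y = (X, z)"
    by (rule pair.local_slice[OF l(1)])
  define h where "h y = e (f (x0 + snd (s y)))" for y
  define \<sigma> where "\<sigma> u = g (\<epsilon> u)" for u
  have holh: "hol_ext h y" if y: "y \<in> N" for y
  proof -
    have "entire_ext (\<lambda>w::qmat \<times> qmat \<times> qmat. x0 + snd w)" by (intro entire_ext_intros)
    then have 1: "hol_ext (\<lambda>y. x0 + snd (s y)) y"
      using N(3) y by (intro hol_ext_entire_compose[of s y "\<lambda>w. x0 + snd w"]) auto
    show ?thesis
      unfolding h_def[abs_def]
      by (rule hol_ext_entire_compose[OF hol_ext_entire_compose[OF 1 f(2)] entire_ext_linear[OF \<epsilon>(2)]])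
  qed
  have hol\<sigma>: "hol_ext \<sigma> u" if "\<epsilon> u \<in> V" for u
    unfolding \<sigma>_def[abs_def]
    by (rule hol_ext_compose[OF hol_ext_linear[OF \<epsilon>(1)]]) (use UV(6) that in blast)
  have \<epsilon>E: "\<epsilon> u \<in> E" for u using \<epsilon>(3) by blast
  have f\<sigma>: "f (\<sigma> u) = \<epsilon> u" "\<sigma> u \<in> U" if "\<epsilon> u \<in> V" for u
    using fg[OF that] by (simp_all add: \<sigma>_def)
  have \<sigma>R: "\<sigma> u \<in> R" if "\<epsilon> u \<in> V" for u
    using RU[OF f\<sigma>(2)[OF that]] f\<sigma>(1)[OF that] \<epsilon>E[of u] by (simp add: E_iff)
  have \<sigma>orth: "inner (adx X) (\<sigma> u - x0) = 0" if "\<epsilon> u \<in> V" for u X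
    using f_orth[of X "\<sigma> u"] f\<sigma>(1)[OF that] \<epsilon>E[of u] by (simp add: E_iff)
  obtain \<delta>' where \<delta>': "0 < \<delta>'" "\<And>y y' P. \<lbrakk>dist y x0 < \<delta>'; dist y' x0 < \<delta>'; plm P y = prm y' P; P \<noteq> 0\<rbrakk> \<Longrightarrow>
    \<exists>c X. c \<noteq> 0 \<and> P = c *\<^sub>R (mat 1 + X) \<and> tau X = 0 \<and> norm X < \<rho>"
    using approximate_schur[OF N(5)] by blast
  \<comment> \<open>The chart domain is a ball so small that its slice points lie in the domain of \<open>h\<close> and satisfy the
      smallness conditions of the approximate Schur lemma and of the uniqueness of local slices.\<close>
  define V' where "V' = {u. \<epsilon> u \<in> V}"
  have "continuous_on UNIV \<epsilon>" by (rule linear_continuous_on) (simp add: \<epsilon>(1) flip: linear_conv_bounded_linear)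
  from open_vimage[OF UV(2) this] have oV': "open V'" by (simp add: V'_def vimage_def)
  have cont\<sigma>: "continuous_on V' \<sigma>"
    using hol\<sigma> hol_ext_continuous by (auto simp: V'_def intro!: continuous_at_imp_continuous_on)
  have \<epsilon>0: "\<epsilon> 0 = 0" by (rule linear_0[OF \<epsilon>(1)])
  have \<sigma>0: "\<sigma> 0 = x0" using gf(1)[OF UV(3)] by (simp add: \<sigma>_def \<epsilon>0 f0)
  have V'0: "0 \<in> V'" using gf(2)[OF UV(3)] by (simp add: V'_def \<epsilon>0 f0)
  have "open (V' \<inter> \<sigma> -` (N \<inter> ball x0 (min \<delta>' \<rho>)))"
    by (intro continuous_open_preimage cont\<sigma> oV' open_Int N(1) open_ball)
  moreover have "0 \<in> V' \<inter> \<sigma> -` (N \<inter> ball x0 (min \<delta>' \<rho>))"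
    using V'0 N(2,5) \<delta>'(1) by (simp add: \<sigma>0)
  ultimately obtain \<kappa> where \<kappa>: "0 < \<kappa>" "ball 0 \<kappa> \<subseteq> V' \<inter> \<sigma> -` (N \<inter> ball x0 (min \<delta>' \<rho>))"
    by (rule openE)
  define U0 where "U0 = ball (0 :: real^6) \<kappa>"
  have U0: "\<epsilon> u \<in> V" "\<sigma> u \<in> N" "dist (\<sigma> u) x0 < \<delta>'" "norm (\<sigma> u - x0) < \<rho>" if "u \<in> U0" for u
  proof -
    have "u \<in> V' \<inter> \<sigma> -` (N \<inter> ball x0 (min \<delta>' \<rho>))"
      using that by (intro subsetD[OF \<kappa>(2)]) (simp add: U0_def)
    then have "\<epsilon> u \<in> V" "\<sigma> u \<in> N" "dist (\<sigma> u) x0 < \<delta>'" "dist (\<sigma> u) x0 < \<rho>"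
      by (simp_all add: V'_def dist_commute)
    then show "\<epsilon> u \<in> V" "\<sigma> u \<in> N" "dist (\<sigma> u) x0 < \<delta>'" "norm (\<sigma> u - x0) < \<rho>"
      by (simp_all add: dist_norm)
  qed
  have s\<sigma>: "s (\<sigma> u) = (0, \<sigma> u - x0)" if u: "u \<in> U0" for u
  proof -
    have "pair.sliced x0 l (\<sigma> u) 0 (\<sigma> u - x0)"
      using \<sigma>orth[OF U0(1)[OF u]] by (simp add: sliced_iff)
    moreover have "norm (0 :: qmat) < \<rho>" using N(5) by simp
    ultimately show ?thesis using N(6) U0(2,4)[OF u] by blast
  qed
  have h\<sigma>: "h (\<sigma> u) = u" if u: "u \<in> U0" for u
    using s\<sigma>[OF u] f\<sigma>(1)[OF U0(1)[OF u]] \<epsilon>(4) by (simp add: h_def)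
  have orbit: "conj_orbit (\<sigma> (h y)) = conj_orbit y" if y: "y \<in> R \<inter> N" for y
  proof -
    define X z where "X = fst (s y)" and "z = snd (s y)"
    have sl: "prm y (mat 1 + X) = plm (mat 1 + X) (x0 + z)" "\<And>X. inner (adx X) z = 0"
      "norm X < \<delta>" "norm z < \<eta>"
      using N(4) y by (auto simp: X_def z_def sliced_iff)
    have iX: "invertible (mat 1 + X)" using \<delta>(2) sl(3) by blast
    have zU: "x0 + z \<in> U" using \<eta>(2) sl(4) by (auto simp: dist_norm)
    have y_eq: "pconj (mat 1 + X) (x0 + z) = y"
      by (simp only: pconj_eq_iff[OF iX] sl(1))
    have "x0 + z = pconj (matrix_inv (mat 1 + X)) y"
      using pconj_inverse(1)[OF iX, of "x0 + z"] by (simp only: y_eq)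
    then have "x0 + z \<in> R"
      using rep_set_similar[OF SL C_eq invertible_matrix_inv[OF iX] pconj_similar[OF invertible_matrix_inv[OF iX]]] y
      by simp
    then have "invariants' x0 (f (x0 + z)) = 0" using RU[OF zU] by simp
    moreover have "inner (adx X) (f (x0 + z)) = 0" for X using f_orth[of X "x0 + z"] sl(2) by simp
    ultimately have "f (x0 + z) \<in> E" by (simp add: E_iff)
    then have "\<sigma> (h y) = x0 + z"
      using \<epsilon>(5) gf(1)[OF zU] by (simp add: \<sigma>_def h_def z_def)
    then show ?thesis using conj_orbit_pconj[OF iX, of "x0 + z"] by (simp only: y_eq)
  qed
  have inj: "u = u'" if u: "u \<in> U0" "u' \<in> U0" and o: "conj_orbit (\<sigma> u) = conj_orbit (\<sigma> u')" for u u'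
  proof -
    obtain P where P: "invertible P" "\<sigma> u' = pconj P (\<sigma> u)"
      by (rule conj_orbit_eq_obtains[OF o])
    have PP: "plm P (\<sigma> u) = prm (\<sigma> u') P" using pconj_similar[OF P(1)] by (simp add: P(2))
    have "P \<noteq> 0" using qdet_pos[OF P(1)] by (auto simp: qdet_def)
    then obtain c X where cX: "c \<noteq> 0" "P = c *\<^sub>R (mat 1 + X)" "tau X = 0" "norm X < \<rho>"
      using \<delta>'(2)[OF U0(3)[OF u(1)] U0(3)[OF u(2)] PP] by blast
    have "c *\<^sub>R plm (mat 1 + X) (\<sigma> u) = c *\<^sub>R prm (\<sigma> u') (mat 1 + X)"
      using PP unfolding cX(2) by (simp only: pair.lm.scaleR_left pair.rm.scaleR_right)
    then have "plm (mat 1 + X) (\<sigma> u) = prm (\<sigma> u') (mat 1 + X)" using cX(1) by simp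
    then have "pair.sliced x0 l (\<sigma> u') X (\<sigma> u - x0)"
      using \<sigma>orth[OF U0(1)[OF u(1)]] cX(3) by (simp add: sliced_iff)
    then have "s (\<sigma> u') = (X, \<sigma> u - x0)"
      using N(6) U0(2)[OF u(2)] U0(4)[OF u(1)] cX(4) by blast
    then have "\<sigma> u = \<sigma> u'" using s\<sigma>[OF u(2)] by simp
    then show ?thesis using h\<sigma> u by metis
  qed
  show thesis
  proof (rule that[of U0 \<sigma> N h])
    show "0 \<in> U0" using \<kappa>(1) by (simp add: U0_def)
    show "\<forall>u\<in>U0. hol_ext \<sigma> u" using hol\<sigma> U0(1) by blast
    show "\<sigma> ` U0 \<subseteq> R" "\<sigma> ` U0 \<subseteq> N" using \<sigma>R U0(1,2) by blast+
    show "\<forall>y\<in>N. hol_ext h y" using holh by blast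
    show "\<forall>u\<in>U0. h (\<sigma> u) = u" using h\<sigma> by blast
    show "\<forall>y\<in>R \<inter> N. h y \<in> U0 \<longrightarrow> conj_orbit (\<sigma> (h y)) = conj_orbit y" using orbit by blast
    show "\<forall>u\<in>U0. \<forall>u'\<in>U0. conj_orbit (\<sigma> u) = conj_orbit (\<sigma> u') \<longrightarrow> u = u'" using inj by blast
  qed (simp_all add: U0_def N(1) \<sigma>0)
qed

end

lemma second_countable_euclidean:
  "second_countable (euclidean :: 'a::second_countable_topology topology)"
proof -
  obtain \<B> :: "'a set set" where \<B>: "countable \<B>" "\<And>C. C \<in> \<B> \<Longrightarrow> open C"
    "\<And>S. open S \<Longrightarrow> \<exists>U. U \<subseteq> \<B> \<and> S = \<Union>U"
    by (rule univ_second_countable) blast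
  have "\<exists>V\<in>\<B>. x \<in> V \<and> V \<subseteq> U" if U: "open U" "x \<in> U" for U x
  proof -
    obtain \<U> where "\<U> \<subseteq> \<B>" "U = \<Union>\<U>" using \<B>(3)[OF U(1)] by blast
    then show ?thesis using U(2) by blast
  qed
  then show ?thesis
    unfolding second_countable_def using \<B>(1,2) by (intro exI[of _ \<B>]) auto
qed

lemma trivial_chart_group:
  "subgroup {\<lambda>x\<in>U. x} (BijGroup U)"
proof -
  have "\<one>\<^bsub>BijGroup U\<^esub> = (\<lambda>x\<in>U. x)" by (simp add: BijGroup_def)
  then show ?thesis
    using group.triv_subgroup[OF group_BijGroup[of U]] by simp
qed

lemma real_analytic_identity:
  assumes "open U" shows "real_analytic_on (\<lambda>x\<in>U. x) U"
  unfolding real_analytic_on_def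
proof
  fix p assume p: "p \<in> U"
  have "hol_ext (\<lambda>x\<in>U. x) p"
    by (rule hol_ext_cong[OF entire_ext_imp_hol_ext[OF entire_ext_ident] assms p]) simp
  then show "real_analytic_at (\<lambda>x\<in>U. x) p" by (rule hol_ext_imp_real_analytic)
qed

lemma analytic_diffeo_identity:
  assumes "open U" shows "analytic_diffeo (\<lambda>x. x) U U"
proof (rule analytic_diffeoI[OF assms assms])
  show "homeomorphism U U (\<lambda>x. x) (\<lambda>x. x)" by (simp add: homeomorphism_def)
qed (rule entire_ext_imp_hol_ext[OF entire_ext_ident])+

text \<open>A quotient map that is injective is a chart with the trivial group. The members of \<^const>\<open>BijGroup\<close>
  are functions restricted to \<open>U\<close>, which is why the identity appears in restricted form.\<close>

lemma single_chart_orbifold: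
  fixes U :: "'v::euclidean_space set" and \<phi> :: "'v \<Rightarrow> 'x"
  assumes U: "open U" "connected U" "U \<noteq> {}"
    and q: "quotient_map (top_of_set U) X \<phi>" and inj: "inj_on \<phi> U"
  shows "analytic_orbifold X {(U, {\<lambda>x\<in>U. x}, \<phi>)}"
proof -
  have top: "topspace X = \<phi> ` U"
    using q by (auto simp: quotient_map_def)
  have homeo: "homeomorphic_map (top_of_set U) X \<phi>"
    using q inj by (simp add: homeomorphic_map_def)
  have haus: "Hausdorff_space X"
    using homeomorphic_Hausdorff_space[OF homeomorphic_map_imp_homeomorphic_space[OF homeo]]
    by (simp add: Hausdorff_space_subtopology)
  have sc: "second_countable X"
    by (rule second_countable_open_map_image[of "top_of_set U" X \<phi>])
       (use homeo in \<open>simp_all add: homeomorphic_eq_everything_map second_countable_subtopology second_countable_euclidean\<close>)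
  have sub: "subtopology X (\<phi> ` U) = X"
    using top by (metis subtopology_topspace)
  have chart: "orbifold_chart X (U, {\<lambda>x\<in>U. x}, \<phi>)"
    unfolding orbifold_chart_def
    using U q inj top sub trivial_chart_group[of U] real_analytic_identity[OF U(1)] openin_topspace[of X]
    by (auto simp: inj_on_def)
  have emb: "chart_embedding (\<lambda>x. x) (U, {\<lambda>x\<in>U. x}, \<phi>) (U, {\<lambda>x\<in>U. x}, \<phi>)"
    unfolding chart_embedding_def using analytic_diffeo_identity[OF U(1)] by auto
  show ?thesis
    unfolding analytic_orbifold_def using haus sc chart emb
    by (auto simp: chart_image_def top)
qed

context schur_pair
begin

text \<open>The slice meets each orbit near that of \<open>(A, B)\<close> in exactly one point, so it is a chart with trivial
  group. For a point \<open>x\<close> of such an orbit, anywhere in \<open>R\<close>, a fixed conjugation carries \<open>x\<close> to the slice;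
  followed by the retraction \<open>h\<close> it lifts the orbit projection to the chart near \<open>x\<close>. These lifts show
  that the chart map is open and that the projection is an analytic submersion.\<close>

theorem rep_quotient_orbifold:
  "\<exists>N (\<A> :: (real^6, (qmat \<times> qmat) set) orb_chart set).
     openin (rep_quotient A B C) N \<and> conj_orbit (A, B) \<in> N \<and>
     analytic_orbifold (subtopology (rep_quotient A B C) N) \<A> \<and>
     orbifold_submersion {x \<in> rep_set A B C. conj_orbit x \<in> N} conj_orbit \<A>"
proof -
  obtain U0 :: "(real^6) set" and \<sigma> W h where
    U0: "open U0" "connected U0" "0 \<in> U0" and \<sigma>: "\<sigma> 0 = x0" "\<forall>u\<in>U0. hol_ext \<sigma> u" "\<sigma> ` U0 \<subseteq> R"
    and W: "open W" "\<sigma> ` U0 \<subseteq> W" and h: "\<forall>y\<in>W. hol_ext h y" "\<forall>u\<in>U0. h (\<sigma> u) = u"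
    "\<forall>y\<in>R \<inter> W. h y \<in> U0 \<longrightarrow> conj_orbit (\<sigma> (h y)) = conj_orbit y"
    and inj: "\<forall>u\<in>U0. \<forall>u'\<in>U0. conj_orbit (\<sigma> u) = conj_orbit (\<sigma> u') \<longrightarrow> u = u'"
    by (rule slice_chart)
  define \<phi> where "\<phi> u = conj_orbit (\<sigma> u)" for u
  define N where "N = \<phi> ` U0"
  define M where "M = {x \<in> R. conj_orbit x \<in> N}"
  have conth: "continuous_on W h"
    using h(1) hol_ext_continuous by (auto intro!: continuous_at_imp_continuous_on)
  have cont\<sigma>: "continuous_on U0 \<sigma>"
    using \<sigma>(2) hol_ext_continuous by (auto intro!: continuous_at_imp_continuous_on)
  have pconjR: "pconj P y \<in> R" if "invertible P" "y \<in> R" for P y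
    using rep_set_similar[OF SL C_eq that(1) pconj_similar[OF that(1)] that(2)] .
  have contp: "continuous_on UNIV (pconj P)" for P
    by (rule linear_continuous_on) (simp add: linear_pconj flip: linear_conv_bounded_linear)

  have lift: "\<exists>P W'. invertible P \<and> x = pconj P (\<sigma> u) \<and> open W' \<and> x \<in> W' \<and>
      (\<forall>y\<in>W'. pconj (matrix_inv P) y \<in> W \<and> h (pconj (matrix_inv P) y) \<in> U') \<and>
      (\<forall>y\<in>R \<inter> W'. \<phi> (h (pconj (matrix_inv P) y)) = conj_orbit y)"
    if x: "conj_orbit x = \<phi> u" "u \<in> U'" and U': "open U'" "U' \<subseteq> U0" for x u U'
  proof -
    have "conj_orbit (\<sigma> u) = conj_orbit x" using x(1) by (simp add: \<phi>_def)
    then obtain P where P: "invertible P" "x = pconj P (\<sigma> u)" by (rule conj_orbit_eq_obtains)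
    have iP: "invertible (matrix_inv P)" by (rule invertible_matrix_inv[OF P(1)])
    have pulled: "pconj (matrix_inv P) x = \<sigma> u" using P by (simp add: pconj_inverse)
    define W' where "W' = pconj (matrix_inv P) -` (W \<inter> h -` U')"
    have "open (W \<inter> h -` U')" by (rule continuous_open_preimage[OF conth W(1) U'(1)])
    then have oW': "open W'" unfolding W'_def by (rule open_vimage[OF _ contp])
    have xW': "x \<in> W'"
    proof -
      have "\<sigma> u \<in> W" "h (\<sigma> u) = u" using W(2) h(2) x(2) U'(2) by blast+
      then show ?thesis using x(2) by (simp add: W'_def pulled)
    qed
    have "\<phi> (h (pconj (matrix_inv P) y)) = conj_orbit y" if y: "y \<in> R \<inter> W'" for y
    proof -
      have "pconj (matrix_inv P) y \<in> R \<inter> W" "h (pconj (matrix_inv P) y) \<in> U0"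
        using y U'(2) pconjR[OF iP] by (auto simp: W'_def)
      then have "\<phi> (h (pconj (matrix_inv P) y)) = conj_orbit (pconj (matrix_inv P) y)"
        using h(3) by (simp add: \<phi>_def)
      then show ?thesis by (simp add: conj_orbit_pconj[OF iP])
    qed
    then show ?thesis
      using P oW' xW' by (intro exI[of _ P] exI[of _ W']) (auto simp: W'_def)
  qed

  have \<phi>_open: "openin (rep_quotient A B C) (\<phi> ` U')" if U': "open U'" "U' \<subseteq> U0" for U'
    unfolding openin_rep_quotient
  proof
    show "\<phi> ` U' \<subseteq> conj_orbit ` R"
      using \<sigma>(3) U'(2) by (auto simp: \<phi>_def)
    show "openin (top_of_set R) {x \<in> R. conj_orbit x \<in> \<phi> ` U'}"
    proof (subst openin_subopen, intro ballI)
      fix x assume "x \<in> {x \<in> R. conj_orbit x \<in> \<phi> ` U'}"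
      then obtain u where u: "x \<in> R" "conj_orbit x = \<phi> u" "u \<in> U'" by blast
      obtain P W' where P: "open W'" "x \<in> W'" "\<forall>y\<in>W'. h (pconj (matrix_inv P) y) \<in> U'"
        "\<forall>y\<in>R \<inter> W'. \<phi> (h (pconj (matrix_inv P) y)) = conj_orbit y"
        using lift[OF u(2,3) U'] by blast
      have "R \<inter> W' \<subseteq> {x \<in> R. conj_orbit x \<in> \<phi> ` U'}"
        using P(3,4) by force
      then show "\<exists>T. openin (top_of_set R) T \<and> x \<in> T \<and> T \<subseteq> {x \<in> R. conj_orbit x \<in> \<phi> ` U'}"
        using P(1,2) u(1) by (intro exI[of _ "R \<inter> W'"]) (auto simp: openin_open)
    qed
  qed
  have N_open: "openin (rep_quotient A B C) N"
    unfolding N_def by (rule \<phi>_open[OF U0(1) subset_refl])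
  have x0N: "conj_orbit (A, B) \<in> N"
    unfolding N_def using U0(3) \<sigma>(1) by (intro image_eqI[of _ _ 0]) (auto simp: \<phi>_def)
  have inj\<phi>: "inj_on \<phi> U0"
    using inj by (auto simp: inj_on_def \<phi>_def)
  have topN: "topspace (subtopology (rep_quotient A B C) N) = N"
    using openin_subset[OF N_open] by auto
  have quot: "quotient_map (top_of_set U0) (subtopology (rep_quotient A B C) N) \<phi>"
    unfolding quotient_map_def topN
  proof (intro conjI allI impI)
    show "\<phi> ` topspace (top_of_set U0) = N" by (simp add: N_def)
    fix S assume S: "S \<subseteq> N"
    have S_eq: "S = \<phi> ` {u \<in> U0. \<phi> u \<in> S}" using S by (auto simp: N_def)
    show "openin (top_of_set U0) {x \<in> topspace (top_of_set U0). \<phi> x \<in> S} =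
        openin (subtopology (rep_quotient A B C) N) S"
    proof
      assume "openin (top_of_set U0) {x \<in> topspace (top_of_set U0). \<phi> x \<in> S}"
      then have "open {u \<in> U0. \<phi> u \<in> S}"
        using openin_open_eq[OF U0(1)] by auto
      then have "openin (rep_quotient A B C) S"
        using \<phi>_open[of "{u \<in> U0. \<phi> u \<in> S}"] S_eq by auto
      then show "openin (subtopology (rep_quotient A B C) N) S"
        using S by (simp add: openin_open_subtopology[OF N_open])
    next
      assume "openin (subtopology (rep_quotient A B C) N) S"
      then have "openin (rep_quotient A B C) S"
        by (simp add: openin_open_subtopology[OF N_open])
      then have o: "openin (top_of_set R) {x \<in> R. conj_orbit x \<in> S}"
        by (simp add: openin_rep_quotient)
      have "openin (top_of_set U0) (U0 \<inter> \<sigma> -` {x \<in> R. conj_orbit x \<in> S})"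
        by (rule continuous_openin_preimage[OF cont\<sigma> _ o]) (use \<sigma>(3) in auto)
      moreover have "U0 \<inter> \<sigma> -` {x \<in> R. conj_orbit x \<in> S} = {x \<in> topspace (top_of_set U0). \<phi> x \<in> S}"
        using \<sigma>(3) by (auto simp: \<phi>_def)
      ultimately show "openin (top_of_set U0) {x \<in> topspace (top_of_set U0). \<phi> x \<in> S}" by simp
    qed
  qed
  have orb: "analytic_orbifold (subtopology (rep_quotient A B C) N) {(U0, {\<lambda>x\<in>U0. x}, \<phi>)}"
    by (rule single_chart_orbifold[OF U0(1,2) _ quot inj\<phi>]) (use U0(3) in blast)
  have "orbifold_submersion M conj_orbit {(U0, {\<lambda>x\<in>U0. x}, \<phi>)}"
    unfolding orbifold_submersion_def
  proof
    fix x assume x: "x \<in> M"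
    then obtain u where u: "x \<in> R" "conj_orbit x = \<phi> u" "u \<in> U0" by (auto simp: M_def N_def)
    obtain P W' where P: "invertible P" "x = pconj P (\<sigma> u)" "open W'" "x \<in> W'"
      "\<forall>y\<in>W'. pconj (matrix_inv P) y \<in> W \<and> h (pconj (matrix_inv P) y) \<in> U0"
      "\<forall>y\<in>R \<inter> W'. \<phi> (h (pconj (matrix_inv P) y)) = conj_orbit y"
      using lift[OF u(2,3) U0(1) subset_refl] by blast
    define k where "k y = h (pconj (matrix_inv P) y)" for y
    have holk: "hol_ext k y" if "y \<in> W'" for y
      unfolding k_def[abs_def]
      by (rule hol_ext_compose[OF hol_ext_linear[OF linear_pconj]]) (use h(1) P(5) that in blast)
    have "real_analytic_on k W'"
      unfolding real_analytic_on_def using holk hol_ext_imp_real_analytic by blast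
    moreover have "k ` (M \<inter> W') \<subseteq> U0" using P(5) by (auto simp: k_def)
    moreover have "\<forall>y\<in>M \<inter> W'. \<phi> (k y) = conj_orbit y" using P(6) by (auto simp: k_def M_def)
    moreover have "frechet_derivative k (at x) ` tangent_space M x = UNIV"
    proof -
      \<comment> \<open>The conjugated slice is a section of \<open>k\<close> through \<open>x\<close>, so the differential of \<open>k\<close> is onto.\<close>
      define \<gamma> where "\<gamma> w = pconj P (\<sigma> w)" for w
      have hol\<gamma>: "hol_ext \<gamma> u"
        unfolding \<gamma>_def[abs_def]
        by (rule hol_ext_entire_compose[OF _ entire_ext_linear[OF linear_pconj]]) (use \<sigma>(2) u(3) in blast)
      obtain D\<gamma> where D\<gamma>: "(\<gamma> has_derivative D\<gamma>) (at u)"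
        using hol_ext_differentiable[OF hol\<gamma>] unfolding differentiable_def by blast
      have \<gamma>u: "\<gamma> u = x" by (simp add: \<gamma>_def P(2))
      have Dk: "(k has_derivative frechet_derivative k (at x)) (at x)"
        using hol_ext_differentiable[OF holk[OF P(4)]] by (simp add: frechet_derivative_works)
      have \<gamma>M: "\<gamma> ` U0 \<subseteq> M"
      proof
        fix z assume "z \<in> \<gamma> ` U0"
        then obtain w where w: "w \<in> U0" "z = pconj P (\<sigma> w)" by (auto simp: \<gamma>_def)
        have "z \<in> R" using pconjR[OF P(1)] \<sigma>(3) w by blast
        moreover have "conj_orbit z = \<phi> w" by (simp add: w(2) conj_orbit_pconj[OF P(1)] \<phi>_def)
        ultimately show "z \<in> M" using w(1) by (simp add: M_def N_def)
      qed
      have "((\<lambda>w. k (\<gamma> w)) has_derivative (\<lambda>v. frechet_derivative k (at x) (D\<gamma> v))) (at u)"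
        by (rule has_derivative_compose[OF D\<gamma>]) (simp add: \<gamma>u Dk)
      moreover have "((\<lambda>w. k (\<gamma> w)) has_derivative (\<lambda>v. v)) (at u)"
      proof (rule has_derivative_transform_within_open[OF has_derivative_ident U0(1) u(3)])
        fix w assume "w \<in> U0"
        then show "w = k (\<gamma> w)"
          using h(2) by (simp add: k_def \<gamma>_def pconj_inverse[OF P(1)])
      qed
      ultimately have "(\<lambda>v. frechet_derivative k (at x) (D\<gamma> v)) = (\<lambda>v. v)"
        by (rule has_derivative_unique)
      then have "frechet_derivative k (at x) (D\<gamma> v) = v" for v by (rule fun_cong)
      moreover have "D\<gamma> v \<in> tangent_space M x" for v
        using tangent_space_hol_ext[OF hol\<gamma> D\<gamma> U0(1) u(3) \<gamma>M, of v] by (simp add: \<gamma>u)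
      ultimately have "v \<in> frechet_derivative k (at x) ` tangent_space M x" for v
        by (metis imageI)
      then show ?thesis by blast
    qed
    ultimately show "\<exists>(U, \<Gamma>, \<phi>')\<in>{(U0, {\<lambda>x\<in>U0. x}, \<phi>)}. \<exists>W h. open W \<and> x \<in> W \<and> real_analytic_on h W \<and>
      h ` (M \<inter> W) \<subseteq> U \<and> (\<forall>y \<in> M \<inter> W. \<phi>' (h y) = conj_orbit y) \<and>
      frechet_derivative h (at x) ` tangent_space M x = UNIV"
      using P(3,4) by (simp del: ex_simps) blast
  qed
  then show ?thesis
    using N_open x0N orb unfolding M_def by blast
qed

end

theorem lemma7p1:
  fixes A B C :: "quat^2^2"
  assumes "A \<in> SL2H" and "B \<in> SL2H"
    and "regular_loxodromic A" and "regular_loxodromic B"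
    and "C = matrix_inv (A ** B)" and "regular_loxodromic C"
    and "lie_centralizer A \<inter> lie_centralizer B = {0}"
  shows "transverse_at (\<lambda>(A', B'). A' ** B') (conj_class A \<times> conj_class B)
           (conj_class (matrix_inv C)) SL2H (A, B) \<and>
         (\<exists>W. open W \<and> (A, B) \<in> W \<and> analytic_submanifold 21 (rep_set A B C \<inter> W)) \<and>
         (fixed_points A \<inter> fixed_points B = {} \<longrightarrow>
           (\<exists>N (\<A> :: (real^6, (qmat \<times> qmat) set) orb_chart set).
              openin (rep_quotient A B C) N \<and> conj_orbit (A, B) \<in> N \<and>
              analytic_orbifold (subtopology (rep_quotient A B C) N) \<A> \<and>
              orbifold_submersion {x \<in> rep_set A B C. conj_orbit x \<in> N} conj_orbit \<A>))"
proof -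
  have AB: "invertible (A ** B)" using assms(1,2) SL2H_mult SL2H_invertible by blast
  have Cinv: "matrix_inv C = A ** B"
    unfolding assms(5) by (intro matrix_inv_eqI matrix_inv_works AB)
  have cyc: "cyclic A" "cyclic B" "cyclic (A ** B)"
    using regular_loxodromic_cyclic[OF assms(3)] regular_loxodromic_cyclic[OF assms(4)]
      regular_loxodromic_inv_cyclic[OF assms(6)] by (simp_all add: Cinv)
  have cent: "M = (tau M / 2) *\<^sub>R mat 1" if "A ** M = M ** A" "B ** M = M ** B" for M
    using commutant_trivial[OF assms(7,1,2) that] .
  interpret schur_pair A B C
    by unfold_locales (fact assms cyc cent)+
  show ?thesis
    using multiplication_transverse[OF assms(1,2) cent] rep_set_submanifold[OF assms(1,2,5) cyc cent]
      rep_quotient_orbifold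
    by (simp add: Cinv)
qed

end
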